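(* Let $a\in\mathbb{C}$ with $a\neq 0$ be a constant, let $n$, $k$, $n_k$ be positive integers such that $nk\geq 2$, and let $n_j$ $(j=1,2,\ldots,k-1)$ be nonnegative integers. Let $\mathcal{F}$ be a family of holomorphic functions in a plane domain $D\subset\mathbb{C}$ such that each $f\in\mathcal{F}$ has only zeros of multiplicity at least $k$. If for each pair $f,g\in\mathcal{F}$ the functions $f^{n}(f')^{n_1}\cdots(f^{(k)})^{n_k}$ and $g^{n}(g')^{n_1}\cdots(g^{(k)})^{n_k}$ share $a$ in $D$, then $\mathcal{F}$ is normal in $D$.
   Context: Here $f^{(j)}$ denotes the $j$-th derivative, and $f^{n}(f')^{n_1}\cdots(f^{(k)})^{n_k}$ denotes the product $f^{n}\prod_{j=1}^{k}(f^{(j)})^{n_j}$. Two meromorphic functions $F$ and $G$ on $D$ are said to share the finite complex number $a$ (in $D$) if $F-a$ and $G-a$ have the same zeros in $D$, ignoring multiplicities. A family $\mathcal{F}$ of meromorphic (in particular, holomorphic) functions on $D$ is normal in $D$ (in the sense of Montel) if every sequence in $\mathcal{F}$ has a subsequence that converges locally uniformly in $D$ with respect to the spherical metric, to a meromorphic function or to the constant $\infty$. *)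

theory Defs
  imports "HOL-Complex_Analysis.Complex_Analysis"
begin

(* The Riemann sphere is the unit sphere of complex \<times> real (whose product metric is Euclidean).
   The point at infinity is the north pole (0, 1), and the spherical metric is the chordal
   distance, i.e. the restriction of the ambient metric (see dist_stereo, dist_stereo_infinity). *)
definition stereo :: "complex \<Rightarrow> complex \<times> real" where
  "stereo z = ((2 / (1 + (cmod z)\<^sup>2)) *\<^sub>R z, ((cmod z)\<^sup>2 - 1) / ((cmod z)\<^sup>2 + 1))"

definition sphere_infinity :: "complex \<times> real" where
  "sphere_infinity = (0, 1)"

lemma dist_stereo:
  "dist (stereo z) (stereo w) =
     2 * cmod (z - w) / (sqrt (1 + (cmod z)\<^sup>2) * sqrt (1 + (cmod w)\<^sup>2))"
proof -
  define a b where "a = 1 + (cmod z)\<^sup>2" and "b = 1 + (cmod w)\<^sup>2"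
  have pos: "a > 0" "b > 0"
    unfolding a_def b_def by (simp_all add: add_pos_nonneg)
  have az: "(Re z)\<^sup>2 = a - 1 - (Im z)\<^sup>2" and bw: "(Re w)\<^sup>2 = b - 1 - (Im w)\<^sup>2"
    by (simp_all add: a_def b_def cmod_power2)
  have s: "stereo z = ((2 / a) *\<^sub>R z, (a - 2) / a)" "stereo w = ((2 / b) *\<^sub>R w, (b - 2) / b)"
    by (simp_all add: stereo_def a_def b_def add.commute)
  have "(cmod ((2 / a) *\<^sub>R z - (2 / b) *\<^sub>R w))\<^sup>2 + ((a - 2) / a - (b - 2) / b)\<^sup>2
      = 4 * ((Re z - Re w)\<^sup>2 + (Im z - Im w)\<^sup>2) / (a * b)"
  proof -
    have "((cmod ((2 / a) *\<^sub>R z - (2 / b) *\<^sub>R w))\<^sup>2 + ((a - 2) / a - (b - 2) / b)\<^sup>2)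
      = (2 / a * Re z - 2 / b * Re w)\<^sup>2 + (2 / a * Im z - 2 / b * Im w)\<^sup>2
          + ((a - 2) / a - (b - 2) / b)\<^sup>2"
      by (simp add: cmod_power2)
    also have "\<dots> = 4 / a\<^sup>2 * ((Re z)\<^sup>2 + (Im z)\<^sup>2) + 4 / b\<^sup>2 * ((Re w)\<^sup>2 + (Im w)\<^sup>2)
        - 8 / (a * b) * (Re z * Re w + Im z * Im w) + (2 / b - 2 / a)\<^sup>2"
      using pos by (simp add: field_simps power2_eq_square)
    also have "\<dots> = 4 * ((Re z)\<^sup>2 + (Im z)\<^sup>2 + (Re w)\<^sup>2 + (Im w)\<^sup>2
        - 2 * (Re z * Re w + Im z * Im w)) / (a * b)"
      using pos by (simp add: az bw) (simp add: field_simps power2_eq_square)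
    finally show ?thesis
      by (simp add: power2_eq_square algebra_simps)
  qed
  also have "\<dots> = (2 * cmod (z - w) / (sqrt a * sqrt b))\<^sup>2"
    using pos by (simp add: power_divide power_mult_distrib cmod_power2)
  finally have "dist (stereo z) (stereo w) = 2 * cmod (z - w) / (sqrt a * sqrt b)"
    using pos by (simp add: dist_prod_def s dist_norm real_sqrt_abs power2_abs)
  then show ?thesis
    by (simp add: a_def b_def)
qed

lemma dist_stereo_infinity:
  "dist (stereo z) sphere_infinity = 2 / sqrt (1 + (cmod z)\<^sup>2)"
proof -
  define a where "a = 1 + (cmod z)\<^sup>2"
  have pos: "a > 0"
    unfolding a_def by (simp add: add_pos_nonneg)
  have s: "stereo z = ((2 / a) *\<^sub>R z, (a - 2) / a)"
    by (simp add: stereo_def a_def add.commute)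
  have "(cmod ((2 / a) *\<^sub>R z))\<^sup>2 + ((a - 2) / a - 1)\<^sup>2 = 4 / a\<^sup>2 * (a - 1) + (2 / a)\<^sup>2"
  proof -
    have c: "(cmod z)\<^sup>2 = a - 1"
      by (simp add: a_def)
    show ?thesis
      using pos by (simp add: c power_mult_distrib power_divide diff_divide_distrib)
  qed
  also have "\<dots> = (2 / sqrt a)\<^sup>2"
    using pos by (simp add: field_simps power2_eq_square)
  finally have "dist (stereo z) sphere_infinity = 2 / sqrt a"
    using pos by (simp add: dist_prod_def s sphere_infinity_def dist_norm power2_commute[of 1])
  then show ?thesis
    by (simp add: a_def)
qed

(* A meromorphic function as a map into the sphere. The test for a pole is needed because
   the library's meromorphic functions carry an ordinary complex value at their poles. *)
definition sphere_map :: "(complex \<Rightarrow> complex) \<Rightarrow> complex \<Rightarrow> complex \<times> real" where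
  "sphere_map f z = (if is_pole f z then sphere_infinity else stereo (f z))"

definition locally_uniform_limit_on ::
    "complex set \<Rightarrow> (nat \<Rightarrow> complex \<Rightarrow> 'a::metric_space) \<Rightarrow> (complex \<Rightarrow> 'a) \<Rightarrow> bool" where
  "locally_uniform_limit_on D f l \<longleftrightarrow>
     (\<forall>z\<in>D. \<exists>U. open U \<and> z \<in> U \<and> U \<subseteq> D \<and> uniform_limit U f l sequentially)"

definition normal_family_on :: "complex set \<Rightarrow> (complex \<Rightarrow> complex) set \<Rightarrow> bool" where
  "normal_family_on D \<F> \<longleftrightarrow>
     (\<forall>s :: nat \<Rightarrow> complex \<Rightarrow> complex. range s \<subseteq> \<F> \<longrightarrow>
        (\<exists>r :: nat \<Rightarrow> nat. strict_mono r \<and>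
           ((\<exists>h. h nicely_meromorphic_on D \<and>
                 locally_uniform_limit_on D (\<lambda>i. sphere_map (s (r i))) (sphere_map h)) \<or>
            locally_uniform_limit_on D (\<lambda>i. sphere_map (s (r i))) (\<lambda>_. sphere_infinity))))"

(* A pole is not an a-point, whatever value the function is assigned there. *)
definition share_value_on ::
    "complex set \<Rightarrow> complex \<Rightarrow> (complex \<Rightarrow> complex) \<Rightarrow> (complex \<Rightarrow> complex) \<Rightarrow> bool" where
  "share_value_on D a F G \<longleftrightarrow>
     {z \<in> D. \<not> is_pole F z \<and> F z - a = 0} = {z \<in> D. \<not> is_pole G z \<and> G z - a = 0}"

(* Multiplicity of a zero of a holomorphic function. zorder is unspecified for a function
   vanishing identically near the point; such a zero has infinite multiplicity. *)
definition zero_multiplicity :: "(complex \<Rightarrow> complex) \<Rightarrow> complex \<Rightarrow> enat" where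
  "zero_multiplicity f z =
     (if eventually (\<lambda>w. f w = 0) (at z) then \<infinity> else enat (nat (zorder f z)))"

definition diff_monomial ::
    "nat \<Rightarrow> nat \<Rightarrow> (nat \<Rightarrow> nat) \<Rightarrow> (complex \<Rightarrow> complex) \<Rightarrow> complex \<Rightarrow> complex" where
  "diff_monomial n k m f z = f z ^ n * (\<Prod>j=1..k. ((deriv ^^ j) f z) ^ m j)"

end

theory Submission
  imports Defs
begin

text \<open>
  Write \<open>M[f]\<close> for the differential monomial. If the spherical derivatives of the family are not
  locally bounded, the Zalcman-Pang rescaling with exponent \<open>\<alpha> = (\<Sum>j m\<^sub>j) / (n + \<Sum>m\<^sub>j) < k\<close>, for
  which \<open>M\<close> is scale invariant, produces a nonconstant entire limit \<open>g\<close> with bounded spherical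
  derivative and zeros of multiplicity at least \<open>k\<close>. The \<open>a\<close>-points of \<open>M[f]\<close> are the same for all
  members of the family, hence isolated, so by Hurwitz \<open>M[g] - a\<close> has at most one zero (or vanishes
  identically). Nevanlinna theory is not needed to exclude this: by Clunie and Hayman \<open>g\<close> has
  exponential type, so \<open>M[g] - a = P e\<^sup>c\<^sup>z\<close> with a polynomial \<open>P\<close>. Since \<open>nk \<ge> 2\<close>, zeros of \<open>g\<close> are
  multiple zeros of \<open>M[g]\<close>, which makes them finite in number, and everything reduces to the
  independence of exponentials over polynomials.
\<close>

section \<open>Spherical derivative and Marty's criterion\<close>

text \<open>Why the exponent must stay below k: where f behaves like x^v near a zero of order v, the
  scaled spherical derivative is worst for x^v = s^p, where it has size s^(q - p/v). It dies out as
  s tends to 0 precisely when p/q < v. So the bound \<alpha> < k keeps the extremal point of the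
  rescaling away from the degenerate scale s = 0. Taking the scale as \<open>s ^ q\<close> makes
  every power an integer power.

  Why two a-points of M[g] are impossible: Hurwitz would put a-points of the rescaled monomials near
  each of them. The affine changes of variable are injective, yet would have to send both to the
  only a-point available near the centre.

  Why nk \<ge> 2 shapes the argument: for n = k = 1 the function g(z) = z gives M[g] = z, which
  takes the value a exactly once, so a rescaling limit of this kind could not be excluded. The order
  bound makes zeros of g critical points of M[g], and that is the only information about g beyond
  its growth that is used to bound their number.

  The limit is entire, so the growth estimate can be had from Harnack's inequality on discs where
  |g| > 1, and growth of order one turns "at most one a-point" into an explicit formula.\<close>

definition sph_deriv :: "(complex \<Rightarrow> complex) \<Rightarrow> complex \<Rightarrow> real" where
  "sph_deriv f z = cmod (deriv f z) / (1 + (cmod (f z))\<^sup>2)"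

lemma sph_deriv_nonneg: "sph_deriv f z \<ge> 0"
  by (simp add: sph_deriv_def)

lemma one_le_sqrt_add_square: "1 \<le> sqrt (1 + x\<^sup>2)"
  by simp

lemma continuous_on_stereo [continuous_intros]:
  assumes "continuous_on S f"
  shows "continuous_on S (\<lambda>x. stereo (f x))"
proof -
  have "1 + (cmod z)\<^sup>2 \<noteq> 0" "(cmod z)\<^sup>2 + 1 \<noteq> 0" for z
    by (smt (verit) zero_le_power2)+
  then show ?thesis
    unfolding stereo_def using assms by (intro continuous_intros) auto
qed

lemma tendsto_stereo:
  assumes "(f \<longlongrightarrow> l) F"
  shows "((\<lambda>x. stereo (f x)) \<longlongrightarrow> stereo l) F"
proof (rule isCont_tendsto_compose[OF _ assms])
  have "continuous_on UNIV stereo"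
    using continuous_on_stereo[OF continuous_on_id] .
  then show "isCont stereo l"
    by (simp add: continuous_on_eq_continuous_at)
qed

lemma norm_stereo: "norm (stereo z) = 1"
proof -
  define a where "a = 1 + (cmod z)\<^sup>2"
  have pos: "a > 0" unfolding a_def by (simp add: add_pos_nonneg)
  have s: "stereo z = ((2 / a) *\<^sub>R z, (a - 2) / a)"
    by (simp add: stereo_def a_def add.commute)
  have "(2 / a * cmod z)\<^sup>2 + ((a - 2) / a)\<^sup>2 = (4 * (a - 1) + (a - 2)\<^sup>2) / a\<^sup>2"
    by (simp add: a_def power_mult_distrib power_divide add_divide_distrib)
  also have "\<dots> = 1"
    using pos by (simp add: power2_eq_square field_simps)
  finally show ?thesis
    using pos by (simp add: s norm_Pair power_divide power2_abs)
qed

text \<open>Inversion is a rotation of the sphere. It turns convergence to infinity into convergence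
  of reciprocals to 0.\<close>

lemma dist_stereo_inverse:
  assumes "z \<noteq> 0" "w \<noteq> 0"
  shows "dist (stereo (inverse z)) (stereo (inverse w)) = dist (stereo z) (stereo w)"
proof -
  have *: "sqrt (1 + (cmod (inverse z))\<^sup>2) = sqrt (1 + (cmod z)\<^sup>2) / cmod z" if "z \<noteq> 0" for z
  proof -
    have "1 + (cmod (inverse z))\<^sup>2 = (1 + (cmod z)\<^sup>2) / (cmod z)\<^sup>2"
      using that by (simp add: norm_inverse power_inverse add_divide_distrib inverse_eq_divide add.commute power_one_over norm_divide)
    then show ?thesis by (simp add: real_sqrt_divide)
  qed
  have "inverse z - inverse w = - (inverse z * (z - w) * inverse w)"
    using assms by (simp add: inverse_diff_inverse)
  then have "cmod (inverse z - inverse w) = cmod (z - w) / (cmod z * cmod w)"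
    by (simp add: norm_mult norm_inverse divide_inverse)
  then show ?thesis
    using assms by (simp add: dist_stereo *)
qed

text \<open>On bounded sets the Euclidean distance is controlled by the chordal one, which turns
  spherical convergence back into ordinary uniform convergence.\<close>

lemma dist_le_dist_stereo:
  assumes "cmod z \<le> B" "cmod w \<le> B"
  shows "dist z w \<le> (1 + B\<^sup>2) * dist (stereo z) (stereo w)"
proof -
  define a b where "a = sqrt (1 + (cmod z)\<^sup>2)" and "b = sqrt (1 + (cmod w)\<^sup>2)"
  have ab: "1 \<le> a" "1 \<le> b" "a \<le> sqrt (1 + B\<^sup>2)" "b \<le> sqrt (1 + B\<^sup>2)"
    unfolding a_def b_def using assms by (auto intro!: power_mono)
  have "a * b \<le> sqrt (1 + B\<^sup>2) * sqrt (1 + B\<^sup>2)"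
    using ab by (intro mult_mono) auto
  also have "\<dots> = 1 + B\<^sup>2"
    by (simp add: add_nonneg_nonneg)
  finally have 1: "a * b \<le> 1 + B\<^sup>2" .
  have "dist z w = (a * b) * dist (stereo z) (stereo w) / 2"
  proof -
    have "dist (stereo z) (stereo w) = 2 * cmod (z - w) / (a * b)"
      by (simp add: dist_stereo a_def b_def)
    then show ?thesis
      using ab by (simp add: dist_norm[of z w])
  qed
  also have "\<dots> \<le> (a * b) * dist (stereo z) (stereo w)"
    using ab by simp
  also have "\<dots> \<le> (1 + B\<^sup>2) * dist (stereo z) (stereo w)"
    using 1 by (intro mult_right_mono) auto
  finally show ?thesis .
qed

text \<open>The chordal difference quotient tends to \<open>2 * sph_deriv f u\<close>; the 2 belongs
  to the unit sphere as model, and \<open>e\<close> is the slack of the limit.\<close>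

lemma eventually_dist_stereo_le:
  assumes "f field_differentiable (at u)" "sph_deriv f u \<le> M" "e > 0"
  shows "\<forall>\<^sub>F v in nhds u. dist (stereo (f v)) (stereo (f u)) \<le> (2 * M + e) * dist v u"
proof -
  have d: "(f has_field_derivative deriv f u) (at u)"
    using assms(1) by (simp add: DERIV_deriv_iff_field_differentiable)
  then have 1: "((\<lambda>v. (f v - f u) / (v - u)) \<longlongrightarrow> deriv f u) (at u)"
    by (simp add: has_field_derivative_iff)
  have 2: "(f \<longlongrightarrow> f u) (at u)"
    using d DERIV_isCont isCont_def by blast
  have nz: "sqrt (1 + (cmod z)\<^sup>2) \<noteq> 0" for z
    using one_le_sqrt_add_square[of "cmod z"] by linarith
  have "((\<lambda>v. 2 * cmod ((f v - f u) / (v - u)) / (sqrt (1 + (cmod (f v))\<^sup>2) * sqrt (1 + (cmod (f u))\<^sup>2)))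
      \<longlongrightarrow> 2 * cmod (deriv f u) / (sqrt (1 + (cmod (f u))\<^sup>2) * sqrt (1 + (cmod (f u))\<^sup>2))) (at u)"
    using nz by (intro tendsto_intros 1 2) (metis mult_eq_0_iff)
  moreover have "2 * cmod (deriv f u) / (sqrt (1 + (cmod (f u))\<^sup>2) * sqrt (1 + (cmod (f u))\<^sup>2)) = 2 * sph_deriv f u"
    by (simp add: sph_deriv_def add_nonneg_nonneg)
  moreover have "2 * sph_deriv f u < 2 * M + e"
    using assms by linarith
  ultimately have "\<forall>\<^sub>F v in at u. 2 * cmod ((f v - f u) / (v - u)) / (sqrt (1 + (cmod (f v))\<^sup>2) * sqrt (1 + (cmod (f u))\<^sup>2)) < 2 * M + e"
    by (simp add: order_tendstoD(2))
  then have "\<forall>\<^sub>F v in at u. v \<noteq> u \<and> 2 * cmod ((f v - f u) / (v - u)) / (sqrt (1 + (cmod (f v))\<^sup>2) * sqrt (1 + (cmod (f u))\<^sup>2)) < 2 * M + e"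
    by (simp add: eventually_conj_iff eventually_neq_at_within)
  then have "\<forall>\<^sub>F v in at u. dist (stereo (f v)) (stereo (f u)) \<le> (2 * M + e) * dist v u"
  proof eventually_elim
    case (elim v)
    then have "dist (stereo (f v)) (stereo (f u)) = 
       2 * cmod ((f v - f u) / (v - u)) / (sqrt (1 + (cmod (f v))\<^sup>2) * sqrt (1 + (cmod (f u))\<^sup>2)) * dist v u"
      by (simp only: dist_stereo norm_divide) (simp add: dist_norm)
    also have "\<dots> \<le> (2 * M + e) * dist v u"
      using elim by (intro mult_right_mono) auto
    finally show ?case .
  qed
  then show ?thesis
    unfolding eventually_at_filter by (rule eventually_mono) auto
qed

text \<open>A mean value inequality obtained without integration: the infinitesimal bound is chained
  along the segment from \<open>z\<close> to \<open>w\<close>, and the slack is removed at the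
  end.\<close>

lemma dist_stereo_le_sph_deriv:
  assumes hol: "f holomorphic_on ball z0 r" and M: "\<And>u. u \<in> ball z0 r \<Longrightarrow> sph_deriv f u \<le> M"
    and z: "z \<in> ball z0 r" and w: "w \<in> ball z0 r"
  shows "dist (stereo (f z)) (stereo (f w)) \<le> 2 * M * dist z w"
proof (rule field_le_epsilon)
  fix e0 :: real assume "e0 > 0"
  define e where "e = e0 / (1 + dist z w)"
  have e: "e > 0" using \<open>e0 > 0\<close> unfolding e_def by (simp add: add_pos_nonneg)
  define u where "u = (\<lambda>t::real. z + t *\<^sub>R (w - z))"
  have u_in: "u t \<in> ball z0 r" if "0 \<le> t" "t \<le> 1" for t
  proof -
    have "u t = (1 - t) *\<^sub>R z + t *\<^sub>R w" by (simp add: u_def algebra_simps)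
    then show ?thesis
      using convexD_alt[OF convex_ball z w that] by simp
  qed
  have du: "dist (u a) (u b) = \<bar>a - b\<bar> * dist z w" for a b
  proof -
    have "u a - u b = (a - b) *\<^sub>R (w - z)" by (simp add: u_def algebra_simps)
    then show ?thesis by (simp add: dist_norm norm_minus_commute)
  qed
  \<comment> \<open>This condition is additive over adjacent intervals, so bisection reduces it to
    short ones. The guards make it vacuous outside [0,1], where \<open>u\<close> may leave the
    disc.\<close>
  define P where "P = (\<lambda>a b. 0 \<le> a \<longrightarrow> b \<le> 1 \<longrightarrow> a \<le> b \<longrightarrow> 
     dist (stereo (f (u a))) (stereo (f (u b))) \<le> (2 * M + e) * ((b - a) * dist z w))"
  have "(0::real) \<le> 1"
    by simp
  then have "P 0 1"
  proof (induction rule: Bolzano)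
    case (trans a b c)
    show ?case unfolding P_def
    proof (intro impI)
      assume "0 \<le> a" "c \<le> 1" "a \<le> c"
      then have "dist (stereo (f (u a))) (stereo (f (u b))) \<le> (2 * M + e) * ((b - a) * dist z w)"
        "dist (stereo (f (u b))) (stereo (f (u c))) \<le> (2 * M + e) * ((c - b) * dist z w)"
        using trans by (auto simp: P_def)
      moreover have "(2 * M + e) * ((b - a) * dist z w) + (2 * M + e) * ((c - b) * dist z w) = (2 * M + e) * ((c - a) * dist z w)"
        by (simp add: algebra_simps)
      ultimately show "dist (stereo (f (u a))) (stereo (f (u c))) \<le> (2 * M + e) * ((c - a) * dist z w)"
        by (smt (verit) dist_triangle)
    qed
  next
    case (local x)
    have "f field_differentiable (at (u x))"
      using hol u_in[OF local] holomorphic_on_imp_differentiable_at by blast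
    from eventually_dist_stereo_le[OF this M[OF u_in[OF local]] e]
    obtain d where d: "d > 0" "\<And>v. dist v (u x) < d \<Longrightarrow> dist (stereo (f v)) (stereo (f (u x))) \<le> (2 * M + e) * dist v (u x)"
      unfolding eventually_nhds_metric by blast
    define d' where "d' = d / (1 + dist z w)"
    have d': "d' > 0" using d(1) unfolding d'_def by (simp add: add_pos_nonneg)
    show ?case
    proof (intro exI[of _ d'] conjI allI impI d')
      fix a b assume ab: "a \<le> x \<and> x \<le> b \<and> b - a < d'"
      have near: "dist (u y) (u x) < d" if "\<bar>y - x\<bar> < d'" for y
      proof -
        have "\<bar>y - x\<bar> * dist z w \<le> d' * dist z w"
          using that by (intro mult_right_mono) auto
        also have "\<dots> < d' * (1 + dist z w)"
          using d' by simp
        also have "\<dots> = d"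
          unfolding d'_def by (metis add_pos_nonneg nonzero_eq_divide_eq order_less_irrefl zero_le_dist zero_less_one)
        finally show ?thesis by (simp add: du)
      qed
      show "P a b" unfolding P_def
      proof (intro impI)
        have "dist (stereo (f (u a))) (stereo (f (u x))) \<le> (2 * M + e) * ((x - a) * dist z w)"
          using d(2)[OF near, of a] ab by (simp add: du)
        moreover have "dist (stereo (f (u x))) (stereo (f (u b))) \<le> (2 * M + e) * ((b - x) * dist z w)"
          using d(2)[OF near, of b] ab by (simp add: du dist_commute)
        moreover have "(2 * M + e) * ((x - a) * dist z w) + (2 * M + e) * ((b - x) * dist z w) = (2 * M + e) * ((b - a) * dist z w)"
          by (simp add: algebra_simps)
        ultimately show "dist (stereo (f (u a))) (stereo (f (u b))) \<le> (2 * M + e) * ((b - a) * dist z w)"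
          by (smt (verit) dist_triangle)
      qed
    qed
  qed
  then have "dist (stereo (f z)) (stereo (f w)) \<le> (2 * M + e) * dist z w"
    by (simp add: P_def u_def)
  also have "\<dots> \<le> 2 * M * dist z w + e0"
  proof -
    have "e * dist z w \<le> e * (1 + dist z w)" using e by simp
    also have "\<dots> = e0" unfolding e_def
      by (metis add_pos_nonneg nonzero_eq_divide_eq order_less_irrefl zero_le_dist zero_less_one)
    finally show ?thesis by (simp add: algebra_simps)
  qed
  finally show "dist (stereo (f z)) (stereo (f w)) \<le> 2 * M * dist z w + e0" .
qed

section \<open>Compactness under locally bounded spherical derivatives\<close>

lemma uniform_limit_imp_Cauchy:
  "uniform_limit X f l sequentially \<Longrightarrow> uniformly_Cauchy_on X f"
  for f :: "nat \<Rightarrow> 'a \<Rightarrow> 'b::metric_space"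
  by (rule uniformly_convergent_Cauchy) (auto simp: uniformly_convergent_on_def)

lemma uniform_limit_shift:
  "uniform_limit X f l sequentially \<Longrightarrow> uniform_limit X (\<lambda>n. f (n + N)) l sequentially"
  by (rule filterlim_compose[OF _ filterlim_add_const_nat_at_top])

lemma uniform_limit_of_stereo:
  fixes g :: "nat \<Rightarrow> 'a \<Rightarrow> complex"
  assumes C: "uniformly_Cauchy_on X (\<lambda>n x. stereo (g n x))"
    and B: "\<forall>\<^sub>F n in sequentially. \<forall>x\<in>X. cmod (g n x) \<le> B"
  shows "\<exists>h. uniform_limit X g h sequentially"
proof -
  obtain N where N: "\<And>n x. n \<ge> N \<Longrightarrow> x \<in> X \<Longrightarrow> cmod (g n x) \<le> B"
    using B by (auto simp: eventually_sequentially)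
  have "uniformly_Cauchy_on X g"
    unfolding uniformly_Cauchy_on_def
  proof (intro allI impI)
    fix e :: real assume "e > 0"
    have pos: "1 + B\<^sup>2 > 0" by (simp add: add_pos_nonneg)
    then have "e / (1 + B\<^sup>2) > 0" using \<open>e > 0\<close> by simp
    then obtain K where K: "\<And>x m n. x \<in> X \<Longrightarrow> m \<ge> K \<Longrightarrow> n \<ge> K \<Longrightarrow> dist (stereo (g m x)) (stereo (g n x)) < e / (1 + B\<^sup>2)"
      using C unfolding uniformly_Cauchy_on_def by metis
    show "\<exists>M. \<forall>x\<in>X. \<forall>m\<ge>M. \<forall>n\<ge>M. dist (g m x) (g n x) < e"
    proof (intro exI[of _ "max K N"] ballI allI impI)
      fix x m n assume *: "x \<in> X" "m \<ge> max K N" "n \<ge> max K N"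
      have "dist (g m x) (g n x) \<le> (1 + B\<^sup>2) * dist (stereo (g m x)) (stereo (g n x))"
        using * N by (intro dist_le_dist_stereo) auto
      also have "\<dots> < (1 + B\<^sup>2) * (e / (1 + B\<^sup>2))"
        using * K pos by (intro mult_strict_left_mono) auto
      also have "\<dots> = e" using pos by simp
      finally show "dist (g m x) (g n x) < e" .
    qed
  qed
  then show ?thesis
    using Cauchy_uniformly_convergent uniformly_convergent_on_def by blast
qed


text \<open>The Arzela-Ascoli argument: the sphere is bounded, so a diagonal subsequence converges
  on a countable dense set, and the common Lipschitz bound spreads convergence to discs. As
  \<open>\<phi>\<close> is the pointwise limit, one function serves all discs. Holomorphy is asked
  only eventually because rescaled functions live on growing discs.\<close>

lemma marty_limit:
  fixes f :: "nat \<Rightarrow> complex \<Rightarrow> complex"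
  assumes loc: "\<And>z. z \<in> D \<Longrightarrow> \<exists>e>0. \<exists>M. ball z e \<subseteq> D \<and>
      (\<forall>\<^sub>F n in sequentially. f n holomorphic_on ball z e \<and> (\<forall>w\<in>ball z e. sph_deriv (f n) w \<le> M))"
  obtains r \<phi> where "strict_mono (r :: nat \<Rightarrow> nat)"
    "\<And>z. z \<in> D \<Longrightarrow> \<exists>e>0. ball z e \<subseteq> D \<and> uniform_limit (ball z e) (\<lambda>n w. stereo (f (r n) w)) \<phi> sequentially"
proof -
  obtain Q :: "complex set" where Q: "countable Q" and Qd: "\<And>X. open X \<Longrightarrow> X \<noteq> {} \<Longrightarrow> \<exists>d\<in>Q. d \<in> X"
    using countable_dense_setE by metis
  obtain r where r: "strict_mono (r :: nat \<Rightarrow> nat)"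
    and conv: "\<And>x. x \<in> Q \<Longrightarrow> \<exists>l. (\<lambda>n. stereo (f (r n) x)) \<longlonglongrightarrow> l"
    using function_convergent_subsequence[OF Q, of "\<lambda>n x. stereo (f n x)" 1] by (auto simp: norm_stereo)
  define \<phi> where "\<phi> = (\<lambda>z. lim (\<lambda>n. stereo (f (r n) z)))"
  have "\<exists>e>0. ball z e \<subseteq> D \<and> uniform_limit (ball z e) (\<lambda>n w. stereo (f (r n) w)) \<phi> sequentially"
    if zD: "z \<in> D" for z
  proof -
    obtain e M where e: "e > 0" "ball z e \<subseteq> D"
      and ev: "\<forall>\<^sub>F n in sequentially. f n holomorphic_on ball z e \<and> (\<forall>w\<in>ball z e. sph_deriv (f n) w \<le> M)"
      using loc[OF zD] by blast
    obtain N where N: "\<And>n. n \<ge> N \<Longrightarrow> f n holomorphic_on ball z e"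
        "\<And>n w. n \<ge> N \<Longrightarrow> w \<in> ball z e \<Longrightarrow> sph_deriv (f n) w \<le> M"
      using ev unfolding eventually_sequentially by blast
    have M0: "M \<ge> 0"
      using N(2)[of N z] e(1) sph_deriv_nonneg[of "f N" z] by auto
    have "uniformly_Cauchy_on (ball z (e/2)) (\<lambda>n w. stereo (f (r n) w))"
      unfolding uniformly_Cauchy_on_def
    proof (intro allI impI)
      fix \<epsilon> :: real assume eps: "\<epsilon> > 0"
      \<comment> \<open>The Lipschitz constant \<open>2 * M\<close> moves points at this distance by
        at most a third of \<epsilon>; \<open>M + 1\<close> guards against M = 0.\<close>
      define \<delta> where "\<delta> = \<epsilon> / (6 * (M + 1))"
      have d: "\<delta> > 0" using eps M0 by (simp add: \<delta>_def)
      have "cball z (e/2) \<subseteq> (\<Union>q\<in>Q \<inter> ball z e. ball q \<delta>)"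
      proof
        fix x assume x: "x \<in> cball z (e/2)"
        then have "x \<in> ball x \<delta> \<inter> ball z e" using d e by auto
        then obtain q where "q \<in> Q" "q \<in> ball x \<delta> \<inter> ball z e"
          using Qd[of "ball x \<delta> \<inter> ball z e"] by blast
        then show "x \<in> (\<Union>q\<in>Q \<inter> ball z e. ball q \<delta>)"
          by (auto simp: dist_commute)
      qed
      then obtain T where T: "T \<subseteq> Q \<inter> ball z e" "finite T" "cball z (e/2) \<subseteq> (\<Union>q\<in>T. ball q \<delta>)"
        by (rule compactE_image[OF compact_cball, rotated]) auto
      have "\<exists>K. \<forall>m\<ge>K. \<forall>n\<ge>K. dist (stereo (f (r m) q)) (stereo (f (r n) q)) < \<epsilon> / 3" if "q \<in> T" for q
      proof -
        have "Cauchy (\<lambda>n. stereo (f (r n) q))"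
          using conv[of q] T(1) that LIMSEQ_imp_Cauchy by blast
        then show ?thesis using eps unfolding Cauchy_def by (metis divide_pos_pos zero_less_numeral)
      qed
      then obtain K where K: "\<And>q m n. q \<in> T \<Longrightarrow> m \<ge> K q \<Longrightarrow> n \<ge> K q \<Longrightarrow> dist (stereo (f (r m) q)) (stereo (f (r n) q)) < \<epsilon> / 3"
        by metis
      define L where "L = Max (insert N (K ` T))"
      have L: "L \<ge> N" "\<And>q. q \<in> T \<Longrightarrow> L \<ge> K q"
        using T(2) by (auto simp: L_def)
      show "\<exists>L. \<forall>x\<in>ball z (e/2). \<forall>m\<ge>L. \<forall>n\<ge>L. dist (stereo (f (r m) x)) (stereo (f (r n) x)) < \<epsilon>"
      proof (intro exI[of _ L] ballI allI impI)
        fix x m n assume x: "x \<in> ball z (e/2)" and mn: "m \<ge> L" "n \<ge> L"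
        then obtain q where q: "q \<in> T" "dist q x < \<delta>"
          using T(3) by (metis (no_types, lifting) UN_E ball_subset_cball mem_ball subsetD)
        have qe: "q \<in> ball z e" and xe: "x \<in> ball z e" using T(1) q x e by auto
        have near: "dist (stereo (f (r i) x)) (stereo (f (r i) q)) \<le> \<epsilon> / 3" if "i \<ge> L" for i
        proof -
          have "r i \<ge> N" using seq_suble[OF r, of i] that L(1) by linarith
          then have "dist (stereo (f (r i) x)) (stereo (f (r i) q)) \<le> 2 * M * dist x q"
            using N qe xe by (intro dist_stereo_le_sph_deriv) auto
          also have "\<dots> \<le> 2 * (M + 1) * \<delta>"
            using M0 q(2) by (intro mult_mono) (auto simp: dist_commute)
          also have "\<dots> = \<epsilon> / 3"
            using M0 by (simp add: \<delta>_def field_simps)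
          finally show ?thesis .
        qed
        have "dist (stereo (f (r m) x)) (stereo (f (r n) x)) \<le> dist (stereo (f (r m) x)) (stereo (f (r m) q))
            + dist (stereo (f (r m) q)) (stereo (f (r n) q)) + dist (stereo (f (r n) x)) (stereo (f (r n) q))"
          by (smt (verit) dist_triangle dist_commute)
        also have "\<dots> < \<epsilon> / 3 + \<epsilon> / 3 + \<epsilon> / 3"
          using near[OF mn(1)] near[OF mn(2)] K[OF q(1), of m n] L(2)[OF q(1)] mn by linarith
        finally show "dist (stereo (f (r m) x)) (stereo (f (r n) x)) < \<epsilon>" by simp
      qed
    qed
    then have "uniformly_convergent_on (ball z (e/2)) (\<lambda>n w. stereo (f (r n) w))"
      by (rule Cauchy_uniformly_convergent)
    then have "uniform_limit (ball z (e/2)) (\<lambda>n w. stereo (f (r n) w)) \<phi> sequentially"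
      unfolding \<phi>_def by (simp add: uniformly_convergent_uniform_limit_iff)
    then show ?thesis using e by (intro exI[of _ "e/2"]) (auto simp: subset_iff)
  qed
  with r show ?thesis using that by blast
qed

text \<open>Holomorphic functions cannot acquire an isolated pole in the limit. Near a point with
  limit infinity the reciprocals are zero-free and their limit has a zero, so by Hurwitz it vanishes
  identically, and the set of such points is open. Its complement is open by continuity, and
  connectedness leaves only one of the two.\<close>

lemma sphere_limit_dichotomy:
  fixes f :: "nat \<Rightarrow> complex \<Rightarrow> complex"
  assumes "open D" and conn: "connected D"
    and hol: "\<And>z. z \<in> D \<Longrightarrow> \<exists>e>0. \<forall>\<^sub>F n in sequentially. f n holomorphic_on ball z e"
    and lim: "\<And>z. z \<in> D \<Longrightarrow> \<exists>e>0. ball z e \<subseteq> D \<and> uniform_limit (ball z e) (\<lambda>n w. stereo (f n w)) \<phi> sequentially"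
  shows "(\<forall>z\<in>D. \<phi> z = sphere_infinity) \<or>
    (\<exists>h. h holomorphic_on D \<and> (\<forall>z\<in>D. \<phi> z = stereo (h z)) \<and>
      (\<forall>z\<in>D. \<exists>e>0. ball z e \<subseteq> D \<and> uniform_limit (ball z e) f h sequentially))"
proof -
  have nice: "\<exists>e>0. \<exists>N. ball z e \<subseteq> D \<and> uniform_limit (ball z e) (\<lambda>n w. stereo (f n w)) \<phi> sequentially \<and>
     continuous_on (ball z e) \<phi> \<and> (\<forall>n\<ge>N. f n holomorphic_on ball z e)"
    if "z \<in> D" for z
  proof -
    obtain e1 where e1: "e1 > 0" "\<forall>\<^sub>F n in sequentially. f n holomorphic_on ball z e1" using hol[OF \<open>z \<in> D\<close>] by blast
    obtain e2 where e2: "e2 > 0" "ball z e2 \<subseteq> D" "uniform_limit (ball z e2) (\<lambda>n w. stereo (f n w)) \<phi> sequentially"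
      using lim[OF \<open>z \<in> D\<close>] by blast
    define e where "e = min e1 e2"
    have sub: "ball z e \<subseteq> ball z e1" "ball z e \<subseteq> ball z e2" by (auto simp: e_def)
    have ev: "\<forall>\<^sub>F n in sequentially. f n holomorphic_on ball z e"
      using e1(2) by eventually_elim (use sub holomorphic_on_subset in blast)
    have ul: "uniform_limit (ball z e) (\<lambda>n w. stereo (f n w)) \<phi> sequentially"
      using uniform_limit_on_subset[OF e2(3) sub(2)] .
    have "continuous_on (ball z e) \<phi>"
    proof (rule uniform_limit_theorem[OF _ ul])
      show "\<forall>\<^sub>F n in sequentially. continuous_on (ball z e) (\<lambda>w. stereo (f n w))"
        using ev by eventually_elim (intro continuous_on_stereo holomorphic_on_imp_continuous_on)
    qed simp
    moreover have "e > 0" using e1 e2 by (simp add: e_def)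
    ultimately show ?thesis using ul ev sub e2(2) by (auto simp: eventually_sequentially)
  qed
  have finite_case: "\<exists>e>0. ball z e \<subseteq> D \<and> (\<exists>h. h holomorphic_on ball z e \<and> uniform_limit (ball z e) f h sequentially)"
    if zD: "z \<in> D" "\<phi> z \<noteq> sphere_infinity" for z
  proof -
    obtain e N where e: "e > 0" "ball z e \<subseteq> D" and ul: "uniform_limit (ball z e) (\<lambda>n w. stereo (f n w)) \<phi> sequentially"
     and cont: "continuous_on (ball z e) \<phi>" and holN: "\<And>n. n \<ge> N \<Longrightarrow> f n holomorphic_on ball z e"
      using nice[OF zD(1)] by blast
    define d where "d = dist (\<phi> z) sphere_infinity"
    have d: "d > 0" using zD by (simp add: d_def)
    have "isCont \<phi> z" using cont e by (simp add: continuous_on_eq_continuous_at)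
    then have "\<forall>\<^sub>F w in nhds z. dist (\<phi> w) (\<phi> z) < d / 4"
      using d by (intro tendstoD) (auto simp: isCont_def tendsto_at_iff_tendsto_nhds)
    then obtain e' where e': "e' > 0" "\<And>w. dist w z < e' \<Longrightarrow> dist (\<phi> w) (\<phi> z) < d / 4"
      unfolding eventually_nhds_metric by blast
    define e2 where "e2 = min e e'"
    have e2: "e2 > 0" "ball z e2 \<subseteq> ball z e" using e e' by (auto simp: e2_def)
    have ul2: "uniform_limit (ball z e2) (\<lambda>n w. stereo (f n w)) \<phi> sequentially"
      using uniform_limit_on_subset[OF ul e2(2)] .
    then have ev: "\<forall>\<^sub>F n in sequentially. \<forall>w\<in>ball z e2. dist (stereo (f n w)) (\<phi> w) < d / 4"
      using d by (auto dest!: uniform_limitD[where e="d/4"])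
    \<comment> \<open>The chordal distance to infinity stays above d/2 here, and it equals
      \<open>2 / sqrt (1 + (cmod (f n w))\<^sup>2)\<close>.\<close>
    have "\<forall>\<^sub>F n in sequentially. \<forall>w\<in>ball z e2. cmod (f n w) \<le> 4 / d"
      using ev
    proof eventually_elim
      case (elim n)
      show ?case
      proof
        fix w assume w: "w \<in> ball z e2"
        then have "dist (stereo (f n w)) (\<phi> w) < d / 4" "dist (\<phi> w) (\<phi> z) < d / 4"
          using elim e' by (auto simp: e2_def dist_commute)
        moreover have "d \<le> dist (\<phi> w) (\<phi> z) + dist (stereo (f n w)) (\<phi> w) + dist (stereo (f n w)) sphere_infinity"
          unfolding d_def by (smt (verit) dist_triangle dist_commute)
        ultimately have "d / 2 < 2 / sqrt (1 + (cmod (f n w))\<^sup>2)"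
          by (simp add: dist_stereo_infinity)
        moreover have s: "sqrt (1 + (cmod (f n w))\<^sup>2) > 0" by (simp add: add_pos_nonneg)
        ultimately have "sqrt (1 + (cmod (f n w))\<^sup>2) < 4 / d" using d by (simp add: field_simps)
        moreover have "cmod (f n w) \<le> sqrt (1 + (cmod (f n w))\<^sup>2)" by (rule real_le_rsqrt) simp
        ultimately show "cmod (f n w) \<le> 4 / d" by linarith
      qed
    qed
    then obtain h where h: "uniform_limit (ball z e2) f h sequentially"
      using uniform_limit_of_stereo[OF uniform_limit_imp_Cauchy[OF ul2]] by blast
    have "h holomorphic_on ball z e2"
    proof (rule holomorphic_uniform_sequence[of _ "\<lambda>n. f (n + N)"])
      fix n show "f (n + N) holomorphic_on ball z e2"
        using holN[of "n + N"] e2(2) holomorphic_on_subset by auto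
    next
      fix x assume "x \<in> ball z e2"
      then obtain c where c: "c > 0" "cball x c \<subseteq> ball z e2" using open_contains_cball open_ball by blast
      then have "uniform_limit (cball x c) (\<lambda>n. f (n + N)) h sequentially"
        using uniform_limit_shift[OF uniform_limit_on_subset[OF h c(2)]] by simp
      with c show "\<exists>d>0. cball x d \<subseteq> ball z e2 \<and> uniform_limit (cball x d) (\<lambda>n. f (n + N)) h sequentially" by blast
    qed simp
    with h e2 e show ?thesis by blast
  qed
  have inf_case: "\<exists>e>0. ball z e \<subseteq> D \<and> (\<forall>w\<in>ball z e. \<phi> w = sphere_infinity)"
    if zD: "z \<in> D" "\<phi> z = sphere_infinity" for z
  proof -
    obtain e N where e: "e > 0" "ball z e \<subseteq> D" and ul: "uniform_limit (ball z e) (\<lambda>n w. stereo (f n w)) \<phi> sequentially"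
     and cont: "continuous_on (ball z e) \<phi>" and holN: "\<And>n. n \<ge> N \<Longrightarrow> f n holomorphic_on ball z e"
      using nice[OF zD(1)] by blast
    have "isCont \<phi> z" using cont e by (simp add: continuous_on_eq_continuous_at)
    then have "\<forall>\<^sub>F w in nhds z. dist (\<phi> w) (\<phi> z) < 1 / 2"
      by (intro tendstoD) (auto simp: isCont_def tendsto_at_iff_tendsto_nhds)
    then obtain e' where e': "e' > 0" "\<And>w. dist w z < e' \<Longrightarrow> dist (\<phi> w) (\<phi> z) < 1 / 2"
      unfolding eventually_nhds_metric by blast
    define e2 where "e2 = min e e'"
    have e2: "e2 > 0" "ball z e2 \<subseteq> ball z e" using e e' by (auto simp: e2_def)
    have ul2: "uniform_limit (ball z e2) (\<lambda>n w. stereo (f n w)) \<phi> sequentially"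
      using uniform_limit_on_subset[OF ul e2(2)] .
    then have "\<forall>\<^sub>F n in sequentially. \<forall>w\<in>ball z e2. dist (stereo (f n w)) (\<phi> w) < 1 / 2"
      by (auto dest!: uniform_limitD[where e="1/2"])
    then obtain N2 where N2: "\<And>n w. n \<ge> N2 \<Longrightarrow> w \<in> ball z e2 \<Longrightarrow> dist (stereo (f n w)) (\<phi> w) < 1 / 2"
      unfolding eventually_sequentially by blast
    \<comment> \<open>A chordal distance to infinity below 1 forces the square root above 2, so the
      functions have no zeros here and reciprocals may be taken.\<close>
    have big: "cmod (f n w) > 1" if "n \<ge> N2" "w \<in> ball z e2" for n w
    proof -
      have "dist (\<phi> w) (\<phi> z) < 1 / 2" using that e' by (auto simp: e2_def dist_commute)
      then have "dist (stereo (f n w)) sphere_infinity < 1"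
        using N2[OF that] \<open>\<phi> z = sphere_infinity\<close> dist_triangle[of "stereo (f n w)" sphere_infinity "\<phi> w"] by simp
      then have "2 / sqrt (1 + (cmod (f n w))\<^sup>2) < 1" by (simp add: dist_stereo_infinity)
      moreover have s: "sqrt (1 + (cmod (f n w))\<^sup>2) > 0" by (simp add: add_pos_nonneg)
      ultimately have "sqrt 4 < sqrt (1 + (cmod (f n w))\<^sup>2)" by (simp add: field_simps)
      then have "1\<^sup>2 < (cmod (f n w))\<^sup>2" by (simp only: real_sqrt_less_iff) simp
      then show ?thesis by (rule power2_less_imp_less) simp
    qed
    \<comment> \<open>The shift by both thresholds makes every term, not only late ones, holomorphic
      and zero-free, as Hurwitz's theorem requires.\<close>
    define k where "k = (\<lambda>n w. inverse (f (n + (N + N2)) w))"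
    have "uniformly_Cauchy_on (ball z e2) (\<lambda>n w. stereo (f n w))"
      by (rule uniform_limit_imp_Cauchy[OF ul2])
    then have "uniformly_Cauchy_on (ball z e2) (\<lambda>n w. stereo (f (n + (N + N2)) w))"
      unfolding uniformly_Cauchy_on_def by (meson trans_le_add1)
    moreover have "dist (stereo (k m w)) (stereo (k n w)) = dist (stereo (f (m + (N + N2)) w)) (stereo (f (n + (N + N2)) w))"
      if "w \<in> ball z e2" for m n w
      unfolding k_def using big[OF _ that, of "m + (N + N2)"] big[OF _ that, of "n + (N + N2)"] by (intro dist_stereo_inverse) auto
    ultimately have "uniformly_Cauchy_on (ball z e2) (\<lambda>n w. stereo (k n w))"
      unfolding uniformly_Cauchy_on_def by simp
    moreover have "cmod (k n w) \<le> 1" if "w \<in> ball z e2" for n w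
      unfolding k_def using big[OF _ that, of "n + (N + N2)"] by (simp add: norm_inverse inverse_le_1_iff)
    ultimately obtain u where u: "uniform_limit (ball z e2) k u sequentially"
      using uniform_limit_of_stereo[of "ball z e2" k 1] by auto
    have holk: "k n holomorphic_on ball z e2" for n
      unfolding k_def using holN[of "n + (N + N2)"] e2(2) big[of "n + (N + N2)"] holomorphic_on_subset
      by (intro holomorphic_intros) fastforce+
    have holu: "u holomorphic_on ball z e2"
    proof (rule holomorphic_uniform_sequence[OF open_ball holk])
      fix x assume "x \<in> ball z e2"
      then obtain c where "c > 0" "cball x c \<subseteq> ball z e2" using open_contains_cball open_ball by blast
      then show "\<exists>d>0. cball x d \<subseteq> ball z e2 \<and> uniform_limit (cball x d) k u sequentially"
        using uniform_limit_on_subset[OF u] by blast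
    qed
    \<comment> \<open>Inversion exchanges 0 and infinity isometrically: the distance of the
      reciprocal to 0 is the distance of the function to infinity.\<close>
    have lim_iff: "\<phi> w = sphere_infinity \<longleftrightarrow> u w = 0" if w: "w \<in> ball z e2" for w
    proof -
      have "(\<lambda>n. k n w) \<longlonglongrightarrow> u w" using tendsto_uniform_limitI[OF u w] .
      then have "(\<lambda>n. dist (stereo (k n w)) (stereo 0)) \<longlonglongrightarrow> dist (stereo (u w)) (stereo 0)"
        by (intro tendsto_dist tendsto_const tendsto_stereo)
      moreover have "dist (stereo (k n w)) (stereo 0) = dist (stereo (f (n + (N + N2)) w)) sphere_infinity" for n
      proof -
        define x where "x = f (n + (N + N2)) w"
        have x: "x \<noteq> 0" using big[OF _ w, of "n + (N + N2)"] by (auto simp: x_def)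
        have "1 + (cmod (inverse x))\<^sup>2 = (1 + (cmod x)\<^sup>2) / (cmod x)\<^sup>2"
          using x by (simp add: norm_inverse power_inverse add_divide_distrib inverse_eq_divide add.commute power_one_over norm_divide)
        then have "sqrt (1 + (cmod (inverse x))\<^sup>2) = sqrt (1 + (cmod x)\<^sup>2) / cmod x"
          by (simp add: real_sqrt_divide)
        then show ?thesis using x
          by (simp add: dist_stereo dist_stereo_infinity k_def norm_inverse flip: x_def)
      qed
      ultimately have 1: "(\<lambda>n. dist (stereo (f (n + (N + N2)) w)) sphere_infinity) \<longlonglongrightarrow> dist (stereo (u w)) (stereo 0)" by simp
      have "(\<lambda>n. stereo (f n w)) \<longlonglongrightarrow> \<phi> w" using tendsto_uniform_limitI[OF ul2 w] .
      then have "(\<lambda>n. stereo (f (n + (N + N2)) w)) \<longlonglongrightarrow> \<phi> w" by (rule LIMSEQ_ignore_initial_segment)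
      then have "(\<lambda>n. dist (stereo (f (n + (N + N2)) w)) sphere_infinity) \<longlonglongrightarrow> dist (\<phi> w) sphere_infinity"
        by (intro tendsto_dist tendsto_const)
      with 1 have "dist (\<phi> w) sphere_infinity = dist (stereo (u w)) (stereo 0)" using LIMSEQ_unique by blast
      moreover have "dist (stereo (u w)) (stereo 0) = 0 \<longleftrightarrow> u w = 0"
      proof -
        have "sqrt (1 + (cmod (u w))\<^sup>2) \<noteq> 0" using one_le_sqrt_add_square[of "cmod (u w)"] by linarith
        then show ?thesis by (simp only: dist_stereo) simp
      qed
      ultimately show ?thesis by (metis dist_eq_0_iff)
    qed
    have "u constant_on ball z e2"
    proof (rule ccontr)
      assume "\<not> u constant_on ball z e2"
      moreover have "k n w \<noteq> 0" if "w \<in> ball z e2" for n w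
        unfolding k_def using big[OF _ that, of "n + (N + N2)"] by auto
      ultimately have "u z \<noteq> 0"
        using e2(1) uniform_limit_on_subset[OF u]
        by (intro Hurwitz_no_zeros[OF open_ball connected_ball holk holu]) auto
      then show False using lim_iff[of z] e2 zD by simp
    qed
    moreover have "u z = 0" using lim_iff[of z] e2 zD by simp
    ultimately have "\<And>w. w \<in> ball z e2 \<Longrightarrow> u w = 0"
      using e2(1) unfolding constant_on_def by (metis centre_in_ball)
    then show ?thesis using lim_iff e2 e by blast
  qed
  define A where "A = {z\<in>D. \<phi> z = sphere_infinity}"
  have "open A" unfolding open_contains_ball
    using inf_case by (fastforce simp: A_def)
  moreover have "open (D - A)" unfolding open_contains_ball
  proof
    fix z assume "z \<in> D - A"
    then have z: "z \<in> D" "\<phi> z \<noteq> sphere_infinity" by (auto simp: A_def)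
    obtain e where e: "e > 0" "ball z e \<subseteq> D" "continuous_on (ball z e) \<phi>" using nice[OF z(1)] by blast
    have "isCont \<phi> z" using e by (simp add: continuous_on_eq_continuous_at)
    then have "\<forall>\<^sub>F w in nhds z. \<phi> w \<noteq> sphere_infinity"
      using z(2) by (intro tendsto_imp_eventually_ne) (auto simp: isCont_def tendsto_at_iff_tendsto_nhds)
    then obtain e' where e': "e' > 0" "\<And>w. dist w z < e' \<Longrightarrow> \<phi> w \<noteq> sphere_infinity"
      unfolding eventually_nhds_metric by blast
    show "\<exists>e>0. ball z e \<subseteq> D - A"
      using e e' by (intro exI[of _ "min e e'"]) (auto simp: A_def dist_commute subset_iff)
  qed
  ultimately have "A = {} \<or> D - A = {}"
    using connectedD[OF conn, of A "D - A"] by (auto simp: A_def)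
  then show ?thesis
  proof
    assume "D - A = {}"
    then show ?thesis by (auto simp: A_def)
  next
    assume "A = {}"
    then have fin: "\<phi> z \<noteq> sphere_infinity" if "z \<in> D" for z using that by (auto simp: A_def)
    \<comment> \<open>Defined pointwise, the limits found on the various discs are restrictions of a
      single function.\<close>
    define h where "h = (\<lambda>z. lim (\<lambda>n. f n z))"
    have loc: "\<exists>e>0. ball z e \<subseteq> D \<and> h holomorphic_on ball z e \<and> uniform_limit (ball z e) f h sequentially" if z: "z \<in> D" for z
    proof -
      obtain e h' where e: "e > 0" "ball z e \<subseteq> D" "h' holomorphic_on ball z e" "uniform_limit (ball z e) f h' sequentially"
        using finite_case[OF z fin[OF z]] by blast
      have eq: "h w = h' w" if "w \<in> ball z e" for w
        unfolding h_def using tendsto_uniform_limitI[OF e(4) that] by (rule limI)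
      have "h holomorphic_on ball z e" by (rule holomorphic_transform[OF e(3)]) (simp add: eq)
      moreover have "uniform_limit (ball z e) f h sequentially"
        using e(4) uniform_limit_cong'[of "ball z e" f f h h'] eq by simp
      ultimately show ?thesis using e by blast
    qed
    have "h holomorphic_on D"
      unfolding holomorphic_on_def
    proof
      fix z assume z: "z \<in> D"
      obtain e where e: "e > 0" "h holomorphic_on ball z e" using loc[OF z] by blast
      then have "h field_differentiable at z"
        by (simp add: holomorphic_on_imp_differentiable_at)
      then show "h field_differentiable at z within D" using field_differentiable_at_within by blast
    qed
    moreover have "\<phi> z = stereo (h z)" if z: "z \<in> D" for z
    proof -
      obtain e where e: "e > 0" "uniform_limit (ball z e) f h sequentially" using loc[OF z] by blast
      then have "(\<lambda>n. f n z) \<longlonglongrightarrow> h z" using tendsto_uniform_limitI by fastforce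
      then have 1: "(\<lambda>n. stereo (f n z)) \<longlonglongrightarrow> stereo (h z)" by (rule tendsto_stereo)
      obtain e where e: "e > 0" "uniform_limit (ball z e) (\<lambda>n w. stereo (f n w)) \<phi> sequentially" using lim[OF z] by blast
      then have "(\<lambda>n. stereo (f n z)) \<longlonglongrightarrow> \<phi> z" using tendsto_uniform_limitI by fastforce
      with 1 show ?thesis using LIMSEQ_unique by blast
    qed
    ultimately show ?thesis using loc by blast
  qed
qed

section \<open>Zalcman-Pang rescaling\<close>

text \<open>Stated through vanishing derivatives, so that identically vanishing functions need no
  separate case and the condition passes easily to rescalings and limits.\<close>

definition zeros_order_ge :: "nat \<Rightarrow> (complex \<Rightarrow> complex) \<Rightarrow> complex set \<Rightarrow> bool" where
  "zeros_order_ge k f S \<longleftrightarrow> (\<forall>z\<in>S. f z = 0 \<longrightarrow> (\<forall>j<k. (deriv ^^ j) f z = 0))"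

text \<open>The spherical derivative at \<open>0\<close> of \<open>\<zeta> \<mapsto> f (z + s^q \<zeta>) / s^p\<close>;
  with \<open>\<rho> = s^q\<close> this is the Zalcman-Pang rescaling of exponent \<open>\<alpha> = p/q\<close>.\<close>

definition scaled_sph_deriv :: "nat \<Rightarrow> nat \<Rightarrow> (complex \<Rightarrow> complex) \<Rightarrow> complex \<Rightarrow> real \<Rightarrow> real" where
  "scaled_sph_deriv p q f z s = s ^ (q + p) * cmod (deriv f z) / (s ^ (2 * p) + (cmod (f z))\<^sup>2)"

text \<open>The model case |f| = x^n, |f'| = x^(n-1): the scaled spherical derivative is at most
  s^(1/n), written without roots. With X = x^n and Y = s^p, both sides are compared with the maximum
  of X and Y; the inequality p < nq leaves one spare factor s.\<close>

lemma power_mult_le_sum_power: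
  fixes s x :: real
  assumes s: "0 \<le> s" "s \<le> 1" and x: "0 \<le> x" and n: "n \<ge> 1" and pq: "p < n * q"
  shows "(s ^ (q + p) * x ^ (n - 1)) ^ n \<le> s * (s ^ (2 * p) + x ^ (2 * n)) ^ n"
proof -
  define X Y m where "X = x ^ n" and "Y = s ^ p" and "m = max X Y"
  have nn: "0 \<le> X" "0 \<le> Y" "X \<le> m" "Y \<le> m" "0 \<le> m"
    using s x by (auto simp: X_def Y_def m_def le_max_iff_disj)
  have "m ^ 2 \<le> Y ^ 2 + X ^ 2"
    by (auto simp: m_def max_def)
  then have "(m ^ 2) ^ n \<le> (Y ^ 2 + X ^ 2) ^ n"
    by (intro power_mono) auto
  moreover have "(m ^ 2) ^ n = m ^ (n - 1) * m ^ (n + 1)"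
  proof -
    have "2 * n = (n - 1) + (n + 1)" using n by simp
    then show ?thesis by (metis power_add power_mult)
  qed
  moreover have "X ^ (n - 1) * Y ^ (n + 1) \<le> m ^ (n - 1) * m ^ (n + 1)"
    using nn by (intro mult_mono power_mono) auto
  ultimately have 1: "X ^ (n - 1) * Y ^ (n + 1) \<le> (Y ^ 2 + X ^ 2) ^ n"
    by linarith
  have "(s ^ (q + p) * x ^ (n - 1)) ^ n = s ^ ((q + p) * n) * X ^ (n - 1)"
    by (simp add: power_mult_distrib X_def mult.commute flip: power_mult)
  also have "\<dots> \<le> s ^ (1 + p * (n + 1)) * X ^ (n - 1)"
  proof -
    have "1 + p * (n + 1) \<le> (q + p) * n"
      using pq by (simp add: algebra_simps)
    then show ?thesis
      using s nn by (intro mult_right_mono power_decreasing) auto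
  qed
  also have "\<dots> = s * (X ^ (n - 1) * Y ^ (n + 1))"
    by (simp only: Y_def power_add power_mult power_one_right mult_ac)
  also have "\<dots> \<le> s * (Y ^ 2 + X ^ 2) ^ n"
    using 1 s by (intro mult_left_mono) auto
  also have "Y ^ 2 + X ^ 2 = s ^ (2 * p) + x ^ (2 * n)"
    by (simp add: X_def Y_def mult.commute flip: power_mult)
  finally show ?thesis .
qed

lemma scaled_sph_deriv_nonneg: "s \<ge> 0 \<Longrightarrow> scaled_sph_deriv p q f z s \<ge> 0"
  by (auto simp: scaled_sph_deriv_def intro!: divide_nonneg_nonneg mult_nonneg_nonneg add_nonneg_nonneg)

text \<open>With n the exact order of the zero, f is (w - z1)^n times a zero-free function; on a
  smaller closed disc compactness bounds that factor from below, and from above the factor left in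
  f'.\<close>

lemma zero_order_bounds:
  assumes hol: "f holomorphic_on ball z1 r" and r: "r > 0"
    and dz: "\<forall>j<k. (deriv ^^ j) f z1 = 0" and k: "k \<ge> 1"
    and nz: "\<exists>w\<in>ball z1 r. f w \<noteq> 0"
  obtains n \<delta> c C where "n \<ge> k" "\<delta> > 0" "0 < c" "c \<le> 1" "0 \<le> C"
    "\<And>w. w \<in> ball z1 \<delta> \<Longrightarrow> c * dist w z1 ^ n \<le> cmod (f w)"
    "\<And>w. w \<in> ball z1 \<delta> \<Longrightarrow> cmod (deriv f w) \<le> C * dist w z1 ^ (n - 1)"
proof -
  have "\<exists>n. (deriv ^^ n) f z1 \<noteq> 0"
  proof (rule ccontr)
    assume "\<nexists>n. (deriv ^^ n) f z1 \<noteq> 0"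
    then have "f w = 0" if "w \<in> ball z1 r" for w
      using holomorphic_fun_eq_0_on_connected[OF hol open_ball connected_ball, of z1 w] that r by auto
    then show False using nz by blast
  qed
  then obtain n where n: "(deriv ^^ n) f z1 \<noteq> 0" "\<And>i. i < n \<Longrightarrow> (deriv ^^ i) f z1 = 0"
    using exists_least_iff[of "\<lambda>n. (deriv ^^ n) f z1 \<noteq> 0"] by blast
  have nk: "n \<ge> k" using n(1) dz not_le by blast
  then have n0: "0 < n" using k by simp
  obtain g e where e: "0 < e" and g: "g holomorphic_on ball z1 e"
     "\<And>w. w \<in> ball z1 e \<Longrightarrow> f w - f z1 = (w - z1) ^ n * g w" "\<And>w. w \<in> ball z1 e \<Longrightarrow> g w \<noteq> 0"
    using holomorphic_factor_order_of_zero[OF hol open_ball _ n0 n(1)] n(2) r by (metis centre_in_ball)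
  have f0: "f z1 = 0" using dz k by (metis funpow_0 less_le_trans zero_less_one)
  define \<delta> where "\<delta> = e / 2"
  have \<delta>: "\<delta> > 0" "cball z1 \<delta> \<subseteq> ball z1 e" using e by (auto simp: \<delta>_def)
  have cg: "continuous_on (cball z1 \<delta>) g"
    using g(1) \<delta>(2) holomorphic_on_imp_continuous_on holomorphic_on_subset by blast
  have cdg: "continuous_on (cball z1 \<delta>) (deriv g)"
    using holomorphic_deriv[OF g(1) open_ball] \<delta>(2) holomorphic_on_imp_continuous_on holomorphic_on_subset by blast
  obtain y where y: "y \<in> cball z1 \<delta>" "\<And>w. w \<in> cball z1 \<delta> \<Longrightarrow> cmod (g y) \<le> cmod (g w)"
    using continuous_attains_inf[OF compact_cball _ continuous_on_norm[OF cg]] \<delta>(1) by fastforce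
  have gy: "cmod (g y) > 0" using y(1) \<delta>(2) g(3) by auto
  have "compact ((\<lambda>w. of_nat n * g w + (w - z1) * deriv g w) ` cball z1 \<delta>)"
    by (intro compact_continuous_image continuous_intros cg cdg) auto
  then obtain B where B: "\<And>w. w \<in> cball z1 \<delta> \<Longrightarrow> cmod (of_nat n * g w + (w - z1) * deriv g w) \<le> B"
    by (meson bounded_iff compact_imp_bounded imageI)
  \<comment> \<open>The lower constant is capped at 1 so that its square can later be pulled out of
    both terms of \<open>s ^ (2 * p) + (cmod (f z))\<^sup>2\<close>.\<close>
  show ?thesis
  proof (rule that[OF nk \<delta>(1), of "min 1 (cmod (g y))" "max 0 B"])
    fix w assume w: "w \<in> ball z1 \<delta>"
    then have wc: "w \<in> cball z1 \<delta>" by simp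
    then have we: "w \<in> ball z1 e" using \<delta>(2) by blast
    have "min 1 (cmod (g y)) * dist w z1 ^ n \<le> cmod (g w) * dist w z1 ^ n"
      using y(2)[OF wc] by (intro mult_right_mono) auto
    also have "\<dots> = cmod (f w)"
      using g(2)[OF we] f0 by (simp add: norm_mult norm_power dist_norm)
    finally show "min 1 (cmod (g y)) * dist w z1 ^ n \<le> cmod (f w)" .
    have "deriv f w = deriv (\<lambda>w. (w - z1) ^ n * g w) w"
    proof (rule deriv_cong_ev[OF _ refl])
      have "\<forall>\<^sub>F x in nhds w. x \<in> ball z1 e" using we by (intro eventually_nhds_in_open) auto
      then show "\<forall>\<^sub>F x in nhds w. f x = (x - z1) ^ n * g x"
        by eventually_elim (use g(2) f0 in auto)
    qed
    also have "\<dots> = (w - z1) ^ (n - 1) * (of_nat n * g w + (w - z1) * deriv g w)"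
    proof -
      have "g field_differentiable at w" using g(1) we holomorphic_on_imp_differentiable_at open_ball by blast
      then have "(g has_field_derivative deriv g w) (at w)" by (simp add: DERIV_deriv_iff_field_differentiable)
      moreover have "((\<lambda>w. (w - z1) ^ n) has_field_derivative of_nat n * (w - z1) ^ (n - 1)) (at w)"
        by (auto intro!: derivative_eq_intros)
      ultimately have "((\<lambda>w. (w - z1) ^ n * g w) has_field_derivative
          of_nat n * (w - z1) ^ (n - 1) * g w + deriv g w * (w - z1) ^ n) (at w)"
        by (intro DERIV_mult)
      moreover have "(w - z1) ^ n = (w - z1) ^ (n - 1) * (w - z1)"
        using n0 by (metis power_minus_mult)
      ultimately have "((\<lambda>w. (w - z1) ^ n * g w) has_field_derivative
          (w - z1) ^ (n - 1) * (of_nat n * g w + (w - z1) * deriv g w)) (at w)"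
        by (simp add: distrib_left mult_ac)
      then show ?thesis by (rule DERIV_imp_deriv)
    qed
    finally have "cmod (deriv f w) = dist w z1 ^ (n - 1) * cmod (of_nat n * g w + (w - z1) * deriv g w)"
      by (simp add: norm_mult norm_power dist_norm)
    also have "\<dots> \<le> dist w z1 ^ (n - 1) * max 0 B"
      using B[OF wc] by (intro mult_left_mono) auto
    finally show "cmod (deriv f w) \<le> max 0 B * dist w z1 ^ (n - 1)" by (simp add: mult.commute)
  qed (use gy in auto)
qed

text \<open>This is where the bound \<open>\<alpha> = p/q < k\<close> on the exponent enters.\<close>

lemma scaled_sph_deriv_near_zero:
  assumes hol: "f holomorphic_on ball z1 r" and r: "r > 0"
    and dz: "\<forall>j<k. (deriv ^^ j) f z1 = 0" and k: "k \<ge> 1" and pq: "p < k * q" and e: "\<epsilon> > 0"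
  shows "\<exists>\<delta>>0. \<forall>z s. dist z z1 < \<delta> \<and> 0 \<le> s \<and> s < \<delta> \<longrightarrow> scaled_sph_deriv p q f z s < \<epsilon>"
proof (cases "\<exists>w\<in>ball z1 r. f w \<noteq> 0")
  case False
  then have "deriv f z = 0" if "z \<in> ball z1 r" for z
  proof -
    have "deriv f z = deriv (\<lambda>_. 0) z"
    proof (rule deriv_cong_ev[OF _ refl])
      have "\<forall>\<^sub>F x in nhds z. x \<in> ball z1 r" using that by (intro eventually_nhds_in_open) auto
      then show "\<forall>\<^sub>F x in nhds z. f x = 0" by eventually_elim (use False in auto)
    qed
    then show ?thesis by simp
  qed
  then show ?thesis
    using r e by (intro exI[of _ r]) (auto simp: scaled_sph_deriv_def dist_commute)
next
  case True
  obtain n \<delta> c C where n: "n \<ge> k" and \<delta>: "\<delta> > 0" and c: "0 < c" "c \<le> 1" and C: "0 \<le> C"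
    and f1: "\<And>w. w \<in> ball z1 \<delta> \<Longrightarrow> c * dist w z1 ^ n \<le> cmod (f w)"
    and f2: "\<And>w. w \<in> ball z1 \<delta> \<Longrightarrow> cmod (deriv f w) \<le> C * dist w z1 ^ (n - 1)"
    using zero_order_bounds[OF hol r dz k True] by metis
  have n1: "n \<ge> 1" using n k by simp
  have pn: "p < n * q" using pq n by (meson less_le_trans mult_le_mono1)
  define K where "K = (C / c\<^sup>2) ^ n"
  have K: "K \<ge> 0" using C by (simp add: K_def)
  have bound: "scaled_sph_deriv p q f z s ^ n \<le> K * s" if z: "dist z z1 < \<delta>" and s: "0 \<le> s" "s \<le> 1" for z s
  proof (cases "s ^ (2 * p) + dist z z1 ^ (2 * n) = 0")
    case True
    then have "dist z z1 ^ (2 * n) = 0" "s ^ (2 * p) = 0"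
      using s by (smt (verit) zero_le_dist zero_le_power)+
    then have "s = 0" by simp
    have "q \<noteq> 0" using pq by (metis mult_0_right not_less_zero)
    then have "scaled_sph_deriv p q f z s = 0"
      using \<open>s = 0\<close> by (simp add: scaled_sph_deriv_def power_0_left)
    then show ?thesis using n1 \<open>s = 0\<close> by (simp add: power_0_left)
  next
    case False
    define x where "x = dist z z1"
    define D where "D = s ^ (2 * p) + x ^ (2 * n)"
    have x: "x \<ge> 0" and D: "D > 0"
      using False s unfolding D_def x_def by (simp, smt (verit) zero_le_dist zero_le_power)
    have zb: "z \<in> ball z1 \<delta>" using z by (simp add: dist_commute)
    have "(c * x ^ n)\<^sup>2 \<le> (cmod (f z))\<^sup>2"
      using f1[OF zb] c x by (intro power_mono) (auto simp: x_def)
    moreover have "(c * x ^ n)\<^sup>2 = c\<^sup>2 * x ^ (2 * n)"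
      by (simp add: power_mult_distrib mult.commute flip: power_mult)
    moreover have "c\<^sup>2 * s ^ (2 * p) \<le> 1 * s ^ (2 * p)"
      using c s by (intro mult_right_mono) (auto simp: power_le_one)
    ultimately have den: "c\<^sup>2 * D \<le> s ^ (2 * p) + (cmod (f z))\<^sup>2"
      by (simp add: D_def distrib_left)
    have "scaled_sph_deriv p q f z s \<le> s ^ (q + p) * (C * x ^ (n - 1)) / (c\<^sup>2 * D)"
      unfolding scaled_sph_deriv_def
      using den D c s f2[OF zb] C x by (intro frac_le mult_left_mono mult_nonneg_nonneg) (auto simp: x_def)
    also have "\<dots> = C / c\<^sup>2 * (s ^ (q + p) * x ^ (n - 1) / D)"
      by simp
    finally have "scaled_sph_deriv p q f z s ^ n \<le> (C / c\<^sup>2 * (s ^ (q + p) * x ^ (n - 1) / D)) ^ n"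
      using s by (intro power_mono scaled_sph_deriv_nonneg)
    also have "\<dots> = K * ((s ^ (q + p) * x ^ (n - 1)) ^ n / D ^ n)"
      unfolding K_def by (simp only: power_mult_distrib power_divide)
    also have "\<dots> \<le> K * s"
    proof (intro mult_left_mono K)
      have "(s ^ (q + p) * x ^ (n - 1)) ^ n \<le> s * D ^ n"
        unfolding D_def using power_mult_le_sum_power[OF s x n1 pn] .
      then show "(s ^ (q + p) * x ^ (n - 1)) ^ n / D ^ n \<le> s"
        using D by (simp add: divide_le_eq)
    qed
    finally show ?thesis .
  qed
  \<comment> \<open>The bound holds for the n-th power, hence the comparison with
    \<open>\<epsilon> ^ n\<close>; \<open>K + 1\<close> keeps the quotient meaningful for K =
    0.\<close>
  define \<delta>' where "\<delta>' = min \<delta> (min 1 (\<epsilon> ^ n / (K + 1)))"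
  have "\<delta>' > 0" using \<delta> e K by (simp add: \<delta>'_def)
  moreover have "scaled_sph_deriv p q f z s < \<epsilon>" if "dist z z1 < \<delta>'" "0 \<le> s" "s < \<delta>'" for z s
  proof -
    have "scaled_sph_deriv p q f z s ^ n \<le> K * s"
      using that by (intro bound) (auto simp: \<delta>'_def)
    also have "\<dots> \<le> (K + 1) * s" using that by (simp add: algebra_simps)
    also have "\<dots> < (K + 1) * (\<epsilon> ^ n / (K + 1))"
      using that K by (intro mult_strict_left_mono) (auto simp: \<delta>'_def)
    also have "\<dots> = \<epsilon> ^ n" using K by simp
    finally show ?thesis using e by (metis less_imp_le power_less_imp_less_base)
  qed
  ultimately show ?thesis by blast
qed

text \<open>Continuity up to s = 0 is what permits an extremal choice by compactness. It is delicate
  only where s = 0 and f vanishes: there the quotient is 0/0 with value 0, and the order of the zero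
  gives the limit 0.\<close>

lemma continuous_on_scaled_sph_deriv:
  assumes hol: "f holomorphic_on S" and S: "open S" and zeros: "zeros_order_ge k f S"
    and k: "k \<ge> 1" and pq: "p < k * q" and p: "p > 0"
  shows "continuous_on (S \<times> {0..1}) (\<lambda>x. scaled_sph_deriv p q f (fst x) (snd x))"
  unfolding continuous_on_def
proof
  fix x assume x: "x \<in> S \<times> {0..1::real}"
  obtain z1 s1 where xx: "x = (z1, s1)" by (cases x)
  have z1: "z1 \<in> S" and s1: "0 \<le> s1" "s1 \<le> 1" using x xx by auto
  let ?F = "at x within S \<times> {0..1}"
  show "((\<lambda>x. scaled_sph_deriv p q f (fst x) (snd x)) \<longlongrightarrow> scaled_sph_deriv p q f (fst x) (snd x)) ?F"
  proof (cases "s1 ^ (2 * p) + (cmod (f z1))\<^sup>2 = 0")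
    case False
    have t1: "(fst \<longlongrightarrow> z1) ?F" "(snd \<longlongrightarrow> s1) ?F"
      using xx by (auto intro!: tendsto_eq_intros)
    have "isCont f z1" "isCont (deriv f) z1"
      using hol holomorphic_deriv[OF hol S] S z1
      by (auto simp: continuous_on_eq_continuous_at dest!: holomorphic_on_imp_continuous_on)
    then have t2: "((\<lambda>x. f (fst x)) \<longlongrightarrow> f z1) ?F" "((\<lambda>x. deriv f (fst x)) \<longlongrightarrow> deriv f z1) ?F"
      using t1(1) isCont_tendsto_compose by blast+
    show ?thesis
      unfolding scaled_sph_deriv_def xx fst_conv snd_conv
      using False t1 t2 unfolding xx by (intro tendsto_intros) auto
  next
    case True
    then have "s1 ^ (2 * p) = 0" "(cmod (f z1))\<^sup>2 = 0"
      using s1 by (smt (verit) zero_le_power zero_le_power2)+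
    then have s0: "s1 = 0" and f0: "f z1 = 0" by auto
    obtain r where r: "r > 0" "ball z1 r \<subseteq> S" using S z1 open_contains_ball by blast
    have holr: "f holomorphic_on ball z1 r" using hol r holomorphic_on_subset by blast
    have dz: "\<forall>j<k. (deriv ^^ j) f z1 = 0" using zeros z1 f0 by (auto simp: zeros_order_ge_def)
    have L0: "scaled_sph_deriv p q f (fst x) (snd x) = 0"
      using p by (simp add: scaled_sph_deriv_def xx s0)
    show ?thesis unfolding L0
    proof (rule tendstoI)
      fix e :: real assume "e > 0"
      from scaled_sph_deriv_near_zero[OF holr r(1) dz k pq this]
      obtain \<delta> where \<delta>: "\<delta> > 0" "\<And>z s. dist z z1 < \<delta> \<Longrightarrow> 0 \<le> s \<Longrightarrow> s < \<delta> \<Longrightarrow> scaled_sph_deriv p q f z s < e"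
        by blast
      show "\<forall>\<^sub>F y in ?F. dist (scaled_sph_deriv p q f (fst y) (snd y)) 0 < e"
        unfolding eventually_at
      proof (intro exI[of _ \<delta>] conjI ballI impI \<delta>(1))
        fix y assume y: "y \<in> S \<times> {0..1::real}" "y \<noteq> x \<and> dist y x < \<delta>"
        have "dist (fst y) z1 < \<delta>" "dist (snd y) 0 < \<delta>"
          using dist_fst_le[of y x] dist_snd_le[of y x] y xx s0 by auto
        moreover have "0 \<le> snd y" using y by auto
        ultimately show "dist (scaled_sph_deriv p q f (fst y) (snd y)) 0 < e"
          using \<delta>(2)[of "fst y" "snd y"] scaled_sph_deriv_nonneg[of "snd y" p q f "fst y"] by (simp add: dist_real_def)
      qed
    qed
  qed
qed

text \<open>Changing the scale by a factor of at most 2 costs \<open>2 ^ (q + p)\<close> in the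
  numerator and \<open>2 ^ (2 * p)\<close> in the denominator.\<close>

lemma scaled_sph_deriv_comparable:
  assumes s: "0 < s'" "s' / 2 \<le> s" "s \<le> 2 * s'"
  shows "scaled_sph_deriv p q f z s \<le> 2 ^ (q + 3 * p) * scaled_sph_deriv p q f z s'"
proof -
  define D where "D = s' ^ (2 * p) + (cmod (f z))\<^sup>2"
  have D: "D > 0" using s by (simp add: D_def add_pos_nonneg)
  have "D \<le> 2 ^ (2 * p) * (s ^ (2 * p) + (cmod (f z))\<^sup>2)"
  proof -
    have "s' ^ (2 * p) \<le> (2 * s) ^ (2 * p)" using s by (intro power_mono) auto
    moreover have "1 * (cmod (f z))\<^sup>2 \<le> 2 ^ (2 * p) * (cmod (f z))\<^sup>2" by (intro mult_right_mono) auto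
    ultimately show ?thesis by (simp add: D_def distrib_left power_mult_distrib)
  qed
  then have den: "D / 2 ^ (2 * p) \<le> s ^ (2 * p) + (cmod (f z))\<^sup>2" by (simp add: field_simps)
  have "s ^ (q + p) \<le> (2 * s') ^ (q + p)" using s by (intro power_mono) auto
  then have "scaled_sph_deriv p q f z s \<le> (2 * s') ^ (q + p) * cmod (deriv f z) / (D / 2 ^ (2 * p))"
    unfolding scaled_sph_deriv_def using den D s by (intro frac_le mult_right_mono) auto
  also have "\<dots> = (2 ^ (q + p) * 2 ^ (2 * p)) * (s' ^ (q + p) * cmod (deriv f z) / D)"
    by (simp add: power_mult_distrib)
  also have "2 ^ (q + p) * 2 ^ (2 * p) = (2::real) ^ (q + 3 * p)"
    by (simp flip: power_add)
  finally show ?thesis by (simp add: scaled_sph_deriv_def D_def)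
qed

text \<open>For s \<le> 1 the denominator is at most that of \<open>sph_deriv\<close>, so a huge
  spherical derivative keeps the scaled one large at small scales as well.\<close>

lemma scaled_sph_deriv_ge:
  assumes "0 \<le> s0" "s0 \<le> s" "s \<le> 1" "0 < s"
  shows "s0 ^ (p + q) * sph_deriv f z \<le> scaled_sph_deriv p q f z s"
proof -
  have "s0 ^ (p + q) * sph_deriv f z \<le> s ^ (p + q) * sph_deriv f z"
    using assms by (intro mult_right_mono power_mono sph_deriv_nonneg) auto
  also have "\<dots> = s ^ (q + p) * cmod (deriv f z) / (1 + (cmod (f z))\<^sup>2)"
    by (simp add: sph_deriv_def add.commute)
  also have "\<dots> \<le> scaled_sph_deriv p q f z s"
    unfolding scaled_sph_deriv_def
  proof (intro divide_left_mono)
    show "s ^ (2 * p) + (cmod (f z))\<^sup>2 \<le> 1 + (cmod (f z))\<^sup>2"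
      using assms by (simp add: power_le_one)
    show "0 < (1 + (cmod (f z))\<^sup>2) * (s ^ (2 * p) + (cmod (f z))\<^sup>2)"
      using assms by (intro mult_pos_pos add_pos_nonneg) auto
  qed (use assms in auto)
  finally show ?thesis .
qed

text \<open>Among the points where the scaled derivative at scale (d - |z - z0|) t is at least 1,
  one with least t is taken. The weight d - |z - z0| makes the quantity vanish on the boundary, so
  the point is interior; minimality bounds the quantity by 1 everywhere for this t. The large value
  at \<open>w\<close> forces 2Rt \<le> 1, so the weight changes by at most a factor 2 on the disc
  that rescales to radius R.\<close>

lemma rescaling:
  assumes hol: "f holomorphic_on S" and S: "open S" "cball z0 d \<subseteq> S" and d: "0 < d" "d \<le> 1"
    and zeros: "zeros_order_ge k f S" and k: "k \<ge> 1" and pq: "p < k * q" and p: "p > 0"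
    and R: "R \<ge> 1" and w: "w \<in> ball z0 (d / 2)" and big: "sph_deriv f w > (4 * R / d) ^ (p + q)"
  obtains z s where "0 < s" "scaled_sph_deriv p q f z s \<ge> 1"
    "\<And>\<zeta>. cmod \<zeta> \<le> R \<Longrightarrow> z + of_real (s ^ q) * \<zeta> \<in> ball z0 d \<and>
        scaled_sph_deriv p q f (z + of_real (s ^ q) * \<zeta>) s \<le> 2 ^ (q + 3 * p)"
proof -
  have q: "q \<ge> 1" using pq by (cases q) auto
  define H where "H = (\<lambda>x. scaled_sph_deriv p q f (fst x) ((d - dist z0 (fst x)) * snd x))"
  define K where "K = cball z0 d \<times> {0..1::real}"
  have rng: "(d - dist z0 z) * t \<in> {0..1}" if "z \<in> cball z0 d" "0 \<le> t" "t \<le> 1" for z t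
  proof -
    have "(d - dist z0 z) * t \<le> 1 * 1" using that d by (intro mult_mono) (auto intro: order_trans[of _ d])
    then show ?thesis using that by auto
  qed
  have contH: "continuous_on K H"
    unfolding H_def
  proof (rule continuous_on_compose2[OF continuous_on_scaled_sph_deriv[OF hol S(1) zeros k pq p],
      of K "\<lambda>x. (fst x, (d - dist z0 (fst x)) * snd x)", simplified])
    show "continuous_on K (\<lambda>x. (fst x, (d - dist z0 (fst x)) * snd x))"
      by (intro continuous_intros)
    show "(\<lambda>x. (fst x, (d - dist z0 (fst x)) * snd x)) ` K \<subseteq> S \<times> {0..1}"
      using S(2) rng by (force simp: K_def)
  qed
  have compK: "compact K" by (simp add: K_def compact_Times)
  define A where "A = {x \<in> K. H x \<ge> 1}"
  have "closed A" unfolding A_def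
    using continuous_closed_preimage[OF contH compact_imp_closed[OF compK], of "{1..}"]
    by (simp add: vimage_def Int_def)
  then have "compact (K \<inter> A)" by (intro compact_Int_closed compK)
  then have compA: "compact A" by (simp add: A_def Int_def conj_commute)
  \<comment> \<open>The weight at \<open>w\<close> exceeds d/2, and (d/2) t (4R/d) = 2Rt; this is
    the origin of the threshold \<open>4 * R / d\<close>.\<close>
  have low: "(2 * R * t) ^ (p + q) < H (w, t)" if t: "0 < t" "t \<le> 1" for t
  proof -
    have wd: "dist z0 w < d / 2" using w by simp
    have "2 * R * t = (d / 2 * t) * (4 * R / d)"
      using d by simp
    then have "(2 * R * t) ^ (p + q) = (d / 2 * t) ^ (p + q) * (4 * R / d) ^ (p + q)"
      by (simp only: power_mult_distrib[symmetric])
    also have "\<dots> < (d / 2 * t) ^ (p + q) * sph_deriv f w"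
      using big d t by (intro mult_strict_left_mono) auto
    also have "\<dots> \<le> H (w, t)"
      unfolding H_def fst_conv snd_conv
    proof (rule scaled_sph_deriv_ge)
      show "d / 2 * t \<le> (d - dist z0 w) * t" using wd t by (intro mult_right_mono) auto
      show "(d - dist z0 w) * t \<le> 1" using rng[of w t] wd d t by auto
      show "0 < (d - dist z0 w) * t" using wd t d by (intro mult_pos_pos) auto
    qed (use d t in auto)
    finally show ?thesis .
  qed
  have "(1::real) \<le> (2 * R * 1) ^ (p + q)" using R by (intro one_le_power) auto
  then have "(w, 1) \<in> A" using low[of 1] w d by (auto simp: A_def K_def)
  then obtain x where x: "x \<in> A" "\<And>y. y \<in> A \<Longrightarrow> snd x \<le> snd y"
    using continuous_attains_inf[OF compA _ continuous_on_snd[OF continuous_on_id]] by (metis empty_iff)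
  obtain z t where xx: "x = (z, t)" by (cases x)
  have z: "z \<in> cball z0 d" and t: "0 \<le> t" "t \<le> 1" and H1: "H (z, t) \<ge> 1"
    using x xx by (auto simp: A_def K_def)
  define s where "s = (d - dist z0 z) * t"
  have "s \<noteq> 0"
  proof
    assume "s = 0"
    then have "H (z, t) = 0" using p by (simp add: H_def s_def[symmetric] scaled_sph_deriv_def)
    then show False using H1 by simp
  qed
  then have zd: "dist z0 z < d" and t0: "0 < t" and s0: "0 < s"
    using z t by (auto simp: s_def intro!: mult_pos_pos)
  \<comment> \<open>Minimality of t excludes values of at least 1 only for parameters below t; the
    parameter t itself is reached by continuity.\<close>
  have le1: "H (y, t) \<le> 1" if y: "y \<in> cball z0 d" for y
  proof -
    have "continuous_on (closure {0<..<t}) (\<lambda>u. H (y, u))"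
    proof (rule continuous_on_compose2[OF contH])
      show "continuous_on (closure {0<..<t}) (\<lambda>u. (y, u))" by (intro continuous_intros)
      show "(\<lambda>u. (y, u)) ` closure {0<..<t} \<subseteq> K" using y t t0 by (auto simp: K_def)
    qed
    moreover have "t \<in> closure {0<..<t}" using t0 by simp
    moreover have "H (y, u) \<le> 1" if "u \<in> {0<..<t}" for u
    proof (rule ccontr)
      assume "\<not> H (y, u) \<le> 1"
      then have "(y, u) \<in> A" using y that t by (auto simp: A_def K_def)
      from x(2)[OF this] show False using xx that by simp
    qed
    ultimately show ?thesis by (rule continuous_le_on_closure)
  qed
  have "(2 * R * t) ^ (p + q) \<le> 1"
    using low[OF t0 t(2)] le1[of w] w d by auto
  then have tR: "2 * R * t \<le> 1"
    using p R t by (subst (asm) power_le_one_iff) auto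
  have s1: "s \<le> 1" using rng[OF z t] by (simp add: s_def)
  show ?thesis
  proof (rule that[OF s0, of z])
    show "1 \<le> scaled_sph_deriv p q f z s" using H1 by (simp add: H_def s_def)
    fix \<zeta> :: complex assume \<zeta>: "cmod \<zeta> \<le> R"
    define z' where "z' = z + of_real (s ^ q) * \<zeta>"
    have "dist z z' = s ^ q * cmod \<zeta>" using s0 by (simp add: z'_def dist_norm norm_mult norm_power)
    \<comment> \<open>From s \<le> 1 and q \<ge> 1 one has \<open>s ^ q \<le> s\<close>, so the disc
      is no larger than one whose radius is linear in the scale.\<close>
    also have "\<dots> \<le> s * R"
      using \<zeta> s0 s1 q R power_decreasing[of 1 q s] by (intro mult_mono) auto
    also have "\<dots> = (d - dist z0 z) * (2 * R * t) / 2" by (simp add: s_def)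
    also have "\<dots> \<le> (d - dist z0 z) * 1 / 2" using tR zd by (intro divide_right_mono mult_left_mono) auto
    finally have dz: "dist z z' \<le> (d - dist z0 z) / 2" by simp
    have d1: "(d - dist z0 z) / 2 \<le> d - dist z0 z'"
      using dz dist_triangle[of z0 z' z] by (simp add: field_simps)
    have d2: "d - dist z0 z' \<le> 3 / 2 * (d - dist z0 z)"
      using dz dist_triangle[of z0 z z'] by (simp add: dist_commute)
    have zb: "z' \<in> ball z0 d" using d1 zd by simp
    define s' where "s' = (d - dist z0 z') * t"
    have "s / 2 \<le> s'" using mult_right_mono[OF d1, of t] t by (simp add: s_def s'_def)
    moreover have "s' \<le> 3 / 2 * s" using mult_right_mono[OF d2 t(1)] by (simp only: s_def s'_def mult.assoc)
    ultimately have "scaled_sph_deriv p q f z' s \<le> 2 ^ (q + 3 * p) * scaled_sph_deriv p q f z' s'"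
      using s0 by (intro scaled_sph_deriv_comparable) auto
    also have "\<dots> \<le> 2 ^ (q + 3 * p) * 1"
      using le1[of z'] zb by (intro mult_left_mono) (auto simp: H_def s'_def)
    finally show "z + of_real (s ^ q) * \<zeta> \<in> ball z0 d \<and>
        scaled_sph_deriv p q f (z + of_real (s ^ q) * \<zeta>) s \<le> 2 ^ (q + 3 * p)"
      using zb by (simp add: z'_def)
  qed
qed

lemma sph_deriv_rescaled:
  assumes "f field_differentiable at (z + of_real (s ^ q) * \<zeta>)" and s: "s > 0"
  shows "sph_deriv (\<lambda>\<zeta>. f (z + of_real (s ^ q) * \<zeta>) / of_real (s ^ p)) \<zeta> =
    scaled_sph_deriv p q f (z + of_real (s ^ q) * \<zeta>) s"
proof -
  define u where "u = z + of_real (s ^ q) * \<zeta>"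
  have "(f has_field_derivative deriv f u) (at (z + of_real (s ^ q) * \<zeta>))"
    using assms(1) by (simp add: u_def DERIV_deriv_iff_field_differentiable)
  then have "((\<lambda>\<zeta>. f (z + of_real (s ^ q) * \<zeta>) / of_real (s ^ p)) has_field_derivative
      (deriv f u * of_real (s ^ q)) / of_real (s ^ p)) (at \<zeta>)"
    by (intro DERIV_cdivide DERIV_chain2[where f = f]) (auto intro!: derivative_eq_intros)
  then have "deriv (\<lambda>\<zeta>. f (z + of_real (s ^ q) * \<zeta>) / of_real (s ^ p)) \<zeta> = deriv f u * of_real (s ^ q) / of_real (s ^ p)"
    by (rule DERIV_imp_deriv)
  then have "sph_deriv (\<lambda>\<zeta>. f (z + of_real (s ^ q) * \<zeta>) / of_real (s ^ p)) \<zeta> =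
     (cmod (deriv f u) * s ^ q / s ^ p) / (1 + (cmod (f u) / s ^ p)\<^sup>2)"
    using s by (simp add: sph_deriv_def norm_mult norm_divide norm_power u_def)
  also have "\<dots> = scaled_sph_deriv p q f u s"
  proof -
    define X Y D where "X = s ^ p" and "Y = s ^ q" and "D = s ^ (2 * p) + (cmod (f u))\<^sup>2"
    have pos: "X > 0" "D > 0" using s by (auto simp: X_def D_def intro!: add_pos_nonneg)
    have "s ^ (2 * p) = X * X" by (simp add: X_def mult_2 power_add)
    then have "1 + (cmod (f u) / X)\<^sup>2 = D / (X * X)"
      using pos by (simp add: D_def power_divide add_divide_distrib power2_eq_square)
    moreover have "cmod (deriv f u) * Y / X / (D / (X * X)) = Y * X * cmod (deriv f u) / D"
      using pos by simp
    ultimately show ?thesis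
      by (simp add: scaled_sph_deriv_def power_add flip: X_def Y_def D_def)
  qed
  finally show ?thesis by (simp add: u_def)
qed

section \<open>Entire functions of exponential type\<close>

lemma norm_diff_less_norm_add_cnj:
  assumes "Re a > 0" "Re b > 0"
  shows "cmod (a - b) < cmod (a + cnj b)"
proof -
  have "(cmod (a + cnj b))\<^sup>2 - (cmod (a - b))\<^sup>2 = 4 * (Re a * Re b)"
    by (simp only: cmod_power2) (simp add: power2_eq_square algebra_simps)
  also have "\<dots> > 0" using assms by simp
  finally have "(cmod (a - b))\<^sup>2 < (cmod (a + cnj b))\<^sup>2" by simp
  then show ?thesis by (rule power2_less_imp_less) simp
qed

text \<open>The Schwarz lemma for maps into the right half-plane; it contains both Harnack's
  inequality and the Borel--Caratheodory inequality.\<close>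

lemma Schwarz_half_plane:
  assumes hol: "p holomorphic_on ball z0 r" and pos: "\<And>z. z \<in> ball z0 r \<Longrightarrow> Re (p z) > 0"
    and z: "z \<in> ball z0 r"
  shows "cmod (p z - p z0) \<le> dist z z0 / r * cmod (p z + cnj (p z0))"
proof -
  have r: "r > 0" using z by (metis ball_eq_empty empty_iff not_le)
  have p0: "Re (p z0) > 0" using pos r by simp
  \<comment> \<open>The Cayley transform of the right half-plane that sends \<open>p z0\<close> to
    0, applied after normalizing the disc.\<close>
  define \<phi> where "\<phi> = (\<lambda>\<xi>. (p (z0 + of_real r * \<xi>) - p z0) / (p (z0 + of_real r * \<xi>) + cnj (p z0)))"
  have inb: "z0 + of_real r * \<xi> \<in> ball z0 r" if "cmod \<xi> < 1" for \<xi>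
    using that r by (simp add: dist_norm norm_mult)
  have nz: "p y + cnj (p z0) \<noteq> 0" if "y \<in> ball z0 r" for y
    using pos[OF that] p0 by (auto simp: complex_eq_iff)
  have "\<phi> holomorphic_on ball 0 1"
    unfolding \<phi>_def
  proof (intro holomorphic_intros)
    show "(\<lambda>\<xi>. p (z0 + of_real r * \<xi>)) holomorphic_on ball 0 1"
      by (rule holomorphic_on_compose_gen[OF _ hol, unfolded o_def]) (use inb in \<open>auto intro!: holomorphic_intros\<close>)
    then show "(\<lambda>\<xi>. p (z0 + of_real r * \<xi>)) holomorphic_on ball 0 1" .
  qed (use inb nz in auto)
  moreover have "cmod (\<phi> \<xi>) < 1" if "cmod \<xi> < 1" for \<xi>
    using norm_diff_less_norm_add_cnj[OF pos[OF inb[OF that]] p0] nz[OF inb[OF that]]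
    by (simp add: \<phi>_def norm_divide divide_less_eq)
  moreover define \<xi> where "\<xi> = (z - z0) / of_real r"
  have x1: "cmod \<xi> = dist z z0 / r" using r by (simp add: \<xi>_def norm_divide dist_norm)
  then have "cmod \<xi> < 1" using z r by (simp add: dist_commute)
  ultimately have "cmod (\<phi> \<xi>) \<le> cmod \<xi>"
    by (intro Schwarz_Lemma(1)) (auto simp: \<phi>_def)
  moreover have "z0 + of_real r * \<xi> = z" using r by (simp add: \<xi>_def)
  ultimately have "cmod (p z - p z0) / cmod (p z + cnj (p z0)) \<le> dist z z0 / r"
    by (simp add: \<phi>_def norm_divide x1)
  then show ?thesis using nz[OF z] by (simp add: divide_le_eq)
qed

lemma Harnack_lower_bound:
  assumes hol: "p holomorphic_on ball z0 r" and pos: "\<And>z. z \<in> ball z0 r \<Longrightarrow> Re (p z) > 0"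
    and z: "z \<in> ball z0 r"
  shows "Re (p z0) * (1 - dist z z0 / r) \<le> Re (p z) * (1 + dist z z0 / r)"
proof -
  have r: "r > 0" using z by (metis ball_eq_empty empty_iff not_le)
  define t where "t = dist z z0 / r"
  have t: "0 \<le> t" "t < 1" using r z by (auto simp: t_def dist_commute)
  define x u v where "x = Re (p z)" and "u = Re (p z0)" and "v = (Im (p z) - Im (p z0))\<^sup>2"
  have xu: "x > 0" "u > 0" using pos z r by (auto simp: x_def u_def)
  have "(cmod (p z - p z0))\<^sup>2 \<le> (t * cmod (p z + cnj (p z0)))\<^sup>2"
    using Schwarz_half_plane[OF hol pos z] by (intro power_mono) (auto simp: t_def)
  then have "(x - u)\<^sup>2 + v \<le> t\<^sup>2 * ((x + u)\<^sup>2 + v)"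
    by (simp add: cmod_power2 power_mult_distrib x_def u_def v_def)
  moreover have "t\<^sup>2 * v \<le> 1 * v"
    using t by (intro mult_right_mono) (auto simp: v_def power_le_one)
  ultimately have "(u - x)\<^sup>2 \<le> t\<^sup>2 * (x + u)\<^sup>2"
    by (simp add: distrib_left power2_commute)
  then have "(u - x)\<^sup>2 \<le> (t * (x + u))\<^sup>2"
    by (simp only: power_mult_distrib)
  then have "u - x \<le> t * (x + u)"
    by (rule power2_le_imp_le) (use t xu in auto)
  then show ?thesis by (simp add: t_def[symmetric] x_def[symmetric] u_def[symmetric] algebra_simps)
qed

text \<open>If \<open>w\<close> is the point of \<open>{\<bar>g\<bar> \<le> 1}\<close> nearest to \<open>z\<close>, then \<open>ln \<bar>g\<bar>\<close> is positive and harmonic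
  in the disc around \<open>z\<close> with \<open>w\<close> on its boundary, and Harnack's inequality on the radius
  ending at \<open>w\<close> bounds \<open>\<bar>g' w\<bar>\<close> from below in terms of \<open>ln \<bar>g z\<bar>\<close>.\<close>

lemma growth_of_bounded_sph_deriv:
  assumes hol: "g holomorphic_on UNIV" and C: "\<And>z. sph_deriv g z \<le> C" and w0: "cmod (g w0) \<le> 1"
  shows "cmod (g z) \<le> exp (4 * C * dist z w0)"
proof (cases "cmod (g z) \<le> 1")
  case True
  have "0 \<le> C" using C[of z] sph_deriv_nonneg[of g z] by linarith
  then have "1 \<le> exp (4 * C * dist z w0)" by simp
  then show ?thesis using True by linarith
next
  case False
  define S where "S = {w. cmod (g w) \<le> 1}"
  have contg: "continuous_on UNIV g" using hol holomorphic_on_imp_continuous_on by blast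
  have "closed S" unfolding S_def
    by (intro closed_Collect_le continuous_on_norm contg continuous_on_const)
  then obtain w where w: "w \<in> S" "\<And>y. y \<in> S \<Longrightarrow> dist z w \<le> dist z y"
    using distance_attains_inf[of S z] w0 by (auto simp: S_def)
  define r where "r = dist z w"
  have r: "r > 0" using w(1) False by (auto simp: r_def S_def)
  have r0: "r \<le> dist z w0" using w(2)[of w0] w0 by (auto simp: r_def S_def)
  have out: "cmod (g y) > 1" if "y \<in> ball z r" for y
    using w(2)[of y] that by (force simp: S_def r_def)
  have "\<And>y. y \<in> ball z r \<Longrightarrow> g y \<noteq> 0" using out by fastforce
  then obtain h where h: "h holomorphic_on ball z r" "\<And>y. y \<in> ball z r \<Longrightarrow> exp (h y) = g y"
    using holomorphic_logarithm_exists[of "ball z r" g z] hol r holomorphic_on_subset[OF hol subset_UNIV]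
    by (metis centre_in_ball convex_ball open_ball)
  have Reh: "cmod (g y) = exp (Re (h y))" if "y \<in> ball z r" for y
    using h(2)[OF that] norm_exp_eq_Re by metis
  have pos: "Re (h y) > 0" if "y \<in> ball z r" for y
    using out[OF that] Reh[OF that] by simp
  define u where "u = (\<lambda>t::real. w + of_real t * (z - w))"
  \<comment> \<open>Harnack at distance (1 - t) r from the centre, followed by e^x \<ge> 1 + x: |g|
    - 1 grows at least linearly in t on leaving the boundary point \<open>w\<close>.\<close>
  have low: "Re (h z) * t / 2 \<le> cmod (g (u t)) - 1" if t: "0 < t" "t < 1" for t
  proof -
    have "u t - z = of_real (1 - t) * (w - z)" by (simp add: u_def algebra_simps)
    then have "dist (u t) z = cmod (of_real (1 - t)) * cmod (w - z)"
      by (simp only: dist_norm norm_mult)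
    also have "\<dots> = (1 - t) * r"
      using t by (simp only: norm_of_real) (simp add: r_def dist_norm norm_minus_commute)
    finally have du: "dist (u t) z = (1 - t) * r" .
    then have ub: "u t \<in> ball z r" using t r by (simp add: dist_commute)
    have "Re (h z) * (1 - (1 - t)) \<le> Re (h (u t)) * (1 + (1 - t))"
      using Harnack_lower_bound[OF h(1) pos ub] r by (simp add: du)
    also have "\<dots> \<le> Re (h (u t)) * 2" using pos[OF ub] t by (intro mult_left_mono) auto
    finally have "Re (h z) * t / 2 \<le> Re (h (u t))" by simp
    moreover have "1 + Re (h (u t)) \<le> cmod (g (u t))"
      using Reh[OF ub] by (simp add: exp_ge_add_one_self)
    ultimately show ?thesis by linarith
  qed
  have g1: "cmod (g w) \<le> 1" using w(1) by (simp add: S_def)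
  have "(g has_field_derivative deriv g w) (at w)"
    using hol holomorphic_derivI by blast
  then have lim: "((\<lambda>y. (g y - g w) / (y - w)) \<longlongrightarrow> deriv g w) (at w)"
    by (simp add: has_field_derivative_iff)
  have zw: "z \<noteq> w" using r by (auto simp: r_def)
  have fl: "filterlim u (at w) (at_right 0)"
  proof (rule filterlim_atI)
    show "(u \<longlongrightarrow> w) (at_right 0)"
      unfolding u_def by (auto intro!: tendsto_eq_intros)
    have "\<forall>\<^sub>F t::real in at_right 0. t > 0" by (simp add: eventually_at_right_less)
    then show "\<forall>\<^sub>F t in at_right 0. u t \<noteq> w"
      by eventually_elim (use zw in \<open>auto simp: u_def\<close>)
  qed
  have "((\<lambda>t. cmod ((g (u t) - g w) / (u t - w))) \<longlongrightarrow> cmod (deriv g w)) (at_right 0)"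
    by (intro tendsto_norm filterlim_compose[OF lim fl])
  moreover have "\<forall>\<^sub>F t in at_right 0. Re (h z) / (2 * r) \<le> cmod ((g (u t) - g w) / (u t - w))"
  proof -
    have "\<forall>\<^sub>F t::real in at_right 0. t \<in> {0<..<1}" by (rule eventually_at_right_real) simp
    then show ?thesis
    proof eventually_elim
      case (elim t)
      then have t: "0 < t" "t < 1" by auto
      have e: "cmod (u t - w) = t * r"
        using t by (simp add: u_def norm_mult r_def dist_norm)
      have "Re (h z) * t / 2 \<le> cmod (g (u t) - g w)"
        using low[OF t] g1 norm_triangle_ineq2[of "g (u t)" "g w"] by linarith
      then show ?case using t r by (simp add: norm_divide e field_simps)
    qed
  qed
  ultimately have "Re (h z) / (2 * r) \<le> cmod (deriv g w)"
    by (rule tendsto_lowerbound) (simp add: trivial_limit_at_right_real)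
  also have "\<dots> \<le> C * (1 + (cmod (g w))\<^sup>2)"
  proof -
    have p: "1 + (cmod (g w))\<^sup>2 > 0" by (simp add: add_pos_nonneg)
    show ?thesis using C[of w] p by (simp add: sph_deriv_def divide_le_eq)
  qed
  \<comment> \<open>Here |g w| \<le> 1 enters. This 2 and the 2 lost in Harnack's inequality make up
    the 4 in the exponent.\<close>
  also have "\<dots> \<le> C * 2"
    using g1 C[of w] sph_deriv_nonneg[of g w] by (intro mult_left_mono) (auto simp: power_le_one)
  finally have "Re (h z) \<le> 4 * C * r" using r by (simp add: field_simps)
  also have "\<dots> \<le> 4 * C * dist z w0"
    using r0 C[of w] sph_deriv_nonneg[of g w] by (intro mult_left_mono) auto
  finally show ?thesis using Reh[of z] r by simp
qed

section \<open>Exponential type: closure properties, and factorization when the zeros are finite in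
  number\<close>

definition exponential_type :: "(complex \<Rightarrow> complex) \<Rightarrow> bool" where
  "exponential_type F \<longleftrightarrow> (\<exists>A\<ge>0. \<exists>B\<ge>0. \<forall>z. cmod (F z) \<le> exp (A + B * cmod z))"

lemma exponential_type_const: "exponential_type (\<lambda>_. c)"
proof -
  have "cmod c \<le> exp (cmod c)" using exp_ge_add_one_self[of "cmod c"] by linarith
  then show ?thesis unfolding exponential_type_def by (intro exI[of _ "cmod c"] exI[of _ 0]) auto
qed

lemma exponential_type_mult:
  assumes "exponential_type F" "exponential_type G"
  shows "exponential_type (\<lambda>z. F z * G z)"
proof -
  obtain A B A' B' where *: "A \<ge> 0" "B \<ge> 0" "A' \<ge> 0" "B' \<ge> 0"
    "\<And>z. cmod (F z) \<le> exp (A + B * cmod z)" "\<And>z. cmod (G z) \<le> exp (A' + B' * cmod z)"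
    using assms unfolding exponential_type_def by metis
  have "cmod (F z * G z) \<le> exp ((A + A') + (B + B') * cmod z)" for z
  proof -
    have "cmod (F z * G z) \<le> exp (A + B * cmod z) * exp (A' + B' * cmod z)"
      unfolding norm_mult using * by (intro mult_mono) auto
    also have "\<dots> = exp ((A + A') + (B + B') * cmod z)"
      by (simp only: exp_add[symmetric]) (simp add: algebra_simps)
    finally show ?thesis .
  qed
  then show ?thesis unfolding exponential_type_def using * by (meson add_nonneg_nonneg)
qed

lemma exponential_type_diff:
  assumes "exponential_type F" "exponential_type G"
  shows "exponential_type (\<lambda>z. F z - G z)"
proof -
  obtain A B A' B' where *: "A \<ge> 0" "B \<ge> 0" "A' \<ge> 0" "B' \<ge> 0"
    "\<And>z. cmod (F z) \<le> exp (A + B * cmod z)" "\<And>z. cmod (G z) \<le> exp (A' + B' * cmod z)"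
    using assms unfolding exponential_type_def by metis
  have "cmod (F z - G z) \<le> exp ((1 + A + A') + (B + B') * cmod z)" for z
  proof -
    define E where "E = exp ((A + A') + (B + B') * cmod z)"
    have "exp (A + B * cmod z) \<le> E" "exp (A' + B' * cmod z) \<le> E"
      using * by (auto simp: E_def distrib_right)
    then have "cmod (F z) + cmod (G z) \<le> E + E"
      using *(5)[of z] *(6)[of z] by linarith
    also have "\<dots> \<le> exp 1 * E"
      using exp_ge_add_one_self[of 1] by (simp add: E_def)
    also have "\<dots> = exp ((1 + A + A') + (B + B') * cmod z)"
      unfolding E_def by (simp only: exp_add[symmetric]) (simp add: algebra_simps)
    finally show ?thesis using norm_triangle_ineq4[of "F z" "G z"] by linarith
  qed
  moreover have "0 \<le> 1 + A + A'" "0 \<le> B + B'" using * by auto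
  ultimately show ?thesis unfolding exponential_type_def by blast
qed

lemma exponential_type_power: "exponential_type F \<Longrightarrow> exponential_type (\<lambda>z. F z ^ n)"
  by (induction n) (auto intro: exponential_type_const exponential_type_mult)

lemma exponential_type_prod:
  "(\<And>i. i \<in> I \<Longrightarrow> exponential_type (F i)) \<Longrightarrow> exponential_type (\<lambda>z. \<Prod>i\<in>I. F i z)"
  by (induction I rule: infinite_finite_induct) (auto intro: exponential_type_const exponential_type_mult)

text \<open>Cauchy's estimate on the unit disc about z costs a factor e^B. The further factor e only
  provides the open ball that the estimate asks for.\<close>

lemma exponential_type_deriv:
  assumes hol: "F holomorphic_on UNIV" and "exponential_type F"
  shows "exponential_type (deriv F)"
proof -
  obtain A B where *: "A \<ge> 0" "B \<ge> 0" "\<And>z. cmod (F z) \<le> exp (A + B * cmod z)"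
    using assms(2) unfolding exponential_type_def by metis
  have "cmod (deriv F z) \<le> exp ((A + B + 1) + B * cmod z)" for z
  proof -
    define E where "E = exp (A + B + B * cmod z)"
    have "cmod ((deriv ^^ 1) F z) \<le> fact 1 * (E * exp 1) / 1 ^ 1"
    proof (rule Cauchy_higher_deriv_bound[where y = 0])
      fix w assume "w \<in> ball z 1"
      then have "cmod w \<le> 1 + cmod z"
        using norm_triangle_ineq2[of w z] by (simp add: dist_norm norm_minus_commute)
      then have "B * cmod w \<le> B * (1 + cmod z)" using * by (intro mult_left_mono)
      then have "exp (A + B * cmod w) \<le> E" by (simp add: E_def algebra_simps)
      then have "cmod (F w) \<le> E" using *(3)[of w] by linarith
      also have "\<dots> < E * exp 1" by (simp add: E_def)
      finally show "F w \<in> ball 0 (E * exp 1)" by simp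
    next
      show "F holomorphic_on ball z 1" "continuous_on (cball z 1) F"
        using holomorphic_on_subset[OF hol] by (auto intro: holomorphic_on_imp_continuous_on)
    qed auto
    also have "\<dots> = exp ((A + B + 1) + B * cmod z)"
      unfolding E_def by (simp only: exp_add[symmetric]) (simp add: algebra_simps)
    finally show ?thesis by simp
  qed
  then show ?thesis unfolding exponential_type_def
    using * by (intro exI[of _ "A + B + 1"] exI[of _ B]) auto
qed

lemma exponential_type_higher_deriv:
  assumes hol: "F holomorphic_on UNIV" and "exponential_type F"
  shows "exponential_type ((deriv ^^ n) F)"
proof (induction n)
  case (Suc n)
  then show ?case
    using exponential_type_deriv[OF holomorphic_higher_deriv[OF hol open_UNIV]] by simp
qed (use assms in simp)

text \<open>A logarithm exists and its real part grows at most linearly; the half-plane Schwarz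
  lemma on the disc of radius 2|z| transfers this to the modulus, and Liouville leaves a polynomial
  of degree at most 1.\<close>

lemma zero_free_exponential_type:
  assumes hol: "F holomorphic_on UNIV" and nz: "\<And>z. F z \<noteq> 0" and "exponential_type F"
  obtains b c where "\<And>z. F z = exp (b + c * z)"
proof -
  obtain A B where *: "A \<ge> 0" "B \<ge> 0" "\<And>z. cmod (F z) \<le> exp (A + B * cmod z)"
    using assms(3) unfolding exponential_type_def by metis
  obtain h where h: "h holomorphic_on UNIV" "\<And>z. exp (h z) = F z"
    using holomorphic_logarithm_exists[of UNIV F 0] hol nz by auto
  define u where "u = (\<lambda>z. h z - h 0)"
  have holu: "u holomorphic_on UNIV" unfolding u_def by (intro holomorphic_intros h)
  have Re_h: "Re (h z) \<le> A + B * cmod z" for z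
    using *(3)[of z] by (simp flip: h(2) add: norm_exp_eq_Re)
  define K where "K = 2 * (A + 2 * B + \<bar>Re (h 0)\<bar> + 1)"
  have bound: "cmod (u z) \<le> K * cmod z ^ 1" if z: "1 \<le> cmod z" for z
  proof -
    \<comment> \<open>A bound for the real part of \<open>u\<close> on the doubled disc, with 1 to
      spare for strict positivity. Since \<open>u 0 = 0\<close> and the radius ratio is 1/2, the
      Schwarz lemma yields |u| \<le> (2M + |u|)/2.\<close>
    define M where "M = A + B * (2 * cmod z) + \<bar>Re (h 0)\<bar> + 1"
    have "(\<lambda>y. of_real M - u y) holomorphic_on ball 0 (2 * cmod z)"
      by (intro holomorphic_intros holomorphic_on_subset[OF holu]) auto
    moreover have "Re (of_real M - u y) > 0" if "y \<in> ball 0 (2 * cmod z)" for y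
    proof -
      have "B * cmod y \<le> B * (2 * cmod z)" using that * by (intro mult_left_mono) auto
      then show ?thesis using Re_h[of y] by (simp add: u_def M_def)
    qed
    moreover have "z \<in> ball 0 (2 * cmod z)" using z by auto
    ultimately have "cmod ((of_real M - u z) - (of_real M - u 0)) \<le> dist z 0 / (2 * cmod z) * cmod ((of_real M - u z) + cnj (of_real M - u 0))"
      by (rule Schwarz_half_plane)
    moreover have "z \<noteq> 0" using z by (metis norm_zero not_one_le_zero)
    then have "dist z 0 / (2 * cmod z) = 1 / 2" by simp
    moreover have "(of_real M - u z) + cnj (of_real M - u 0) = of_real (2 * M) - u z"
      "(of_real M - u z) - (of_real M - u 0) = - u z" by (simp_all add: u_def)
    ultimately have "cmod (u z) \<le> 1 / 2 * cmod (of_real (2 * M) - u z)"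
      by (simp only: norm_minus_cancel)
    moreover have M: "M \<ge> 0" using * by (simp add: M_def)
    moreover have "cmod (of_real (2 * M) - u z) \<le> 2 * M + cmod (u z)"
      using norm_triangle_ineq4[of "of_real (2 * M)" "u z"] M by simp
    ultimately have "cmod (u z) \<le> 2 * M" by linarith
    also have "\<dots> \<le> K * cmod z"
    proof -
      have "(A + \<bar>Re (h 0)\<bar> + 1) * 1 \<le> (A + \<bar>Re (h 0)\<bar> + 1) * cmod z"
        using * z by (intro mult_left_mono) auto
      then show ?thesis by (simp add: M_def K_def algebra_simps)
    qed
    finally show ?thesis by simp
  qed
  have sum: "u z = (\<Sum>k\<le>1. (deriv ^^ k) u 0 / fact k * z ^ k)" for z
    by (rule Liouville_polynomial[OF holu bound])
  have "u 0 = 0" by (simp add: u_def)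
  then have lin: "u z = deriv u 0 * z" for z
    using sum[of z] by simp
  have "h z = h 0 + deriv u 0 * z" for z
    by (simp only: lin[symmetric]) (simp add: u_def)
  then have "F z = exp (h 0 + deriv u 0 * z)" for z
    by (metis h(2))
  then show ?thesis using that by blast
qed

text \<open>The quotient by the full power of z - \<zeta> is patched at \<zeta> with the local
  factor; the two definitions agree on the overlap, so it is entire.\<close>

lemma split_off_zero:
  assumes hol: "F holomorphic_on UNIV" and z0: "F \<zeta> = 0" and nz: "F z1 \<noteq> 0"
  obtains n G where "n \<ge> 1" "G holomorphic_on UNIV" "\<And>z. F z = (z - \<zeta>) ^ n * G z" "G \<zeta> \<noteq> 0"
proof -
  have nc: "\<not> F constant_on UNIV" using z0 nz unfolding constant_on_def by (metis UNIV_I)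
  obtain g r n where g: "0 < n" "0 < r" "g holomorphic_on ball \<zeta> r"
      "\<And>w. w \<in> ball \<zeta> r \<Longrightarrow> F w = (w - \<zeta>) ^ n * g w" "\<And>w. w \<in> ball \<zeta> r \<Longrightarrow> g w \<noteq> 0"
    using holomorphic_factor_zero_nonconstant[OF hol open_UNIV connected_UNIV UNIV_I z0 nc] by metis
  define G where "G = (\<lambda>z. if z = \<zeta> then g \<zeta> else F z / (z - \<zeta>) ^ n)"
  have eq: "G w = g w" if "w \<in> ball \<zeta> r" for w
    using g(4)[OF that] by (auto simp: G_def)
  have "G holomorphic_on ball \<zeta> r"
    by (rule holomorphic_transform[OF g(3)]) (simp add: eq)
  moreover have "G holomorphic_on UNIV - {\<zeta>}"
  proof (rule holomorphic_transform)
    show "(\<lambda>z. F z / (z - \<zeta>) ^ n) holomorphic_on UNIV - {\<zeta>}"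
      by (intro holomorphic_intros holomorphic_on_subset[OF hol]) auto
  qed (auto simp: G_def)
  ultimately have "G holomorphic_on ball \<zeta> r \<union> (UNIV - {\<zeta>})"
    by (intro holomorphic_on_Un) auto
  moreover have "ball \<zeta> r \<union> (UNIV - {\<zeta>}) = UNIV" using g(2) by auto
  ultimately have "G holomorphic_on UNIV" by simp
  moreover have "F z = (z - \<zeta>) ^ n * G z" for z
    using z0 g(1) by (auto simp: G_def)
  moreover have "G \<zeta> \<noteq> 0" using g(2,5) by (auto simp: G_def)
  ultimately show ?thesis using that g(1) by (metis Suc_leI One_nat_def)
qed

text \<open>Outside the unit disc about \<zeta> the division only decreases the modulus; inside,
  compactness gives a bound K, absorbed by K \<le> e^K.\<close>

lemma exponential_type_quotient:
  assumes G: "G holomorphic_on UNIV" and F: "exponential_type (\<lambda>z. (z - \<zeta>) ^ n * G z)"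
  shows "exponential_type G"
proof -
  obtain A B where *: "A \<ge> 0" "B \<ge> 0" "\<And>z. cmod ((z - \<zeta>) ^ n * G z) \<le> exp (A + B * cmod z)"
    using F unfolding exponential_type_def by metis
  have "compact (G ` cball \<zeta> 1)"
    using G by (intro compact_continuous_image holomorphic_on_imp_continuous_on) (auto intro: holomorphic_on_subset)
  then obtain K where K: "K > 0" "\<And>z. z \<in> cball \<zeta> 1 \<Longrightarrow> cmod (G z) \<le> K"
    by (metis (no_types, lifting) bounded_pos compact_imp_bounded imageI)
  have "cmod (G z) \<le> exp ((A + K) + B * cmod z)" for z
  proof (cases "z \<in> cball \<zeta> 1")
    case True
    have "K \<le> exp K" using exp_ge_add_one_self[of K] by linarith
    also have "\<dots> \<le> exp ((A + K) + B * cmod z)" using * by simp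
    finally show ?thesis using K(2)[OF True] by linarith
  next
    case False
    then have "1 * cmod (G z) \<le> cmod (z - \<zeta>) ^ n * cmod (G z)"
      by (intro mult_right_mono one_le_power) (auto simp: dist_norm norm_minus_commute)
    also have "\<dots> \<le> exp (A + B * cmod z)" using *(3)[of z] by (simp add: norm_mult norm_power)
    also have "\<dots> \<le> exp ((A + K) + B * cmod z)" using K by simp
    finally show ?thesis by simp
  qed
  then show ?thesis unfolding exponential_type_def
    using * K by (intro exI[of _ "A + K"] exI[of _ B]) auto
qed

text \<open>The elementary case of Hadamard's factorization: each distinct zero is divided out with
  its full multiplicity, until the zero-free case remains.\<close>

lemma finite_zeros_exponential_type:
  assumes "F holomorphic_on UNIV" "exponential_type F" "finite {z. F z = 0}" "F z1 \<noteq> 0"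
  shows "\<exists>P c. P \<noteq> 0 \<and> (\<forall>z. F z = poly P z * exp (c * z))"
  using assms
proof (induction "card {z. F z = 0}" arbitrary: F rule: less_induct)
  case less
  show ?case
  proof (cases "\<exists>\<zeta>. F \<zeta> = 0")
    case False
    then obtain b c where "\<And>z. F z = exp (b + c * z)"
      using zero_free_exponential_type less.prems by metis
    then show ?thesis by (intro exI[of _ "[:exp b:]"] exI[of _ c]) (auto simp: exp_add)
  next
    case True
    then obtain \<zeta> where \<zeta>: "F \<zeta> = 0" by blast
    obtain n G where G: "n \<ge> 1" "G holomorphic_on UNIV" "\<And>z. F z = (z - \<zeta>) ^ n * G z" "G \<zeta> \<noteq> 0"
      using split_off_zero[OF less.prems(1) \<zeta> less.prems(4)] by metis
    have sub: "{z. G z = 0} \<subset> {z. F z = 0}" using G(3,4) \<zeta> by auto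
    have "F = (\<lambda>z. (z - \<zeta>) ^ n * G z)" using G(3) by (rule ext)
    then have "exponential_type G"
      using exponential_type_quotient[OF G(2), of \<zeta> n] less.prems(2) by simp
    moreover have "card {z. G z = 0} < card {z. F z = 0}" using sub less.prems(3) psubset_card_mono by blast
    moreover have "finite {z. G z = 0}" using sub less.prems(3) finite_subset by blast
    moreover have "G z1 \<noteq> 0" using less.prems(4) G(3) by auto
    ultimately obtain P c where P: "P \<noteq> 0" "\<And>z. G z = poly P z * exp (c * z)"
      using less.hyps G(2) by blast
    show ?thesis
      using P by (intro exI[of _ "[:-\<zeta>, 1:] ^ n * P"] exI[of _ c]) (auto simp: G(3))
  qed
qed

section \<open>Values of differential monomials of entire functions\<close>

definition exp_pderiv :: "complex \<Rightarrow> complex poly \<Rightarrow> complex poly" where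
  "exp_pderiv b Q = pderiv Q + smult b Q"

lemma DERIV_poly_exp:
  "((\<lambda>z. poly Q z * exp (b * z)) has_field_derivative poly (exp_pderiv b Q) z * exp (b * z)) (at z)"
  unfolding exp_pderiv_def by (auto intro!: derivative_eq_intros simp: algebra_simps)

text \<open>For b nonzero the term bQ keeps the degree of Q while Q' lowers it, so the two cannot
  cancel.\<close>

lemma exp_pderiv_eq_0: "exp_pderiv b Q = 0 \<Longrightarrow> b \<noteq> 0 \<Longrightarrow> Q = 0"
proof (rule ccontr)
  assume *: "exp_pderiv b Q = 0" "b \<noteq> 0" "Q \<noteq> 0"
  then have "smult b Q = - pderiv Q"
    by (metis exp_pderiv_def add.commute eq_neg_iff_add_eq_0)
  then have "degree Q = degree Q - 1"
    using *(2) by (metis degree_minus degree_pderiv degree_smult_eq)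
  then have "degree Q = 0" by simp
  then have "pderiv Q = 0" by (simp add: pderiv_eq_0_iff)
  then show False using * by (simp add: exp_pderiv_def)
qed

lemma higher_deriv_poly_exp:
  assumes "\<And>z. g z = poly Q z * exp (b * z)"
  shows "(deriv ^^ j) g z = poly ((exp_pderiv b ^^ j) Q) z * exp (b * z)"
proof (induction j arbitrary: z)
  case (Suc j)
  have "(deriv ^^ j) g = (\<lambda>z. poly ((exp_pderiv b ^^ j) Q) z * exp (b * z))"
    using Suc.IH by (rule ext)
  then have "(deriv ^^ Suc j) g z = deriv (\<lambda>z. poly ((exp_pderiv b ^^ j) Q) z * exp (b * z)) z"
    by simp
  also have "\<dots> = poly ((exp_pderiv b ^^ Suc j) Q) z * exp (b * z)"
    using DERIV_imp_deriv[OF DERIV_poly_exp] by simp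
  finally show ?case .
qed (use assms in simp)

text \<open>Differentiating lowers the degree of the right side and preserves the shape of the left;
  injectivity of \<open>exp_pderiv c\<close> carries the vanishing back to S.\<close>

lemma poly_mult_exp_eq_poly:
  fixes S T :: "complex poly"
  assumes "\<And>z. poly S z * exp (c * z) = poly T z" "c \<noteq> 0"
  shows "S = 0"
  using assms(1)
proof (induction "degree T" arbitrary: S T rule: less_induct)
  case less
  have eq: "poly (exp_pderiv c S) z * exp (c * z) = poly (pderiv T) z" for z
  proof -
    have "((\<lambda>z. poly T z) has_field_derivative poly (exp_pderiv c S) z * exp (c * z)) (at z)"
      using DERIV_poly_exp[of S c z] less.prems by simp
    then show ?thesis using poly_DERIV[of T z] DERIV_unique by blast
  qed
  have "exp_pderiv c S = 0"
  proof (cases "degree T = 0")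
    case True
    then have "pderiv T = 0" by (simp add: pderiv_eq_0_iff)
    then have "\<forall>z. poly (exp_pderiv c S) z = 0" using eq by simp
    then show ?thesis by (simp add: poly_all_0_iff_0)
  next
    case False
    then show ?thesis using less.hyps[OF _ eq] by (simp add: degree_pderiv)
  qed
  then show ?case using assms(2) exp_pderiv_eq_0 by blast
qed

text \<open>Independence of exponentials with distinct rates. When two of the rates 0, \<beta>, c
  coincide, the identity reduces to two terms; when all differ, differentiation removes the constant
  a and leaves two terms.\<close>

lemma poly_exp_eq_const_plus_poly_exp:
  fixes P R :: "complex poly"
  assumes eq: "\<And>z. poly R z * exp (\<beta> * z) = a + poly P z * exp (c * z)"
    and a: "a \<noteq> 0" and R: "R \<noteq> 0" and P: "P \<noteq> 0"
  shows "\<beta> = 0 \<and> c = 0"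
proof (cases "c = 0")
  case True
  then have "poly R z * exp (\<beta> * z) = poly ([:a:] + P) z" for z using eq by simp
  then show ?thesis using True R poly_mult_exp_eq_poly by blast
next
  case c: False
  show ?thesis
  proof (cases "\<beta> = 0")
    case True
    then have "poly P z * exp (c * z) = poly ([:-a:] + R) z" for z using eq[of z] by simp
    then show ?thesis using c P poly_mult_exp_eq_poly by blast
  next
    case b: False
    show ?thesis
    proof (cases "\<beta> = c")
      case True
      then have "poly (R - P) z * exp (c * z) = poly [:a:] z" for z
        using eq[of z] by (simp add: left_diff_distrib)
      moreover from this have "R - P = 0" using c poly_mult_exp_eq_poly by blast
      ultimately show ?thesis using a by simp
    next
      case False
      have "poly (exp_pderiv \<beta> R) z * exp (\<beta> * z) = poly (exp_pderiv c P) z * exp (c * z)" for z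
      proof -
        have "((\<lambda>z. a + poly P z * exp (c * z)) has_field_derivative 0 + poly (exp_pderiv c P) z * exp (c * z)) (at z)"
          by (rule DERIV_add[OF DERIV_const DERIV_poly_exp])
        moreover have "((\<lambda>z. a + poly P z * exp (c * z)) has_field_derivative poly (exp_pderiv \<beta> R) z * exp (\<beta> * z)) (at z)"
          using DERIV_poly_exp[of R \<beta> z] by (simp add: eq)
        ultimately show ?thesis using DERIV_unique by fastforce
      qed
      then have "poly (exp_pderiv \<beta> R) z * exp (\<beta> * z) / exp (c * z) = poly (exp_pderiv c P) z" for z
        by simp
      then have "poly (exp_pderiv \<beta> R) z * exp ((\<beta> - c) * z) = poly (exp_pderiv c P) z" for z
        by (simp add: left_diff_distrib exp_diff)
      then have "exp_pderiv \<beta> R = 0" using False poly_mult_exp_eq_poly by (metis right_minus_eq)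
      then show ?thesis using b R exp_pderiv_eq_0 by blast
    qed
  qed
qed

lemma zero_free_poly_degree:
  fixes p :: "complex poly"
  assumes "\<And>z. poly p z \<noteq> 0"
  shows "degree p = 0"
proof (rule ccontr)
  assume d: "degree p \<noteq> 0"
  then have "coeff p (degree p) \<noteq> 0" by auto
  then have "\<exists>i\<in>{1..degree p}. coeff p i \<noteq> 0" using d by (intro bexI[of _ "degree p"]) auto
  then obtain z where "(\<Sum>i\<le>degree p. coeff p i * z ^ i) = 0"
    using fundamental_theorem_of_algebra[of "coeff p" "degree p"] by blast
  then show False using assms by (simp add: poly_altdef)
qed

text \<open>Such a P is a constant times (z - z0)^N, and for N > 0 its derivative can vanish nowhere
  except at its root.\<close>

lemma poly_single_root_pderiv:
  fixes P :: "complex poly"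
  assumes roots: "\<And>z. poly P z = 0 \<Longrightarrow> z = z0" and w: "poly P w \<noteq> 0" "poly (pderiv P) w = 0"
  shows "degree P = 0"
proof -
  have "P \<noteq> 0" using w by auto
  then obtain q where q: "P = [:-z0, 1:] ^ order z0 P * q" "\<not> [:-z0, 1:] dvd q"
    using order_decomp by blast
  define N where "N = order z0 P"
  have nz: "poly q z \<noteq> 0" for z
  proof
    assume z: "poly q z = 0"
    then have "poly P z = 0" by (subst q(1)) simp
    then have "z = z0" using roots by blast
    then show False using z q(2) by (simp add: poly_eq_0_iff_dvd)
  qed
  then obtain e where e: "q = [:e:]"
    using zero_free_poly_degree degree_eq_zeroE by blast
  then have "e \<noteq> 0" using nz by auto
  have P: "P = smult e ([:-z0, 1:] ^ N)" using q(1) e by (simp add: N_def)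
  have "N = 0"
  proof (rule ccontr)
    assume N: "N \<noteq> 0"
    have "poly (pderiv P) w = e * (of_nat N * (w - z0) ^ (N - 1))"
      unfolding P by (simp add: pderiv_smult pderiv_power pderiv_pCons)
    then have "(w - z0) ^ (N - 1) = 0" using w(2) \<open>e \<noteq> 0\<close> N by simp
    then have "w = z0" by simp
    then show False using w(1) N unfolding P by simp
  qed
  then show ?thesis using P by simp
qed

section \<open>Differential monomials: zeros and explicit form\<close>

lemma holomorphic_on_diff_monomial:
  assumes "f holomorphic_on S" "open S"
  shows "diff_monomial n k m f holomorphic_on S"
proof -
  have "(\<lambda>z. f z ^ n * (\<Prod>j=1..k. ((deriv ^^ j) f z) ^ m j)) holomorphic_on S"
    using assms by (intro holomorphic_intros)
  then show ?thesis by (simp add: diff_monomial_def[abs_def])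
qed

text \<open>If n \<ge> 2, the factor g^n already has a multiple zero; if n = 1, then k \<ge> 2 makes
  the zero of g itself multiple.\<close>

lemma diff_monomial_double_zero:
  assumes hol: "g holomorphic_on UNIV" and zeros: "\<And>j. j < k \<Longrightarrow> (deriv ^^ j) g w = 0"
    and n: "n \<ge> 1" and k: "k \<ge> 1" and nk: "n * k \<ge> 2"
  shows "diff_monomial n k m g w = 0" "(diff_monomial n k m g has_field_derivative 0) (at w)"
proof -
  have gw: "g w = 0" using zeros[of 0] k by simp
  then show "diff_monomial n k m g w = 0" using n by (simp add: diff_monomial_def)
  define T where "T = (\<lambda>z. \<Prod>j=1..k. ((deriv ^^ j) g z) ^ m j)"
  have "T holomorphic_on UNIV" unfolding T_def using hol by (intro holomorphic_intros) auto
  then have T: "(T has_field_derivative deriv T w) (at w)" by (rule holomorphic_derivI) auto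
  have g: "(g has_field_derivative deriv g w) (at w)" using hol by (rule holomorphic_derivI) auto
  have "((\<lambda>z. g z ^ n * T z) has_field_derivative
      of_nat n * (deriv g w * g w ^ (n - Suc 0)) * T w + deriv T w * g w ^ n) (at w)"
    by (rule DERIV_mult[OF DERIV_power[OF g] T])
  moreover have "of_nat n * (deriv g w * g w ^ (n - Suc 0)) * T w + deriv T w * g w ^ n = 0"
  proof (cases "n = 1")
    case True
    then have "deriv g w = 0" using zeros[of 1] nk by simp
    then show ?thesis using gw n by simp
  next
    case False
    then show ?thesis using gw n by (simp add: power_0_left)
  qed
  ultimately show "(diff_monomial n k m g has_field_derivative 0) (at w)"
    by (simp add: diff_monomial_def[abs_def] T_def)
qed

lemma diff_monomial_poly_exp:
  assumes g: "\<And>z. g z = poly Q z * exp (b * z)"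
  shows "diff_monomial n k m g z =
    poly (Q ^ n * (\<Prod>j=1..k. ((exp_pderiv b ^^ j) Q) ^ m j)) z * exp (of_nat (n + (\<Sum>j=1..k. m j)) * b * z)"
proof -
  have "diff_monomial n k m g z = (poly Q z * exp (b * z)) ^ n *
     (\<Prod>j=1..k. (poly ((exp_pderiv b ^^ j) Q) z * exp (b * z)) ^ m j)"
    by (simp only: diff_monomial_def higher_deriv_poly_exp[OF g] g)
  also have "\<dots> = poly Q z ^ n * (\<Prod>j=1..k. poly ((exp_pderiv b ^^ j) Q) z ^ m j) *
     (exp (b * z) ^ n * (\<Prod>j=1..k. exp (b * z) ^ m j))"
    by (simp add: power_mult_distrib prod.distrib)
  also have "exp (b * z) ^ n * (\<Prod>j=1..k. exp (b * z) ^ m j) = exp (b * z) ^ (n + (\<Sum>j=1..k. m j))"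
    by (simp add: power_add power_sum)
  also have "\<dots> = exp (of_nat (n + (\<Sum>j=1..k. m j)) * b * z)"
    by (simp only: exp_of_nat_mult mult.assoc)
  finally show ?thesis by (simp add: poly_prod)
qed

text \<open>The growth estimate needs a base point with |g| \<le> 1; without one, 1/g would be
  bounded and g constant by Liouville.\<close>

lemma exponential_type_of_bounded_sph_deriv:
  assumes hol: "g holomorphic_on UNIV" and C: "\<And>z. sph_deriv g z \<le> C" and nc: "\<not> g constant_on UNIV"
  shows "exponential_type g"
proof -
  have "\<exists>w0. cmod (g w0) \<le> 1"
  proof (rule ccontr)
    assume "\<nexists>w0. cmod (g w0) \<le> 1"
    then have big: "cmod (g w) > 1" for w using not_le by blast
    then have nz: "g w \<noteq> 0" for w by (metis norm_zero not_one_less_zero)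
    have "(\<lambda>w. inverse (g w)) holomorphic_on UNIV" using hol nz by (intro holomorphic_intros) auto
    moreover have "bounded (range (\<lambda>w. inverse (g w)))"
      unfolding bounded_iff
    proof (intro exI[of _ 1] ballI)
      fix x assume "x \<in> range (\<lambda>w. inverse (g w))"
      then obtain w where "x = inverse (g w)" by blast
      then show "cmod x \<le> 1" using big[of w] by (simp add: norm_inverse inverse_le_1_iff)
    qed
    ultimately have "(\<lambda>w. inverse (g w)) constant_on UNIV" by (rule Liouville_theorem)
    then have "g constant_on UNIV" unfolding constant_on_def by (metis inverse_inverse_eq)
    then show False using nc by simp
  qed
  then obtain w0 where w0: "cmod (g w0) \<le> 1" by blast
  have C0: "C \<ge> 0" using C[of 0] sph_deriv_nonneg[of g 0] by linarith
  have "cmod (g z) \<le> exp (4 * C * cmod w0 + 4 * C * cmod z)" for z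
  proof -
    have "dist z w0 \<le> cmod w0 + cmod z" using norm_triangle_ineq4[of z w0] by (simp add: dist_norm)
    then have "4 * C * dist z w0 \<le> 4 * C * (cmod w0 + cmod z)" using C0 by (intro mult_left_mono) auto
    then have "exp (4 * C * dist z w0) \<le> exp (4 * C * cmod w0 + 4 * C * cmod z)" by (simp add: algebra_simps)
    then show ?thesis using growth_of_bounded_sph_deriv[OF hol C w0, of z] by linarith
  qed
  moreover have "0 \<le> 4 * C * cmod w0" "0 \<le> 4 * C" using C0 by auto
  ultimately show ?thesis unfolding exponential_type_def by blast
qed

text \<open>A nontrivial entire function has countably many zeros, so finitely many such functions
  cannot cover the plane with theirs.\<close>

lemma entire_product_eq_0:
  assumes "finite I" and hol: "\<And>i. i \<in> I \<Longrightarrow> F i holomorphic_on UNIV"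
    and 0: "\<And>z. \<exists>i\<in>I. F i z = 0"
  shows "\<exists>i\<in>I. \<forall>z. F i z = (0::complex)"
proof (rule ccontr)
  assume *: "\<not> ?thesis"
  have "countable {z. F i z = 0}" if i: "i \<in> I" for i
  proof (cases "F i constant_on UNIV")
    case True
    then obtain c where c: "\<And>z. F i z = c" unfolding constant_on_def by blast
    then have "c \<noteq> 0" using * i by auto
    then show ?thesis using c by simp
  next
    case False
    then show ?thesis using holomorphic_countable_zeros[OF hol[OF i] open_UNIV connected_UNIV] by simp
  qed
  then have "countable (\<Union>i\<in>I. {z. F i z = 0})" by (intro countable_UN countable_finite[OF \<open>finite I\<close>])
  moreover have "(\<Union>i\<in>I. {z. F i z = 0}) = UNIV" using 0 by auto
  ultimately show False using uncountable_UNIV_complex by simp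
qed

section \<open>Nonconstant entire functions of exponential type with zeros of order at least
  k\<close>

context
  fixes g :: "complex \<Rightarrow> complex" and n k :: nat and m :: "nat \<Rightarrow> nat"
  assumes hol: "g holomorphic_on UNIV" and et: "exponential_type g" and nc: "\<not> g constant_on UNIV"
    and zeros: "\<And>z j. g z = 0 \<Longrightarrow> j < k \<Longrightarrow> (deriv ^^ j) g z = 0"
    and n: "n \<ge> 1" and k: "k \<ge> 1" and nk: "n * k \<ge> 2"
begin

lemma finite_zeros_poly_exp:
  assumes "finite {z. g z = 0}"
  obtains Q b where "Q \<noteq> 0" "\<And>z. g z = poly Q z * exp (b * z)"
proof -
  obtain z1 where "g z1 \<noteq> 0" using nc unfolding constant_on_def by metis
  then show ?thesis using finite_zeros_exponential_type[OF hol et assms] that by metis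
qed

lemma poly_exp_rate_nonzero:
  assumes Q: "\<And>z. g z = poly Q z * exp (b * z)" and nz: "\<And>z. g z \<noteq> 0"
  shows "b \<noteq> 0"
proof
  assume "b = 0"
  then have gQ: "g z = poly Q z" for z using Q by simp
  then have "degree Q = 0" using nz by (intro zero_free_poly_degree) metis
  then obtain e where "Q = [:e:]" by (rule degree_eq_zeroE)
  then show False using nc gQ unfolding constant_on_def by auto
qed

text \<open>Otherwise all derivatives from the j-th on vanish. At a zero of g the lower ones vanish
  as well, so g would be identically 0; without zeros g is Q e^(bz) with b nonzero, and
  \<open>exp_pderiv b\<close> never reaches 0.\<close>

lemma higher_deriv_not_identically_0: "\<exists>z. (deriv ^^ j) g z \<noteq> 0" if j: "j \<le> k"
proof (rule ccontr)
  assume "\<nexists>z. (deriv ^^ j) g z \<noteq> 0"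
  then have 0: "(deriv ^^ j) g = (\<lambda>_. 0)" by auto
  have all0: "(deriv ^^ i) g = (\<lambda>_. 0)" if "i \<ge> j" for i
    using that
  proof (induction i rule: dec_induct)
    case (step i)
    then show ?case by simp
  qed (rule 0)
  show False
  proof (cases "\<exists>w. g w = 0")
    case True
    then obtain w where w: "g w = 0" by blast
    have "(deriv ^^ i) g w = 0" for i
      using zeros[OF w, of i] all0[of i] j by (cases "i < k") auto
    then have "g z = 0" for z
      using holomorphic_fun_eq_0_on_connected[OF hol open_UNIV connected_UNIV] by blast
    then show False using nc unfolding constant_on_def by blast
  next
    case False
    then have "{z. g z = 0} = {}" by auto
    then obtain Q b where Q: "Q \<noteq> 0" "\<And>z. g z = poly Q z * exp (b * z)"
      using finite_zeros_poly_exp by (metis finite.emptyI)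
    have b: "b \<noteq> 0" using poly_exp_rate_nonzero Q(2) False by blast
    have "(exp_pderiv b ^^ i) Q \<noteq> 0" for i
      using exp_pderiv_eq_0[OF _ b] Q(1) by (induction i) auto
    moreover have "\<forall>z. poly ((exp_pderiv b ^^ j) Q) z = 0"
      using higher_deriv_poly_exp[OF Q(2)] 0 by (metis exp_not_eq_zero mult_eq_0_iff)
    ultimately show False by (simp add: poly_all_0_iff_0)
  qed
qed

lemma diff_monomial_not_identically_0: "\<exists>z. diff_monomial n k m g z \<noteq> 0"
proof (rule ccontr)
  assume *: "\<nexists>z. diff_monomial n k m g z \<noteq> 0"
  have "\<exists>j\<in>{0..k}. (deriv ^^ j) g z = 0" for z
  proof -
    have "g z ^ n * (\<Prod>j=1..k. ((deriv ^^ j) g z) ^ m j) = 0" using * by (auto simp: diff_monomial_def)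
    then show ?thesis using n by (force simp: Bex_def)
  qed
  then have "\<exists>j\<in>{0..k}. \<forall>z. (deriv ^^ j) g z = 0"
    using hol by (intro entire_product_eq_0 holomorphic_higher_deriv) auto
  then show False using higher_deriv_not_identically_0 by (metis atLeastAtMost_iff)
qed

text \<open>A constant value would be nonzero, so g would be zero-free and hence Q e^(bz) with b
  nonzero; M[g] would then carry the exponential rate (n + \<Sum>m) b, which is nonzero because n
  \<ge> 1.\<close>

lemma diff_monomial_not_constant: "\<not> diff_monomial n k m g constant_on UNIV"
proof
  assume "diff_monomial n k m g constant_on UNIV"
  then obtain c where c: "\<And>z. diff_monomial n k m g z = c" unfolding constant_on_def by blast
  have c0: "c \<noteq> 0" using c diff_monomial_not_identically_0 by auto
  have nz: "g z \<noteq> 0" for z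
  proof
    assume "g z = 0"
    then have "diff_monomial n k m g z = 0" using n by (simp add: diff_monomial_def)
    then show False using c c0 by simp
  qed
  then have "{z. g z = 0} = {}" by auto
  then obtain Q b where Q: "Q \<noteq> 0" "\<And>z. g z = poly Q z * exp (b * z)"
    using finite_zeros_poly_exp by (metis finite.emptyI)
  have b: "b \<noteq> 0" using poly_exp_rate_nonzero Q(2) nz by blast
  define N where "N = n + (\<Sum>j=1..k. m j)"
  define R where "R = Q ^ n * (\<Prod>j=1..k. ((exp_pderiv b ^^ j) Q) ^ m j)"
  have W: "poly R z * exp (of_nat N * b * z) = poly [:c:] z" for z
    using diff_monomial_poly_exp[OF Q(2), of n k m z] c by (simp add: R_def N_def)
  have "N \<noteq> 0" using n by (simp add: N_def)
  then have "of_nat N * b \<noteq> 0" using b by simp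
  then have "R = 0" using poly_mult_exp_eq_poly[OF W] by simp
  then show False using W[of 0] c0 by simp
qed

text \<open>If \<open>M[g] - a\<close> had at most one zero it would be \<open>P e\<^sup>c\<^sup>z\<close>, so \<open>M[g]'\<close> would have finitely many
  zeros. As \<open>nk \<ge> 2\<close>, every zero of \<open>g\<close> is one of them, so \<open>g\<close> and \<open>M[g]\<close> are of the same
  shape; comparing the exponentials leaves only polynomials, and \<open>a + C (z - z\<^sub>0)\<^sup>N\<close> has no
  multiple zero.\<close>

lemma diff_monomial_two_a_points:
  assumes a: "a \<noteq> 0"
  shows "\<exists>z w. z \<noteq> w \<and> diff_monomial n k m g z = a \<and> diff_monomial n k m g w = a"
proof (rule ccontr)
  assume "\<not> ?thesis"
  then obtain z0 where z0: "\<And>z. diff_monomial n k m g z = a \<Longrightarrow> z = z0" by metis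
  define W where "W = diff_monomial n k m g"
  have holW: "W holomorphic_on UNIV" unfolding W_def using hol by (intro holomorphic_on_diff_monomial) auto
  have ncW: "\<not> W constant_on UNIV" unfolding W_def by (rule diff_monomial_not_constant)
  have etW: "exponential_type W"
    unfolding W_def diff_monomial_def[abs_def]
    using et hol by (intro exponential_type_mult exponential_type_power exponential_type_prod exponential_type_higher_deriv)
  have "{z. W z - a = 0} \<subseteq> {z0}" using z0 by (auto simp: W_def)
  then have fin: "finite {z. W z - a = 0}" using finite_subset by blast
  obtain z1 where z1: "W z1 - a \<noteq> 0" using ncW unfolding constant_on_def by (metis right_minus_eq)
  have holWa: "(\<lambda>z. W z - a) holomorphic_on UNIV" using holW by (intro holomorphic_intros)
  have etWa: "exponential_type (\<lambda>z. W z - a)"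
    by (rule exponential_type_diff[OF etW exponential_type_const])
  obtain P c where P: "P \<noteq> 0" "\<And>z. W z - a = poly P z * exp (c * z)"
    using finite_zeros_exponential_type[OF holWa etWa fin z1] by blast
  have WP: "W z = a + poly P z * exp (c * z)" for z using P(2)[of z] by (simp add: algebra_simps)
  have dW: "(W has_field_derivative poly (exp_pderiv c P) z * exp (c * z)) (at z)" for z
  proof -
    have "((\<lambda>z. a + poly P z * exp (c * z)) has_field_derivative 0 + poly (exp_pderiv c P) z * exp (c * z)) (at z)"
      by (rule DERIV_add[OF DERIV_const DERIV_poly_exp])
    then show ?thesis by (simp only: WP[symmetric] add_0_left)
  qed
  have nzd: "exp_pderiv c P \<noteq> 0"
  proof
    assume "exp_pderiv c P = 0"
    then have "W constant_on UNIV"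
      using dW by (intro has_field_derivative_0_imp_constant_on) (auto simp: connected_UNIV)
    then show False using ncW by simp
  qed
  have dzero: "W w = 0 \<and> poly (exp_pderiv c P) w = 0" if "g w = 0" for w
  proof -
    have "W w = 0" "(W has_field_derivative 0) (at w)"
      unfolding W_def using diff_monomial_double_zero[OF hol zeros[OF that] n k nk, of m] by auto
    then show ?thesis using DERIV_unique[OF dW[of w], of 0] by simp
  qed
  then have "{w. g w = 0} \<subseteq> {w. poly (exp_pderiv c P) w = 0}" by auto
  then have "finite {w. g w = 0}" using poly_roots_finite[OF nzd] finite_subset by blast
  then obtain Q b where Q: "Q \<noteq> 0" "\<And>z. g z = poly Q z * exp (b * z)"
    using finite_zeros_poly_exp by metis
  define N where "N = n + (\<Sum>j=1..k. m j)"
  define R where "R = Q ^ n * (\<Prod>j=1..k. ((exp_pderiv b ^^ j) Q) ^ m j)"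
  have WR: "W z = poly R z * exp (of_nat N * b * z)" for z
    using diff_monomial_poly_exp[OF Q(2), of n k m z] by (simp add: R_def N_def W_def)
  have "R \<noteq> 0" using WR diff_monomial_not_identically_0 by (auto simp: W_def)
  moreover have "poly R z * exp (of_nat N * b * z) = a + poly P z * exp (c * z)" for z
    using WR[of z] WP[of z] by simp
  ultimately have "of_nat N * b = 0 \<and> c = 0"
    using poly_exp_eq_const_plus_poly_exp[of R "of_nat N * b" a P c] a P(1) by blast
  moreover have "N \<noteq> 0" using n by (simp add: N_def)
  ultimately have "b = 0" "c = 0" by auto
  \<comment> \<open>A zero-free g would have a nonzero rate b, so g has a zero w. There M[g] = 0
    gives P(w) = -a, and the double zero gives P'(w) = 0, while P has at most the root z0.\<close>
  then obtain w where w: "g w = 0" using poly_exp_rate_nonzero[OF Q(2)] by blast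
  have "poly P w \<noteq> 0" using dzero[OF w] WP[of w] a by auto
  moreover have "poly (pderiv P) w = 0" using dzero[OF w] \<open>c = 0\<close> by (simp add: exp_pderiv_def)
  moreover have "z = z0" if "poly P z = 0" for z using z0[of z] WP[of z] that by (simp add: W_def)
  ultimately have "degree P = 0" using poly_single_root_pderiv by blast
  then obtain e where "P = [:e:]" using degree_eq_zeroE by blast
  then show False using ncW WP \<open>c = 0\<close> unfolding constant_on_def by simp
qed

end

section \<open>Limits of rescaled sequences\<close>

text \<open>Infinite multiplicity means that f vanishes near the point, with all derivatives;
  otherwise \<open>zorder\<close> is the index of the first nonvanishing derivative.\<close>

lemma zero_multiplicity_ge_imp_zeros_order_ge:
  assumes hol: "f holomorphic_on D" and D: "open D"
    and mult: "\<And>z. z \<in> D \<Longrightarrow> f z = 0 \<Longrightarrow> zero_multiplicity f z \<ge> enat k"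
  shows "zeros_order_ge k f D"
  unfolding zeros_order_ge_def
proof (intro ballI impI allI)
  fix z j assume z: "z \<in> D" "f z = 0" and j: "j < k"
  show "(deriv ^^ j) f z = 0"
  proof (cases "eventually (\<lambda>w. f w = 0) (at z)")
    case True
    then have "\<forall>\<^sub>F w in nhds z. f w = 0"
      unfolding eventually_at_filter by (rule eventually_mono) (use z in auto)
    then have "(deriv ^^ j) f z = (deriv ^^ j) (\<lambda>_. 0) z"
      by (intro higher_deriv_cong_ev) auto
    then show ?thesis by simp
  next
    case False
    show ?thesis
    proof (rule ccontr)
      assume nz: "(deriv ^^ j) f z \<noteq> 0"
      define i where "i = (LEAST i. (deriv ^^ i) f z \<noteq> 0)"
      have i: "(deriv ^^ i) f z \<noteq> 0" "i \<le> j"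
        unfolding i_def using nz by (rule LeastI, rule Least_le)
      have "\<And>l. l < i \<Longrightarrow> (deriv ^^ l) f z = 0"
        unfolding i_def using not_less_Least by blast
      then have "zorder f z = int i"
        using i(1) by (intro zorder_zero_eqI[OF hol D z(1)]) auto
      then have "zero_multiplicity f z = enat i"
        using False by (simp add: zero_multiplicity_def)
      then show False using mult[OF z] i(2) j by simp
    qed
  qed
qed

text \<open>The sufficient direction of Marty's criterion. Holomorphic functions have no poles in D,
  so \<open>sphere_map\<close> is \<open>stereo\<close> of the value, both for the sequence and for
  a holomorphic limit.\<close>

lemma normal_family_on_of_bounded_sph_deriv:
  assumes D: "open D" "connected D" and hol: "\<And>f. f \<in> \<F> \<Longrightarrow> f holomorphic_on D"
    and bound: "\<And>z. z \<in> D \<Longrightarrow> \<exists>e>0. \<exists>M. ball z e \<subseteq> D \<and> (\<forall>f\<in>\<F>. \<forall>w\<in>ball z e. sph_deriv f w \<le> M)"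
  shows "normal_family_on D \<F>"
  unfolding normal_family_on_def
proof (intro allI impI)
  fix s :: "nat \<Rightarrow> complex \<Rightarrow> complex" assume "range s \<subseteq> \<F>"
  then have sF: "s n \<in> \<F>" for n by blast
  have "\<exists>e>0. \<exists>M. ball z e \<subseteq> D \<and>
      (\<forall>\<^sub>F n in sequentially. s n holomorphic_on ball z e \<and> (\<forall>w\<in>ball z e. sph_deriv (s n) w \<le> M))"
    if z: "z \<in> D" for z
  proof -
    obtain e M where e: "e > 0" "ball z e \<subseteq> D" "\<forall>f\<in>\<F>. \<forall>w\<in>ball z e. sph_deriv f w \<le> M"
      using bound[OF z] by blast
    then have "s n holomorphic_on ball z e \<and> (\<forall>w\<in>ball z e. sph_deriv (s n) w \<le> M)" for n
      using holomorphic_on_subset[OF hol[OF sF]] sF by blast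
    then have "\<forall>\<^sub>F n in sequentially. s n holomorphic_on ball z e \<and> (\<forall>w\<in>ball z e. sph_deriv (s n) w \<le> M)"
      by (rule always_eventually[OF allI])
    then show ?thesis using e(1,2) by blast
  qed
  from marty_limit[OF this] obtain r \<phi> where r: "strict_mono (r :: nat \<Rightarrow> nat)"
    and lim: "\<And>z. z \<in> D \<Longrightarrow> \<exists>e>0. ball z e \<subseteq> D \<and> uniform_limit (ball z e) (\<lambda>n w. stereo (s (r n) w)) \<phi> sequentially"
    by metis
  have sm: "sphere_map f w = stereo (f w)" if "f holomorphic_on D" "w \<in> D" for f w
    using not_is_pole_holomorphic[OF D(1) that(2,1)] by (simp add: sphere_map_def)
  have conv: "locally_uniform_limit_on D (\<lambda>i. sphere_map (s (r i))) \<psi>" if "\<And>w. w \<in> D \<Longrightarrow> \<psi> w = \<phi> w" for \<psi>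
    unfolding locally_uniform_limit_on_def
  proof
    fix z assume "z \<in> D"
    then obtain e where e: "e > 0" "ball z e \<subseteq> D" "uniform_limit (ball z e) (\<lambda>n w. stereo (s (r n) w)) \<phi> sequentially"
      using lim by blast
    have "uniform_limit (ball z e) (\<lambda>i. sphere_map (s (r i))) \<psi> sequentially \<longleftrightarrow>
        uniform_limit (ball z e) (\<lambda>n w. stereo (s (r n) w)) \<phi> sequentially"
      using that sm[OF hol[OF sF]] e(2) by (intro uniform_limit_cong') auto
    then show "\<exists>U. open U \<and> z \<in> U \<and> U \<subseteq> D \<and> uniform_limit U (\<lambda>i. sphere_map (s (r i))) \<psi> sequentially"
      using e by (intro exI[of _ "ball z e"]) auto
  qed
  have hol_loc: "\<exists>e>0. \<forall>\<^sub>F n in sequentially. s (r n) holomorphic_on ball z e" if zD: "z \<in> D" for z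
  proof -
    obtain e where e: "e > 0" "ball z e \<subseteq> D" using D(1) zD open_contains_ball by blast
    then have "s (r n) holomorphic_on ball z e" for n
      using holomorphic_on_subset[OF hol[OF sF]] by blast
    then show ?thesis using e(1) by (intro exI[of _ e]) auto
  qed
  from sphere_limit_dichotomy[OF D, of "\<lambda>n. s (r n)", OF hol_loc lim]
  have "(\<forall>z\<in>D. \<phi> z = sphere_infinity) \<or> (\<exists>h. h holomorphic_on D \<and> (\<forall>z\<in>D. \<phi> z = stereo (h z)))"
    by blast
  then show "\<exists>r. strict_mono (r :: nat \<Rightarrow> nat) \<and>
           ((\<exists>h. h nicely_meromorphic_on D \<and>
                 locally_uniform_limit_on D (\<lambda>i. sphere_map (s (r i))) (sphere_map h)) \<or>
            locally_uniform_limit_on D (\<lambda>i. sphere_map (s (r i))) (\<lambda>_. sphere_infinity))"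
  proof
    assume "\<forall>z\<in>D. \<phi> z = sphere_infinity"
    then show ?thesis using r conv[of "\<lambda>_. sphere_infinity"] by auto
  next
    assume "\<exists>h. h holomorphic_on D \<and> (\<forall>z\<in>D. \<phi> z = stereo (h z))"
    then obtain h where h: "h holomorphic_on D" "\<forall>z\<in>D. \<phi> z = stereo (h z)" by blast
    have "h nicely_meromorphic_on D"
      using h(1) D(1) by (intro analytic_on_imp_nicely_meromorphic_on) (simp add: analytic_on_open)
    moreover have "locally_uniform_limit_on D (\<lambda>i. sphere_map (s (r i))) (sphere_map h)"
      using h sm by (intro conv) auto
    ultimately show ?thesis using r by blast
  qed
qed

section \<open>Convergence of derivatives, monomials and zeros under locally uniform limits\<close>

lemma uniform_limit_on_compact:
  fixes f :: "nat \<Rightarrow> 'a::metric_space \<Rightarrow> 'b::metric_space"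
  assumes K: "compact K" and loc: "\<And>z. z \<in> K \<Longrightarrow> \<exists>e>0. uniform_limit (ball z e) f l sequentially"
  shows "uniform_limit K f l sequentially"
proof -
  obtain e where e: "\<And>z. z \<in> K \<Longrightarrow> e z > 0 \<and> uniform_limit (ball z (e z)) f l sequentially"
    using loc by metis
  have "K \<subseteq> (\<Union>z\<in>K. ball z (e z))" using e by force
  then obtain T where T: "T \<subseteq> K" "finite T" "K \<subseteq> (\<Union>z\<in>T. ball z (e z))"
    by (rule compactE_image[OF K, rotated]) auto
  then have "uniform_limit (\<Union>z\<in>T. ball z (e z)) f l sequentially"
    using e by (intro uniform_limit_on_UNION) auto
  then show ?thesis using T(3) uniform_limit_on_subset by blast
qed

text \<open>Cauchy's estimate on unit discs: convergence on \<open>cball 0 (R + 1)\<close> pays for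
  convergence of derivatives on \<open>cball 0 R\<close>. Holomorphy is eventual for each radius, to
  suit functions whose domains exhaust the plane.\<close>

lemma uniform_limit_deriv:
  assumes lim: "\<And>R. uniform_limit (cball 0 R) f g sequentially"
    and hol: "\<And>R. \<forall>\<^sub>F n in sequentially. f n holomorphic_on ball 0 R" and g: "g holomorphic_on UNIV"
  shows "uniform_limit (cball 0 R) (\<lambda>n. deriv (f n)) (deriv g) sequentially"
proof (rule uniform_limitI)
  fix e :: real assume e: "e > 0"
  have "\<forall>\<^sub>F n in sequentially. \<forall>z\<in>cball 0 (R + 1). dist (f n z) (g z) < e / 2"
    using e by (intro uniform_limitD[OF lim]) auto
  then show "\<forall>\<^sub>F n in sequentially. \<forall>z\<in>cball 0 R. dist (deriv (f n) z) (deriv g z) < e"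
    using hol[of "R + 2"]
  proof eventually_elim
    case (elim n)
    show ?case
    proof
      fix z :: complex assume z: "z \<in> cball 0 R"
      have sub: "cball z 1 \<subseteq> cball 0 (R + 1)" "cball z 1 \<subseteq> ball 0 (R + 2)"
      proof -
        have "cmod w \<le> R + 1" if "w \<in> cball z 1" for w
          using that z norm_triangle_ineq2[of w z] by (simp add: dist_norm norm_minus_commute)
        then show "cball z 1 \<subseteq> cball 0 (R + 1)" "cball z 1 \<subseteq> ball 0 (R + 2)" by fastforce+
      qed
      define u where "u = (\<lambda>w. f n w - g w)"
      have holu: "u holomorphic_on ball 0 (R + 2)"
        unfolding u_def using elim(2) holomorphic_on_subset[OF g] by (intro holomorphic_intros) auto
      have "cmod ((deriv ^^ 1) u z) \<le> fact 1 * (e / 2) / 1 ^ 1"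
      proof (rule Cauchy_higher_deriv_bound[where y = 0])
        show "u holomorphic_on ball z 1"
          using holomorphic_on_subset[OF holu] sub(2) ball_subset_cball by blast
        show "continuous_on (cball z 1) u"
          using holomorphic_on_subset[OF holu sub(2)] by (rule holomorphic_on_imp_continuous_on)
        fix w assume "w \<in> ball z 1"
        then have "w \<in> cball 0 (R + 1)" using sub(1) ball_subset_cball by blast
        then show "u w \<in> ball 0 (e / 2)" using elim(1) by (simp add: u_def dist_norm norm_minus_commute)
      qed auto
      moreover have "deriv u z = deriv (f n) z - deriv g z"
        unfolding u_def
      proof (rule deriv_diff)
        have "z \<in> ball 0 (R + 2)" using z by simp
        then show "f n field_differentiable at z"
          using elim(2) holomorphic_on_imp_differentiable_at open_ball by blast
        show "g field_differentiable at z" using g holomorphic_on_imp_differentiable_at by blast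
      qed
      ultimately show "dist (deriv (f n) z) (deriv g z) < e" using e by (simp add: dist_norm)
    qed
  qed
qed

lemma uniform_limit_higher_deriv:
  assumes lim: "\<And>R. uniform_limit (cball 0 R) f g sequentially"
    and hol: "\<And>R. \<forall>\<^sub>F n in sequentially. f n holomorphic_on ball 0 R" and g: "g holomorphic_on UNIV"
  shows "uniform_limit (cball 0 R) (\<lambda>n. (deriv ^^ j) (f n)) ((deriv ^^ j) g) sequentially"
proof (induction j arbitrary: R)
  case (Suc j)
  have "\<forall>\<^sub>F n in sequentially. (deriv ^^ j) (f n) holomorphic_on ball 0 R" for R
    using hol[of R] by eventually_elim (intro holomorphic_higher_deriv open_ball)
  then show ?case
    using uniform_limit_deriv[OF Suc _ holomorphic_higher_deriv[OF g open_UNIV]] by simp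
qed (use lim in simp)

lemma bounded_image_cball:
  fixes l :: "complex \<Rightarrow> complex"
  assumes "continuous_on UNIV l"
  shows "bounded (l ` cball 0 R)"
  using assms by (intro compact_imp_bounded compact_continuous_image) (auto intro: continuous_on_subset)

lemma uniform_limit_power:
  fixes l :: "complex \<Rightarrow> complex"
  assumes "uniform_limit (cball 0 R) f l F" "continuous_on UNIV l"
  shows "uniform_limit (cball 0 R) (\<lambda>n z. f n z ^ m) (\<lambda>z. l z ^ m) F"
proof (induction m)
  case (Suc m)
  then show ?case
    using assms by (auto intro!: uniform_lim_mult bounded_image_cball continuous_intros)
qed (simp add: uniform_limit_const)

lemma uniform_limit_prod:
  fixes l :: "'i \<Rightarrow> complex \<Rightarrow> complex"
  assumes "finite I" "\<And>i. i \<in> I \<Longrightarrow> uniform_limit (cball 0 R) (f i) (l i) F" "\<And>i. i \<in> I \<Longrightarrow> continuous_on UNIV (l i)"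
  shows "uniform_limit (cball 0 R) (\<lambda>n z. \<Prod>i\<in>I. f i n z) (\<lambda>z. \<Prod>i\<in>I. l i z) F"
  using assms
proof (induction I rule: finite_induct)
  case (insert i I)
  then show ?case
    by (auto intro!: uniform_lim_mult bounded_image_cball continuous_intros)
qed (simp add: uniform_limit_const)

lemma uniform_limit_diff_monomial:
  assumes lim: "\<And>R. uniform_limit (cball 0 R) f g sequentially"
    and hol: "\<And>R. \<forall>\<^sub>F n in sequentially. f n holomorphic_on ball 0 R" and g: "g holomorphic_on UNIV"
  shows "uniform_limit (cball 0 R) (\<lambda>i. diff_monomial n k m (f i)) (diff_monomial n k m g) sequentially"
proof -
  have c: "continuous_on UNIV ((deriv ^^ j) g)" for j
    using holomorphic_higher_deriv[OF g open_UNIV] holomorphic_on_imp_continuous_on by blast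
  have c0: "continuous_on UNIV g" using c[of 0] by simp
  have "uniform_limit (cball 0 R) (\<lambda>i z. f i z ^ n * (\<Prod>j=1..k. ((deriv ^^ j) (f i) z) ^ m j))
     (\<lambda>z. g z ^ n * (\<Prod>j=1..k. ((deriv ^^ j) g z) ^ m j)) sequentially"
    by (intro uniform_lim_mult uniform_limit_power uniform_limit_prod bounded_image_cball
         continuous_intros lim uniform_limit_higher_deriv[OF lim hol g] c c0) auto
  then show ?thesis by (simp add: diff_monomial_def[abs_def])
qed

lemma Hurwitz_zero:
  assumes lim: "\<And>R. uniform_limit (cball 0 R) H h sequentially"
    and hol: "\<And>R. \<forall>\<^sub>F n in sequentially. H n holomorphic_on ball 0 R" and h: "h holomorphic_on UNIV"
    and nc: "\<not> h constant_on UNIV" and z: "h z = 0" and e: "e > 0"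
  shows "\<forall>\<^sub>F n in sequentially. \<exists>w\<in>ball z e. H n w = 0"
proof (rule ccontr)
  assume "\<not> ?thesis"
  then have freq: "\<exists>n\<ge>N. \<forall>w\<in>ball z e. H n w \<noteq> 0" for N
    by (auto simp: eventually_sequentially)
  define R where "R = cmod z + e"
  have sub: "ball z e \<subseteq> ball 0 R"
  proof
    fix w assume "w \<in> ball z e"
    then show "w \<in> ball 0 R"
      using norm_triangle_ineq2[of w z] by (simp add: R_def dist_norm norm_minus_commute)
  qed
  obtain N0 where N0: "\<And>n. n \<ge> N0 \<Longrightarrow> H n holomorphic_on ball 0 R"
    using hol[of R] by (auto simp: eventually_sequentially)
  \<comment> \<open>Indices at which zeros are missing; \<open>c\<close> need not be increasing,
    tending to infinity is enough for the uniform limit to survive.\<close>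
  have "\<exists>c. \<forall>N. c N \<ge> N + N0 \<and> (\<forall>w\<in>ball z e. H (c N) w \<noteq> 0)"
    using freq by (intro choice) blast
  then obtain c where c: "\<And>N. c N \<ge> N + N0 \<and> (\<forall>w\<in>ball z e. H (c N) w \<noteq> 0)"
    by blast
  have "N \<le> c N" for N using c[of N] by linarith
  then have "filterlim c sequentially sequentially"
    by (intro filterlim_at_top_mono[OF filterlim_ident always_eventually]) auto
  then have lim': "uniform_limit (cball 0 R) (\<lambda>N. H (c N)) h sequentially"
    using filterlim_compose[OF lim] by blast
  have "h z \<noteq> 0"
  proof (rule Hurwitz_no_zeros[where \<F> = "\<lambda>N. H (c N)" and g = h and S = "ball z e"])
    show "open (ball z e)" "connected (ball z e)" by auto
    show "H (c N) holomorphic_on ball z e" for N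
      using N0[of "c N"] c[of N] sub holomorphic_on_subset by (meson add_leD2)
    show "h holomorphic_on ball z e" using h holomorphic_on_subset by blast
    show "uniform_limit K (\<lambda>N. H (c N)) h sequentially" if "K \<subseteq> ball z e" for K
      using that sub by (intro uniform_limit_on_subset[OF lim']) auto
    show "\<not> h constant_on ball z e"
    proof
      assume "h constant_on ball z e"
      moreover have "z islimpt ball z e" using e by (simp add: islimpt_ball)
      ultimately have "h constant_on UNIV"
        using analytic_continuation'[OF h open_UNIV connected_UNIV, of "ball z e" z] by simp
      then show False using nc by simp
    qed
    show "H (c N) w \<noteq> 0" if "w \<in> ball z e" for N w using c[of N] that by blast
    show "z \<in> ball z e" using e by simp
  qed
  then show False using z by simp
qed

text \<open>A locally uniform limit \<open>\<infinity>\<close> is excluded because the spherical derivative is invariant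
  under \<open>w \<mapsto> 1/w\<close> while \<open>1/G\<^sub>n \<rightarrow> 0\<close> forces it to tend to \<open>0\<close>.\<close>

lemma entire_limit_of_bounded_sph_deriv:
  assumes hol: "\<And>n. G n holomorphic_on ball 0 (real n + 1)"
    and C: "\<And>n \<zeta>. cmod \<zeta> < real n + 1 \<Longrightarrow> sph_deriv (G n) \<zeta> \<le> C"
    and low: "\<And>n. sph_deriv (G n) 0 \<ge> 1"
  obtains r g where "strict_mono (r :: nat \<Rightarrow> nat)" "g holomorphic_on UNIV" "\<not> g constant_on UNIV"
    "\<And>z. sph_deriv g z \<le> C" "\<And>R. uniform_limit (cball 0 R) (\<lambda>n. G (r n)) g sequentially"
proof -
  have loc: "\<forall>\<^sub>F n in sequentially. ball z 1 \<subseteq> ball 0 (real n + 1)" for z :: complex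
  proof -
    obtain N :: nat where N: "cmod z \<le> real N" using real_arch_simple by blast
    have "ball z 1 \<subseteq> ball 0 (real n + 1)" if "n \<ge> N" for n
    proof
      fix w assume "w \<in> ball z 1"
      moreover have "real N \<le> real n" using that by simp
      ultimately show "w \<in> ball 0 (real n + 1)"
        using N norm_triangle_ineq2[of w z] by (simp add: dist_norm norm_minus_commute)
    qed
    then show ?thesis by (auto simp: eventually_sequentially)
  qed
  have ev: "\<forall>\<^sub>F n in sequentially. G n holomorphic_on ball z 1 \<and> (\<forall>w\<in>ball z 1. sph_deriv (G n) w \<le> C)" for z
    using loc[of z]
  proof eventually_elim
    case (elim n)
    have "G n holomorphic_on ball z 1" using holomorphic_on_subset[OF hol elim] .
    moreover have "sph_deriv (G n) w \<le> C" if "w \<in> ball z 1" for w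
    proof (rule C)
      have "w \<in> ball 0 (real n + 1)" using elim that by blast
      then show "cmod w < real n + 1" by simp
    qed
    ultimately show ?case by blast
  qed
  have "\<exists>e>0. \<exists>M. ball z e \<subseteq> UNIV \<and>
      (\<forall>\<^sub>F n in sequentially. G n holomorphic_on ball z e \<and> (\<forall>w\<in>ball z e. sph_deriv (G n) w \<le> M))" for z
    using ev[of z] zero_less_one[where 'a = real] by blast
  from marty_limit[of UNIV G, OF this] obtain r \<phi> where r: "strict_mono (r :: nat \<Rightarrow> nat)"
    and lim: "\<And>z. \<exists>e>0. ball z e \<subseteq> UNIV \<and> uniform_limit (ball z e) (\<lambda>n w. stereo (G (r n) w)) \<phi> sequentially"
    by (metis UNIV_I)
  have rn: "real n \<le> real (r n)" for n using seq_suble[OF r, of n] by simp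
  have hol_r: "G (r n) holomorphic_on ball 0 (real n + 1)" for n
    using rn[of n] by (intro holomorphic_on_subset[OF hol] subset_ball) auto
  have hol_ev: "\<forall>\<^sub>F n in sequentially. G (r n) holomorphic_on ball 0 R" for R
  proof -
    obtain N :: nat where N: "R \<le> real N" using real_arch_simple by blast
    have "G (r n) holomorphic_on ball 0 R" if "n \<ge> N" for n
    proof (rule holomorphic_on_subset[OF hol_r subset_ball])
      have "real N \<le> real n" using that by simp
      then show "R \<le> real n + 1" using N by linarith
    qed
    then show ?thesis by (auto simp: eventually_sequentially)
  qed
  have hol_loc: "\<exists>e>0. \<forall>\<^sub>F n in sequentially. G (r n) holomorphic_on ball z e" for z
  proof (intro exI[of _ 1] conjI)
    show "\<forall>\<^sub>F n in sequentially. G (r n) holomorphic_on ball z 1"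
      using loc[of z] by eventually_elim (rule holomorphic_on_subset[OF hol_r])
  qed auto
  have low_r: "1 \<le> sph_deriv (G (r n)) 0" for n using low .
  have not_inf: "\<phi> w \<noteq> sphere_infinity" if inf: "\<And>w. \<phi> w = sphere_infinity" for w
  proof -
    obtain e1 where e1: "e1 > 0" "uniform_limit (ball 0 e1) (\<lambda>n w. stereo (G (r n) w)) \<phi> sequentially"
      using lim[of 0] by blast
    define e where "e = min e1 1"
    have e: "e > 0" "ball 0 e \<subseteq> ball 0 e1" using e1 by (auto simp: e_def)
    define k where "k = (\<lambda>n w. inverse (G (r n) w))"
    have big: "\<forall>\<^sub>F n in sequentially. \<forall>w\<in>ball 0 e. G (r n) w \<noteq> 0 \<and> cmod (k n w) < \<epsilon>" if eps: "\<epsilon> > 0" for \<epsilon>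
    proof -
      \<comment> \<open>The cap at 1 makes \<open>1 / \<delta>\<close> at least 1, so the summand 1
        under the root can be absorbed.\<close>
      define \<delta> where "\<delta> = min \<epsilon> 1"
      have d: "\<delta> > 0" "\<delta> \<le> 1" "\<delta> \<le> \<epsilon>" using eps by (auto simp: \<delta>_def)
      have "\<forall>\<^sub>F n in sequentially. \<forall>w\<in>ball 0 e1. dist (stereo (G (r n) w)) (\<phi> w) < \<delta>"
        by (rule uniform_limitD[OF e1(2) d(1)])
      then show ?thesis
      proof eventually_elim
        case (elim n)
        show ?case
        proof
          fix w :: complex assume "w \<in> ball 0 e"
          then have "w \<in> ball 0 e1" using e(2) by blast
          then have "dist (stereo (G (r n) w)) sphere_infinity < \<delta>" using elim inf by simp
          then have "2 / sqrt (1 + (cmod (G (r n) w))\<^sup>2) < \<delta>" by (simp add: dist_stereo_infinity)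
          moreover have s: "sqrt (1 + (cmod (G (r n) w))\<^sup>2) > 0" by (simp add: add_pos_nonneg)
          ultimately have "2 / \<delta> < sqrt (1 + (cmod (G (r n) w))\<^sup>2)" using d by (simp add: field_simps)
          then have "(2 / \<delta>)\<^sup>2 < (sqrt (1 + (cmod (G (r n) w))\<^sup>2))\<^sup>2"
            using d by (intro power_strict_mono) auto
          also have "\<dots> = 1 + (cmod (G (r n) w))\<^sup>2" by (simp add: add_nonneg_nonneg)
          finally have 1: "4 * (1 / \<delta>)\<^sup>2 < 1 + (cmod (G (r n) w))\<^sup>2" by (simp add: power_divide)
          have "1 \<le> (1 / \<delta>)\<^sup>2" using d by (intro one_le_power) auto
          then have "(1 / \<delta>)\<^sup>2 < (cmod (G (r n) w))\<^sup>2" using 1 by linarith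
          then have 2: "1 / \<delta> < cmod (G (r n) w)" by (rule power2_less_imp_less) simp
          then have nz: "G (r n) w \<noteq> 0" using d by (auto simp: not_less)
          have "inverse (cmod (G (r n) w)) < \<delta>"
            using 2 d nz by (simp add: field_simps)
          then show "G (r n) w \<noteq> 0 \<and> cmod (k n w) < \<epsilon>" using nz d by (simp add: k_def norm_inverse)
        qed
      qed
    qed
    have ul: "uniform_limit (ball 0 e) k (\<lambda>_. 0) sequentially"
    proof (rule uniform_limitI)
      fix \<epsilon> :: real assume "\<epsilon> > 0"
      from big[OF this] show "\<forall>\<^sub>F n in sequentially. \<forall>x\<in>ball 0 e. dist (k n x) 0 < \<epsilon>"
        by eventually_elim auto
    qed
    have holG: "G (r n) holomorphic_on ball 0 e" for n
      by (rule holomorphic_on_subset[OF hol_r subset_ball]) (simp add: e_def min_le_iff_disj)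
    have "\<forall>\<^sub>F n in sequentially. k n holomorphic_on ball 0 e"
      using big[of 1, OF zero_less_one]
    proof eventually_elim
      case (elim n)
      then show ?case unfolding k_def by (intro holomorphic_intros holG) auto
    qed
    then have "(\<lambda>n. deriv (k n) 0) \<longlonglongrightarrow> deriv (\<lambda>_. 0) 0"
      using e(1) by (intro deriv_complex_uniform_limit[OF ul]) auto
    then have "(\<lambda>n. cmod (deriv (k n) 0)) \<longlonglongrightarrow> 0" by (simp add: tendsto_norm_zero)
    then have "\<forall>\<^sub>F n in sequentially. cmod (deriv (k n) 0) < 1" by (rule order_tendstoD) simp
    moreover have "\<forall>\<^sub>F n in sequentially. \<not> cmod (deriv (k n) 0) < 1"
      using big[of 1, OF zero_less_one]
    proof eventually_elim
      case (elim n)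
      then have nz: "G (r n) 0 \<noteq> 0" using e(1) by auto
      have "(G (r n) has_field_derivative deriv (G (r n)) 0) (at 0)"
        using holomorphic_derivI[OF holG open_ball] e(1) by auto
      then have "deriv (k n) 0 = - (inverse (G (r n) 0) * deriv (G (r n)) 0 * inverse (G (r n) 0))"
        unfolding k_def using nz by (intro DERIV_imp_deriv DERIV_inverse')
      then have eq: "cmod (deriv (k n) 0) = cmod (deriv (G (r n)) 0) / (cmod (G (r n) 0))\<^sup>2"
        by (simp only: norm_minus_cancel norm_mult norm_inverse power2_eq_square divide_inverse
            inverse_mult_distrib mult_ac)
      \<comment> \<open>Dropping the 1 in the denominator of the spherical derivative leaves
        |G'|/|G|^2, which is the modulus of the derivative of 1/G.\<close>
      have "1 \<le> cmod (deriv (G (r n)) 0) / (1 + (cmod (G (r n) 0))\<^sup>2)"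
        using low_r[of n] by (simp add: sph_deriv_def)
      also have "\<dots> \<le> cmod (deriv (G (r n)) 0) / (cmod (G (r n) 0))\<^sup>2"
        using nz by (intro divide_left_mono mult_pos_pos add_pos_nonneg) auto
      finally show ?case using eq by simp
    qed
    ultimately have "\<forall>\<^sub>F n in sequentially. False" by eventually_elim simp
    then show ?thesis by simp
  qed
  from sphere_limit_dichotomy[of UNIV "\<lambda>n. G (r n)" \<phi>] lim hol_loc
  have "(\<forall>z. \<phi> z = sphere_infinity) \<or> (\<exists>g. g holomorphic_on UNIV \<and>
      (\<forall>z. \<exists>e>0. uniform_limit (ball z e) (\<lambda>n. G (r n)) g sequentially))"
    by (simp add: connected_UNIV) blast
  then obtain g where g: "g holomorphic_on UNIV"
    and limg: "\<And>z. \<exists>e>0. uniform_limit (ball z e) (\<lambda>n. G (r n)) g sequentially"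
    using not_inf by blast
  have ul: "uniform_limit (cball 0 R) (\<lambda>n. G (r n)) g sequentially" for R
    using limg by (intro uniform_limit_on_compact compact_cball) auto
  \<comment> \<open>The spherical derivative passes to the limit pointwise. So does its upper bound,
    and the lower bound at 0 makes the limit nonconstant.\<close>
  have sd: "(\<lambda>n. sph_deriv (G (r n)) z) \<longlonglongrightarrow> sph_deriv g z" for z
  proof -
    have z: "z \<in> cball 0 (cmod z)" "z \<in> ball 0 (cmod z + 1)" by auto
    have 1: "(\<lambda>n. G (r n) z) \<longlonglongrightarrow> g z" using tendsto_uniform_limitI[OF ul z(1)] .
    have 2: "(\<lambda>n. deriv (G (r n)) z) \<longlonglongrightarrow> deriv g z"
      using uniform_limit_on_subset[OF ul ball_subset_cball] hol_ev z(2)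
      by (intro deriv_complex_uniform_limit[where A = "ball 0 (cmod z + 1)"]) auto
    have nz: "1 + (cmod (g z))\<^sup>2 \<noteq> 0" by (smt (verit) zero_le_power2)
    show ?thesis unfolding sph_deriv_def using nz by (intro tendsto_intros 1 2)
  qed
  have "sph_deriv g z \<le> C" for z
  proof (rule tendsto_upperbound[OF sd])
    obtain N :: nat where N: "cmod z \<le> real N" using real_arch_simple by blast
    have "sph_deriv (G (r n)) z \<le> C" if "n \<ge> N" for n
    proof (rule C)
      have "real N \<le> real n" using that by simp
      then show "cmod z < real (r n) + 1" using N rn[of n] by linarith
    qed
    then show "\<forall>\<^sub>F n in sequentially. sph_deriv (G (r n)) z \<le> C" by (auto simp: eventually_sequentially)
  qed simp
  moreover have "\<not> g constant_on UNIV"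
  proof
    assume "g constant_on UNIV"
    then obtain c where "g = (\<lambda>_. c)" unfolding constant_on_def by auto
    then have "sph_deriv g 0 = 0" by (simp add: sph_deriv_def)
    moreover have "1 \<le> sph_deriv g 0"
      using tendsto_lowerbound[OF sd[of 0], of 1] low_r by simp
    ultimately show False by simp
  qed
  ultimately show ?thesis using that r g ul by blast
qed

text \<open>By Hurwitz, zeros of the approximating functions accumulate at z; their derivatives
  below order k vanish there, and uniform convergence with continuity carries this to z.\<close>

lemma limit_zeros_order_ge:
  assumes lim: "\<And>R. uniform_limit (cball 0 R) G g sequentially"
    and hol: "\<And>R. \<forall>\<^sub>F n in sequentially. G n holomorphic_on ball 0 R" and g: "g holomorphic_on UNIV"
    and nc: "\<not> g constant_on UNIV"
    and zeros: "\<And>n. zeros_order_ge k (G n) (ball 0 (real n + 1))"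
    and z: "g z = 0" and j: "j < k"
  shows "(deriv ^^ j) g z = 0"
proof (rule ccontr)
  assume "(deriv ^^ j) g z \<noteq> 0"
  define e where "e = cmod ((deriv ^^ j) g z) / 2"
  have e: "e > 0" using \<open>(deriv ^^ j) g z \<noteq> 0\<close> by (simp add: e_def)
  have "isCont ((deriv ^^ j) g) z"
    using holomorphic_higher_deriv[OF g open_UNIV] holomorphic_on_imp_continuous_on
    by (metis UNIV_I continuous_on_eq_continuous_at open_UNIV)
  then obtain d where d: "d > 0" "\<And>w. dist w z < d \<Longrightarrow> dist ((deriv ^^ j) g w) ((deriv ^^ j) g z) < e"
    using e unfolding continuous_at_eps_delta by blast
  define \<delta> where "\<delta> = min d 1"
  have \<delta>: "\<delta> > 0" "\<delta> \<le> d" "\<delta> \<le> 1" using d by (auto simp: \<delta>_def)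
  obtain N :: nat where N: "cmod z \<le> real N" using real_arch_simple by blast
  have "\<forall>\<^sub>F n in sequentially. \<exists>w\<in>ball z \<delta>. G n w = 0"
    by (rule Hurwitz_zero[OF lim hol g nc z \<delta>(1)])
  moreover have "\<forall>\<^sub>F n in sequentially. \<forall>w\<in>cball 0 (cmod z + 1). dist ((deriv ^^ j) (G n) w) ((deriv ^^ j) g w) < e"
    by (rule uniform_limitD[OF uniform_limit_higher_deriv[OF lim hol g] e])
  moreover have "\<forall>\<^sub>F n in sequentially. n \<ge> N" by (rule eventually_ge_at_top)
  ultimately have "\<forall>\<^sub>F n in sequentially. False"
  proof eventually_elim
    case (elim n)
    then obtain w where w: "w \<in> ball z \<delta>" "G n w = 0" by blast
    have wn: "cmod w < cmod z + 1"
      using w(1) \<delta>(3) norm_triangle_ineq2[of w z] by (simp add: dist_norm norm_minus_commute)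
    moreover have "real N \<le> real n" using elim by simp
    ultimately have "w \<in> ball 0 (real n + 1)" using N by simp
    then have "(deriv ^^ j) (G n) w = 0" using zeros w(2) j unfolding zeros_order_ge_def by blast
    moreover have "dist ((deriv ^^ j) (G n) w) ((deriv ^^ j) g w) < e" using elim(2) wn by simp
    moreover have "dist ((deriv ^^ j) g w) ((deriv ^^ j) g z) < e" using d(2) w(1) \<delta>(2) by (simp add: dist_commute)
    ultimately have "cmod ((deriv ^^ j) g z) < e + e"
      using norm_triangle_sub[of "(deriv ^^ j) g z" "(deriv ^^ j) g w"] by (simp add: dist_norm norm_minus_commute)
    then show False by (simp add: e_def)
  qed
  then show False by simp
qed

section \<open>Scale invariance of the monomial and the contradiction\<close>

lemma higher_deriv_rescaled:
  assumes hol: "f holomorphic_on S" and S: "open S" and "z0 + u * \<zeta> \<in> S"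
  shows "(deriv ^^ j) (\<lambda>\<zeta>. f (z0 + u * \<zeta>) / c) \<zeta> = u ^ j * (deriv ^^ j) f (z0 + u * \<zeta>) / c"
proof -
  define T where "T = (\<lambda>\<zeta>. u * \<zeta> + z0) -` S"
  have T: "open T" unfolding T_def by (intro open_vimage S continuous_intros)
  have zT: "\<zeta> \<in> T" using assms(3) by (simp add: T_def add.commute)
  have holT: "(\<lambda>\<zeta>. f (u * \<zeta> + z0)) holomorphic_on T"
    by (rule holomorphic_on_compose_gen[OF _ hol, unfolded o_def]) (auto simp: T_def intro!: holomorphic_intros)
  have "(deriv ^^ j) (\<lambda>\<zeta>. inverse c * f (u * \<zeta> + z0)) \<zeta> = inverse c * (deriv ^^ j) (\<lambda>\<zeta>. f (u * \<zeta> + z0)) \<zeta>"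
    by (rule higher_deriv_cmult[OF holT zT T])
  also have "(deriv ^^ j) (\<lambda>\<zeta>. f (u * \<zeta> + z0)) \<zeta> = u ^ j * (deriv ^^ j) f (u * \<zeta> + z0)"
    by (rule higher_deriv_compose_linear'[OF hol T S zT]) (simp add: T_def)
  finally show ?thesis by (simp add: divide_inverse add.commute mult_ac)
qed

text \<open>The exponent \<open>\<alpha> = p/q\<close> is chosen to make the differential monomial scale invariant.\<close>

lemma diff_monomial_rescaled:
  assumes hol: "f holomorphic_on S" and S: "open S" and z: "z0 + of_real (s ^ q) * \<zeta> \<in> S"
    and p: "p = (\<Sum>j=1..k. j * m j)" and q: "q = n + (\<Sum>j=1..k. m j)" and s: "s > 0"
  shows "diff_monomial n k m (\<lambda>\<zeta>. f (z0 + of_real (s ^ q) * \<zeta>) / of_real (s ^ p)) \<zeta> =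
     diff_monomial n k m f (z0 + of_real (s ^ q) * \<zeta>)"
proof -
  define u c w :: complex where "u = of_real (s ^ q)" and "c = of_real (s ^ p)" and "w = z0 + u * \<zeta>"
  have c: "c \<noteq> 0" using s by (simp add: c_def)
  \<comment> \<open>Differentiation contributes the factor u^p in total and the denominators c^q;
    both equal s^(pq), which is the balance behind the choice of p and q.\<close>
  have uc: "u ^ p = c ^ q" by (simp add: u_def c_def mult.commute flip: power_mult)
  have "diff_monomial n k m (\<lambda>\<zeta>. f (z0 + u * \<zeta>) / c) \<zeta> =
      (f w / c) ^ n * (\<Prod>j=1..k. (u ^ j * (deriv ^^ j) f w / c) ^ m j)"
    unfolding diff_monomial_def using higher_deriv_rescaled[OF hol S, of z0 u \<zeta> _ c] z by (simp add: w_def u_def)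
  also have "(\<Prod>j=1..k. (u ^ j * (deriv ^^ j) f w / c) ^ m j) =
      (\<Prod>j=1..k. (u ^ j) ^ m j) * (\<Prod>j=1..k. (deriv ^^ j) f w ^ m j) / (\<Prod>j=1..k. c ^ m j)"
    by (simp add: power_mult_distrib power_divide prod.distrib prod_dividef)
  also have "(\<Prod>j=1..k. (u ^ j) ^ m j) = u ^ p"
    unfolding p power_sum by (simp add: power_mult)
  also have "(\<Prod>j=1..k. c ^ m j) = c ^ (\<Sum>j=1..k. m j)"
    by (simp add: power_sum)
  also have "(f w / c) ^ n * (u ^ p * (\<Prod>j=1..k. (deriv ^^ j) f w ^ m j) / c ^ (\<Sum>j=1..k. m j)) =
     (f w ^ n * (\<Prod>j=1..k. (deriv ^^ j) f w ^ m j)) * (u ^ p / c ^ q)"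
    by (simp add: power_divide q power_add)
  also have "u ^ p / c ^ q = 1" using uc c by simp
  finally show ?thesis by (simp add: diff_monomial_def w_def u_def c_def)
qed

theorem corollary1p5:
  fixes a :: complex and n k :: nat and m :: "nat \<Rightarrow> nat"
    and D :: "complex set" and \<F> :: "(complex \<Rightarrow> complex) set"
  assumes "a \<noteq> 0"
    and "n \<ge> 1" and "k \<ge> 1" and "m k \<ge> 1" and "n * k \<ge> 2"
    and "open D" and "connected D" and "D \<noteq> {}"
    and "\<And>f. f \<in> \<F> \<Longrightarrow> f holomorphic_on D"
    and "\<And>f z. f \<in> \<F> \<Longrightarrow> z \<in> D \<Longrightarrow> f z = 0 \<Longrightarrow> zero_multiplicity f z \<ge> enat k"
    and "\<And>f g. f \<in> \<F> \<Longrightarrow> g \<in> \<F> \<Longrightarrow>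
           share_value_on D a (diff_monomial n k m f) (diff_monomial n k m g)"
  shows "normal_family_on D \<F>"
proof (rule normal_family_on_of_bounded_sph_deriv[OF \<open>open D\<close> \<open>connected D\<close> assms(9)])
  note hol = assms(9)
  have zeros: "zeros_order_ge k f D" if "f \<in> \<F>" for f
    using that assms(6,9,10) by (intro zero_multiplicity_ge_imp_zeros_order_ge) auto
  have holM: "diff_monomial n k m f holomorphic_on D" if "f \<in> \<F>" for f
    using hol[OF that] \<open>open D\<close> by (rule holomorphic_on_diff_monomial)
  have share: "diff_monomial n k m f z = a \<longleftrightarrow> diff_monomial n k m g z = a"
    if "f \<in> \<F>" "g \<in> \<F>" "z \<in> D" for f g z
  proof -
    have "\<not> is_pole (diff_monomial n k m h) z" if "h \<in> \<F>" for h
      using not_is_pole_holomorphic[OF \<open>open D\<close> \<open>z \<in> D\<close> holM[OF that]] .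
    then show ?thesis
      using assms(11)[OF that(1,2)] that by (auto simp: share_value_on_def set_eq_iff)
  qed
  fix z0 assume z0: "z0 \<in> D"
  show "\<exists>e>0. \<exists>M. ball z0 e \<subseteq> D \<and> (\<forall>f\<in>\<F>. \<forall>w\<in>ball z0 e. sph_deriv f w \<le> M)"
  proof (rule ccontr)
    assume "\<not> ?thesis"
    then have unbounded: "\<exists>f\<in>\<F>. \<exists>w\<in>ball z0 e. sph_deriv f w > M" if "e > 0" "ball z0 e \<subseteq> D" for e M
      using that not_le by metis
    obtain e0 where e0: "e0 > 0" "ball z0 e0 \<subseteq> D" using \<open>open D\<close> z0 open_contains_ball by blast
    \<comment> \<open>A fixed reference member: by sharing, its a-points are those of every member
      of the family.\<close>
    obtain f0 where f0: "f0 \<in> \<F>" using unbounded[OF e0] by blast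
    define W0 where "W0 = (\<lambda>z. diff_monomial n k m f0 z - a)"
    have holW0: "W0 holomorphic_on D" unfolding W0_def by (intro holomorphic_intros holM f0)
    \<comment> \<open>The identity theorem: either the monomial equals a throughout D, or no a-point
      other than z0 itself lies near z0.\<close>
    have "(\<forall>z\<in>D. W0 z = 0) \<or> (\<exists>d>0. \<forall>z\<in>ball z0 d. W0 z = 0 \<longrightarrow> z = z0)"
    proof (cases "W0 z0 = 0")
      case True
      then show ?thesis
        using isolated_zeros[OF holW0 \<open>open D\<close> \<open>connected D\<close> z0 True] by (metis Diff_iff singletonD)
    next
      case False
      have contW: "isCont W0 z0"
        using holW0 \<open>open D\<close> z0 by (auto dest!: holomorphic_on_imp_continuous_on simp: continuous_on_eq_continuous_at)
      then obtain d where "d > 0" "\<And>y. dist z0 y < d \<Longrightarrow> W0 y \<noteq> 0"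
        using continuous_at_avoid[OF contW False] by blast
      then show ?thesis by (metis mem_ball)
    qed
    then obtain d0 where d0: "d0 > 0" "(\<forall>z\<in>D. W0 z = 0) \<or> (\<forall>z\<in>ball z0 d0. W0 z = 0 \<longrightarrow> z = z0)"
      by (metis zero_less_one)
    define d where "d = min 1 (min d0 e0) / 2"
    have d: "d > 0" "d \<le> 1" "d < d0" "d < e0" using d0 e0 by (auto simp: d_def)
    have cD: "cball z0 d \<subseteq> D" using d(4) e0(2) by (auto simp: subset_iff)
    define p q where "p = (\<Sum>j=1..k. j * m j)" and "q = n + (\<Sum>j=1..k. m j)"
    have "k * m k \<le> p" unfolding p_def using assms(3) by (intro member_le_sum) auto
    then have p: "p > 0" using assms(3,4) by (metis less_le_trans nat_0_less_mult_iff zero_less_one)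
    have "p \<le> (\<Sum>j=1..k. k * m j)" unfolding p_def by (intro sum_mono) auto
    \<comment> \<open>The strict inequality is the contribution k n > 0 of the undifferentiated
      factor.\<close>
    also have "\<dots> < k * q" using assms(2,3) by (simp add: q_def distrib_left flip: sum_distrib_left)
    finally have pq: "p < k * q" .
    define C :: real where "C = 2 ^ (q + 3 * p)"
    have "\<exists>f z s. f \<in> \<F> \<and> 0 < s \<and> scaled_sph_deriv p q f z s \<ge> 1 \<and>
        (\<forall>\<zeta>. cmod \<zeta> \<le> real N + 1 \<longrightarrow> z + of_real (s ^ q) * \<zeta> \<in> ball z0 d \<and>
             scaled_sph_deriv p q f (z + of_real (s ^ q) * \<zeta>) s \<le> C)" for N
    proof -
      \<comment> \<open>The N-th function is chosen with spherical derivative large enough for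
        rescaling to the radius N + 1, so the domains exhaust the plane.\<close>
      obtain f w where fw: "f \<in> \<F>" "w \<in> ball z0 (d / 2)" "sph_deriv f w > (4 * (real N + 1) / d) ^ (p + q)"
        using unbounded[of "d / 2" "(4 * (real N + 1) / d) ^ (p + q)"] d cD by (auto simp: subset_iff)
      obtain z s where "0 < s" "scaled_sph_deriv p q f z s \<ge> 1"
        "\<And>\<zeta>. cmod \<zeta> \<le> real N + 1 \<Longrightarrow> z + of_real (s ^ q) * \<zeta> \<in> ball z0 d \<and>
             scaled_sph_deriv p q f (z + of_real (s ^ q) * \<zeta>) s \<le> C"
        using rescaling[OF hol[OF fw(1)] \<open>open D\<close> cD d(1,2) zeros[OF fw(1)] \<open>k \<ge> 1\<close> pq p _ fw(2,3)]
        unfolding C_def by (metis le_add_same_cancel2 of_nat_0_le_iff)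
      then show ?thesis using fw(1) by blast
    qed
    then obtain f z s where fF: "\<And>N. f N \<in> \<F>" and s: "\<And>N. s N > 0"
      and sd1: "\<And>N. scaled_sph_deriv p q (f N) (z N) (s N) \<ge> 1"
      and inb: "\<And>N \<zeta>. cmod \<zeta> \<le> real N + 1 \<Longrightarrow> z N + of_real (s N ^ q) * \<zeta> \<in> ball z0 d"
      and sdC: "\<And>N \<zeta>. cmod \<zeta> \<le> real N + 1 \<Longrightarrow> scaled_sph_deriv p q (f N) (z N + of_real (s N ^ q) * \<zeta>) (s N) \<le> C"
      by metis
    define G where "G = (\<lambda>N \<zeta>. f N (z N + of_real (s N ^ q) * \<zeta>) / of_real (s N ^ p))"
    have inD: "z N + of_real (s N ^ q) * \<zeta> \<in> D" if "cmod \<zeta> \<le> real N + 1" for N \<zeta>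
      using inb[OF that] cD ball_subset_cball by blast
    have holG: "G N holomorphic_on ball 0 (real N + 1)" for N
      unfolding G_def
    proof (intro holomorphic_intros)
      show "(\<lambda>\<zeta>. f N (z N + of_real (s N ^ q) * \<zeta>)) holomorphic_on ball 0 (real N + 1)"
        by (rule holomorphic_on_compose_gen[OF _ hol[OF fF], unfolded o_def])
          (use inD in \<open>auto intro!: holomorphic_intros\<close>)
      show "of_real (s N ^ p) \<noteq> (0::complex)" using s[of N] by simp
    qed
    have sdG: "sph_deriv (G N) \<zeta> = scaled_sph_deriv p q (f N) (z N + of_real (s N ^ q) * \<zeta>) (s N)"
      if "cmod \<zeta> \<le> real N + 1" for N \<zeta>
      unfolding G_def using inD[OF that] hol[OF fF] \<open>open D\<close> s
      by (intro sph_deriv_rescaled holomorphic_on_imp_differentiable_at) auto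
    have zerosG: "zeros_order_ge k (G N) (ball 0 (real N + 1))" for N
      unfolding zeros_order_ge_def
    proof (intro ballI impI allI)
      fix \<zeta> j assume \<zeta>: "\<zeta> \<in> ball (0::complex) (real N + 1)" "G N \<zeta> = 0" and j: "j < k"
      have zD: "z N + of_real (s N ^ q) * \<zeta> \<in> D" using inD \<zeta>(1) by simp
      moreover have "f N (z N + of_real (s N ^ q) * \<zeta>) = 0" using \<zeta>(2) s[of N] by (simp add: G_def)
      ultimately have "(deriv ^^ j) (f N) (z N + of_real (s N ^ q) * \<zeta>) = 0"
        using zeros[OF fF[of N]] j by (auto simp: zeros_order_ge_def)
      then show "(deriv ^^ j) (G N) \<zeta> = 0"
        unfolding G_def using higher_deriv_rescaled[OF hol[OF fF] \<open>open D\<close> zD] by simp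
    qed
    have MG: "diff_monomial n k m (G N) \<zeta> = diff_monomial n k m (f N) (z N + of_real (s N ^ q) * \<zeta>)"
      if "cmod \<zeta> \<le> real N + 1" for N \<zeta>
      unfolding G_def by (rule diff_monomial_rescaled[OF hol[OF fF] \<open>open D\<close> inD[OF that] p_def q_def s])
    obtain r g where r: "strict_mono (r :: nat \<Rightarrow> nat)" and g: "g holomorphic_on UNIV" and nc: "\<not> g constant_on UNIV"
      and gC: "\<And>z. sph_deriv g z \<le> C" and lim: "\<And>R. uniform_limit (cball 0 R) (\<lambda>n. G (r n)) g sequentially"
    proof (rule entire_limit_of_bounded_sph_deriv[of G C])
      show "sph_deriv (G N) \<zeta> \<le> C" if "cmod \<zeta> < real N + 1" for N \<zeta>
        using sdG[of \<zeta> N] sdC[of \<zeta> N] that by simp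
      show "1 \<le> sph_deriv (G N) 0" for N using sdG[of 0 N] sd1[of N] by simp
    qed (use holG in auto)
    have rn: "real N \<le> real (r N)" for N using seq_suble[OF r, of N] by simp
    have holGr: "\<forall>\<^sub>F N in sequentially. G (r N) holomorphic_on ball 0 R" for R
    proof -
      obtain L :: nat where L: "R \<le> real L" using real_arch_simple by blast
      have "G (r N) holomorphic_on ball 0 R" if "N \<ge> L" for N
      proof (rule holomorphic_on_subset[OF holG subset_ball])
        have "real L \<le> real N" using that by simp
        then show "R \<le> real (r N) + 1" using L rn[of N] by linarith
      qed
      then show ?thesis by (auto simp: eventually_sequentially)
    qed
    have zerosGr: "zeros_order_ge k (G (r N)) (ball 0 (real N + 1))" for N
      using zerosG[of "r N"] rn[of N] by (auto simp: zeros_order_ge_def)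
    have zg: "(deriv ^^ j) g w = 0" if "g w = 0" "j < k" for w j
      by (rule limit_zeros_order_ge[OF lim holGr g nc zerosGr that])
    have et: "exponential_type g" by (rule exponential_type_of_bounded_sph_deriv[OF g gC nc])
    define W where "W = diff_monomial n k m g"
    have ncW: "\<not> W constant_on UNIV"
      unfolding W_def by (rule diff_monomial_not_constant[OF g et nc zg assms(2,3,5)])
    obtain x y where xy: "x \<noteq> y" "W x = a" "W y = a"
      using diff_monomial_two_a_points[OF g et nc zg assms(2,3,5) \<open>a \<noteq> 0\<close>, of m] unfolding W_def by blast
    have holW: "W holomorphic_on UNIV" unfolding W_def by (rule holomorphic_on_diff_monomial[OF g open_UNIV])
    have limW: "uniform_limit (cball 0 R) (\<lambda>N. diff_monomial n k m (G (r N))) W sequentially" for R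
      unfolding W_def by (rule uniform_limit_diff_monomial[OF lim holGr g])
    \<comment> \<open>Sharing and scale invariance together: the a-points of the rescaled monomial
      are the preimages of those of the reference member.\<close>
    have Wa: "W0 (z (r N) + of_real (s (r N) ^ q) * \<zeta>) = 0 \<longleftrightarrow> diff_monomial n k m (G (r N)) \<zeta> = a"
      if "cmod \<zeta> \<le> real N + 1" for N \<zeta>
    proof -
      have *: "cmod \<zeta> \<le> real (r N) + 1" using that rn[of N] by linarith
      show ?thesis unfolding W0_def using share[OF f0 fF inD[OF *], of "r N"] MG[OF *] by simp
    qed
    from d0(2) show False
    proof
      assume all: "\<forall>z\<in>D. W0 z = 0"
      have "W \<zeta> = a" for \<zeta>
      proof -
        have "(\<lambda>N. diff_monomial n k m (G (r N)) \<zeta>) \<longlonglongrightarrow> W \<zeta>"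
          by (rule tendsto_uniform_limitI[OF limW, of _ "cmod \<zeta>"]) simp
        moreover have "\<forall>\<^sub>F N in sequentially. diff_monomial n k m (G (r N)) \<zeta> = a"
        proof -
          obtain L :: nat where L: "cmod \<zeta> \<le> real L" using real_arch_simple by blast
          have "diff_monomial n k m (G (r N)) \<zeta> = a" if "N \<ge> L" for N
          proof -
            have "real L \<le> real N" using that by simp
            then have "cmod \<zeta> \<le> real N + 1" "cmod \<zeta> \<le> real (r N) + 1" using L rn[of N] by linarith+
            then show ?thesis using Wa all inD by blast
          qed
          then show ?thesis by (auto simp: eventually_sequentially)
        qed
        then have "(\<lambda>N. diff_monomial n k m (G (r N)) \<zeta>) \<longlonglongrightarrow> a" by (rule tendsto_eventually)
        ultimately show ?thesis using LIMSEQ_unique by blast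
      qed
      then show False using ncW unfolding constant_on_def by blast
    next
      assume iso: "\<forall>z\<in>ball z0 d0. W0 z = 0 \<longrightarrow> z = z0"
      define H where "H = (\<lambda>N \<zeta>. diff_monomial n k m (G (r N)) \<zeta> - a)"
      have limH: "uniform_limit (cball 0 R) H (\<lambda>\<zeta>. W \<zeta> - a) sequentially" for R
        unfolding H_def by (intro uniform_limit_intros limW)
      have holH: "\<forall>\<^sub>F N in sequentially. H N holomorphic_on ball 0 R" for R
        unfolding H_def using holGr[of R]
        by eventually_elim (intro holomorphic_intros holomorphic_on_diff_monomial open_ball)
      have holWa: "(\<lambda>\<zeta>. W \<zeta> - a) holomorphic_on UNIV" by (intro holomorphic_intros holW)
      have ncWa: "\<not> (\<lambda>\<zeta>. W \<zeta> - a) constant_on UNIV"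
        using ncW unfolding constant_on_def by (metis diff_add_cancel)
      \<comment> \<open>With this radius the discs about x and y are disjoint, so a point common to
        both gives the contradiction.\<close>
      define e where "e = dist x y / 2"
      have e: "e > 0" using xy by (simp add: e_def)
      obtain L :: nat where L: "cmod x + cmod y + e \<le> real L" using real_arch_simple by blast
      have "\<forall>\<^sub>F N in sequentially. \<exists>w\<in>ball x e. H N w = 0"
        by (rule Hurwitz_zero[OF limH holH holWa ncWa _ e]) (use xy in simp)
      moreover have "\<forall>\<^sub>F N in sequentially. \<exists>w\<in>ball y e. H N w = 0"
        by (rule Hurwitz_zero[OF limH holH holWa ncWa _ e]) (use xy in simp)
      moreover have "\<forall>\<^sub>F N in sequentially. N \<ge> L" by (rule eventually_ge_at_top)
      ultimately have "\<forall>\<^sub>F N in sequentially. False"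
      proof eventually_elim
        case (elim N)
        obtain x' y' where x': "x' \<in> ball x e" "H N x' = 0" and y': "y' \<in> ball y e" "H N y' = 0"
          using elim by blast
        have LN: "real L \<le> real N" using elim by simp
        have small: "cmod v \<le> real N + 1" if "v \<in> ball x e \<union> ball y e" for v
        proof -
          have "cmod (v - x) < e \<or> cmod (v - y) < e"
            using that by (auto simp: dist_norm norm_minus_commute)
          then show ?thesis
            using LN L norm_triangle_ineq2[of v x] norm_triangle_ineq2[of v y] norm_ge_zero[of x] norm_ge_zero[of y]
            by (elim disjE) linarith+
        qed
        \<comment> \<open>The change of variable lands in the disc where z0 is the only possible
          a-point; being injective, it cannot send two different a-points there.\<close>
        have hit: "z (r N) + of_real (s (r N) ^ q) * v = z0" if v: "v \<in> ball x e \<union> ball y e" "H N v = 0" for v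
        proof -
          have "W0 (z (r N) + of_real (s (r N) ^ q) * v) = 0"
            using Wa[OF small[OF v(1)]] v(2) by (simp add: H_def)
          moreover have "z (r N) + of_real (s (r N) ^ q) * v \<in> ball z0 d0"
            using inb[of v "r N"] small[OF v(1)] rn[of N] d(3) by auto
          ultimately show ?thesis using iso by blast
        qed
        have "of_real (s (r N) ^ q) * x' = of_real (s (r N) ^ q) * y'"
          using hit[of x'] hit[of y'] x' y' by (metis UnI1 UnI2 add_left_cancel)
        then have "x' = y'" using s[of "r N"] by simp
        then have "dist x y < e + e" using x'(1) y'(1) dist_triangle[of x y x'] by (simp add: dist_commute)
        then show False by (simp add: e_def)
      qed
      then show False by simp
    qed
  qed
qed

end
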